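(* Let $P$ be a Borel probability measure on $\mathbb{R}_+$ with finite mean $\mu\neq0$, Laplace transform $\phi(t)=\int_{\mathbb{R}_+}e^{-tx}P(dx)$, and $\mathbf{p}_0:=P(\{0\})$. Let $\mathbf{w}^{(n)}=(w_1^{(n)},\ldots,w_n^{(n)})$, $n\in\mathbb{N}$, be (random or deterministic) vectors satisfying LLN-$P^-$ or LLN-$P^+$ (defined in the context), and let $S^{(n)}(t)$ be the search-cost, and $S_{\mathbf{o}}^{(n)}(t)$ its out-of-equilibrium part, in the move-to-front Markov chain with popularities $p^{(n)}_i=w^{(n)}_i/\sum_{j=1}^n w^{(n)}_j$. Define functions $g_t$ and $\widetilde{g_t}$ by $$g_t(y)=\int_0^ye^{-zt}P(dz)\quad\text{and}\quad\widetilde{g_t}(y)=g_t^{-1}(1-y)\qquad\text{if LLN-}P^-\text{ holds},$$ or by $$g_t(y)=\int_{y^+}^\infty e^{-zt}P(dz)\quad\text{and}\quad\widetilde{g_t}(y)=(1-g_t)^{-1}(y)\qquad\text{if LLN-}P^+\text{ holds},$$ where $g^{-1}$ stands for the generalized inverse of a nondecreasing right-continuous function $g$. Let $S^{(\infty)}$ be a random variable in $[0,1]$ with density $$f_{S^{(\infty)}}(x)=-\frac1\mu\,\frac{\phi''(\phi^{-1}(1-x))}{\phi'(\phi^{-1}(1-x))}\,\mathbf{1}_{[0,1-\mathbf{p}_0]}(x).$$ Then, under LLN-$P^-$ or LLN-$P^+$, for each $t>0$ we have the convergence in distribution, as $n\to\infty$, $$\frac{S^{(n)}(n\mu t)}{n}\longrightarrow^dS(t),$$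 where $S(t)$ has the density $$f_{S(t)}(x)=\mathbf{1}_{[0,1-\phi(t)]}(x)f_{S^{(\infty)}}(x)+\mathbf{1}_{[1-\phi(t),1]}(x)\,\frac1\mu\,\widetilde{g_t}(x).$$ Moreover, when $n\to\infty$, $$\mathbb{P}\bigl(S_{\mathbf{o}}^{(n)}(n\mu t)>0\bigr)\longrightarrow\mathbb{P}\bigl(S(t)>1-\phi(t)\bigr)=\mathbb{P}\bigl(S^{(\infty)}>1-\phi(t)\bigr)=\frac{|\phi'(t)|}{\mu},$$ and for all $t\geq0$, $\bigl\|\mathrm{law}(S(t))-\mathrm{law}(S^{(\infty)})\bigr\|_{\mathrm{TV}}\le2\,\frac{|\phi'(t)|}{\mu}$.
   Context: The generalized inverse is $g^{-1}(x):=\inf\{s\ge0: g(s)\ge x\}$. $\int_{y^+}^\infty$ denotes integration over $(y,\infty)$ and $\int_0^y$ integration over $[0,y]$. The total variation norm is normalized so that for laws with densities $f,h$ it equals $\int|f-h|\,dx$. $\phi^{-1}$ denotes the inverse of the strictly decreasing function $\phi:[0,\infty)\to(\mathbf{p}_0,1]$; densities are understood up to Lebesgue-null sets. For $t=0$, $S(0)$ denotes a random variable with the density given by the same formula at $t=0$. Condition LLN-$P$. A sequence of random or deterministic vectors $\mathbf{w}^{(n)}=(w_1^{(n)},\ldots,w_n^{(n)})$, $n\in\mathbb{N}$, with nonnegative coordinates satisfies LLN-$P$, where $P$ is a Borel probability measure on $\mathbb{R}_+=[0,\infty)$ with finite first moment $\mu\neq0$, if there exist positive random variables $Z_n$ (with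 $Z_n$ defined on the same probability space as $\mathbf{w}^{(n)}$) such that the random probability measures $\hat\nu^{(n)}:=\frac1n\sum_{i=1}^n\delta_{Z_nw_i^{(n)}}$ converge in law to the deterministic limit $P$ (as random elements of the space $\mathcal{P}(\mathbb{R}_+)$ of Borel probability measures with the weak topology), and the empirical means $\frac1n\sum_{i=1}^nZ_nw_i^{(n)}$ converge in law to $\mu$. Move-to-front chain. Let $p_i^{(n)}:=w_i^{(n)}/\sum_{j=1}^nw_j^{(n)}$ (convention $0/0:=0$). Objects labeled $1,\ldots,n$ are kept in a list; at time $0$ object $i$ is at position $\pi(i)$, where $\pi$ is some permutation of $\{1,\ldots,n\}$ (position $1$ is the front of the list). Conditionally on $\mathbf{w}^{(n)}$, object $i$ is requested at the instants of a Poisson process on $[0,\infty)$ of rate $p_i^{(n)}$, independently for different $i$. Instantaneously after a request the requested object is moved to the front of the list, the relative order of the other objects being unchanged. $N_t$ is the total number of requests up to time $t$, and $I_k\in\{1,\ldots,n\}$ is the label of the $k$-th requested object, so that $I_{N_{t^-}+1}$ is the first object requested in $[t,\infty)$. $S^{(n,i)}(t)$ is the position of object $i$ at time $t$ (left-continuous in $t$: a request occurring exactly at time $t$ has not yet modified the list). The search-cost is $S^{(n)}(t):=\sum_{i=1}^nS^{(n,i)}(t)\mathbf{1}_{\{I_{N_{t^-}+1}=i\}}$; if all $w_j^{(n)}$ are zero there are no requests and $S^{(n)}(t)=0$. $R_t$ is the set of objects requested at least once in $[0,t)$. The out-of-equilibrium part of the search-cost is $S_{\mathbf{o}}^{(n)}(t):=S^{(n)}(t)\mathbf{1}_{\{I_{N_{t^-}+1}\notin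 R_t\}}$. LLN-$P^-$: LLN-$P$ holds, $\pi$ is the identity, and for each $n$ the vector $\mathbf{w}^{(n)}$ is a.s. decreasing, i.e. $w_1^{(n)}\ge\cdots\ge w_n^{(n)}$. LLN-$P^+$: LLN-$P$ holds, $\pi$ is the identity, and for each $n$ the vector $\mathbf{w}^{(n)}$ is a.s. increasing, i.e. $w_1^{(n)}\le\cdots\le w_n^{(n)}$. *)

theory Defs
  imports "HOL-Probability.Probability"
begin

section \<open>Laws on the half-line and modes of convergence\<close>

text \<open>Borel probability measures on $[0,\infty)$ are represented as Borel probability measures on
  the real line that charge only $[0,\infty)$.\<close>

definition nonneg_distributions :: "real measure set" where
  "nonneg_distributions = {Q. real_distribution Q \<and> (AE x in Q. 0 \<le> x)}"

text \<open>The coarsest topology making all integrals of bounded continuous functions continuous. Every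
  bounded continuous function on $[0,\infty)$ extends to one on the real line, so test functions on
  the line suffice.\<close>

definition weak_topology :: "real measure topology" where
  "weak_topology = topology_generated_by
     {{Q \<in> nonneg_distributions. (\<integral>x. f x \<partial>Q) \<in> U} | (f :: real \<Rightarrow> real) U.
        continuous_on UNIV f \<and> bounded (range f) \<and> open U}"

lemma topspace_weak_topology: "topspace weak_topology = nonneg_distributions"
proof -
  have "nonneg_distributions \<in> {{Q \<in> nonneg_distributions. (\<integral>x. f x \<partial>Q) \<in> U} | (f :: real \<Rightarrow> real) U.
        continuous_on UNIV f \<and> bounded (range f) \<and> open U}"
    by (auto intro!: exI[of _ "\<lambda>_. 0"] exI[of _ UNIV])
  then show ?thesis
    unfolding weak_topology_def topology_generated_by_topspace by blast
qed

text \<open>Convergence in law of random elements \<open>Y n\<close> of a topological space, living on probability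
  spaces \<open>M n\<close>, to the constant \<open>l\<close>.\<close>

definition converges_in_law_to_const ::
  "'b topology \<Rightarrow> (nat \<Rightarrow> 'a measure) \<Rightarrow> (nat \<Rightarrow> 'a \<Rightarrow> 'b) \<Rightarrow> 'b \<Rightarrow> bool" where
  "converges_in_law_to_const X M Y l \<longleftrightarrow>
     (\<forall>F :: 'b \<Rightarrow> real. continuous_map X euclideanreal F \<and> bounded (F ` topspace X) \<longrightarrow>
        (\<lambda>n. \<integral>\<omega>. F (Y n \<omega>) \<partial>M n) \<longlonglongrightarrow> F l)"

text \<open>The measure $\frac1n\sum_{i=1}^n\delta_{x_i}$.\<close>

definition empirical_measure :: "nat \<Rightarrow> (nat \<Rightarrow> real) \<Rightarrow> real measure" where
  "empirical_measure n x = distr (uniform_count_measure {1..n}) borel x"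

text \<open>Total variation norm of the difference of two probability measures, normalized so that two
  mutually singular laws are at distance 2.\<close>

definition tv_norm_diff :: "'a measure \<Rightarrow> 'a measure \<Rightarrow> real" where
  "tv_norm_diff M N = 2 * (SUP A\<in>sets M. \<bar>measure M A - measure N A\<bar>)"

definition probability_density :: "(real \<Rightarrow> real) \<Rightarrow> bool" where
  "probability_density f \<longleftrightarrow>
     f \<in> borel_measurable borel \<and> (AE x in lborel. 0 \<le> f x) \<and> (\<integral>\<^sup>+x. ennreal (f x) \<partial>lborel) = 1"

lemma probability_density_measure:
  assumes "probability_density f" and A: "A \<in> sets borel"
  shows "measure (density lborel (\<lambda>x. ennreal (f x))) A = (LINT x:A|lborel. f x)"
    and "integrable lborel f" and "(\<integral>x. f x \<partial>lborel) = 1"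
proof -
  have m[measurable]: "f \<in> borel_measurable lborel" and nn: "AE x in lborel. 0 \<le> f x"
    and i: "(\<integral>\<^sup>+x. ennreal (f x) \<partial>lborel) = 1"
    using assms by (auto simp: probability_density_def)
  show int: "integrable lborel f"
    using nn i by (intro integrableI_nonneg) auto
  show "(\<integral>x. f x \<partial>lborel) = 1"
    using nn i by (simp add: integral_eq_nn_integral)
  have nnA: "AE x in lborel. 0 \<le> indicator A x *\<^sub>R f x"
    using nn by eventually_elim (auto simp: indicator_def)
  have "emeasure (density lborel (\<lambda>x. ennreal (f x))) A = (\<integral>\<^sup>+x. ennreal (indicator A x *\<^sub>R f x) \<partial>lborel)"
    using A by (subst emeasure_density) (auto intro!: nn_integral_cong simp: indicator_def)
  then show "measure (density lborel (\<lambda>x. ennreal (f x))) A = (LINT x:A|lborel. f x)"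
    using A nnA unfolding measure_def set_lebesgue_integral_def
    by (subst integral_eq_nn_integral) auto
qed

lemma tv_norm_diff_density:
  assumes f: "probability_density f" and h: "probability_density h"
  shows "tv_norm_diff (density lborel (\<lambda>x. ennreal (f x))) (density lborel (\<lambda>x. ennreal (h x)))
           = (\<integral>x. \<bar>f x - h x\<bar> \<partial>lborel)"
proof -
  let ?M = "density lborel (\<lambda>x. ennreal (f x))" and ?N = "density lborel (\<lambda>x. ennreal (h x))"
  define s where "s x = f x - h x" for x
  note F = probability_density_measure[OF f] and H = probability_density_measure[OF h]
  have s: "integrable lborel s" and s0: "(\<integral>x. s x \<partial>lborel) = 0"
    using F(2,3)[of "{}"] H(2,3)[of "{}"] unfolding s_def by auto
  then have sm[measurable]: "s \<in> borel_measurable borel" by auto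
  have abs_s: "integrable lborel (\<lambda>x. \<bar>s x\<bar>)" using s by auto
  have diff: "measure ?M A - measure ?N A = (LINT x:A|lborel. s x)" if A: "A \<in> sets borel" for A
  proof -
    have "set_integrable lborel A f" "set_integrable lborel A h"
      using F(2)[of "{}"] H(2)[of "{}"] A unfolding set_integrable_def
      by (auto intro: integrable_mult_indicator simp del: real_scaleR_def)
    then show ?thesis using F(1)[OF A] H(1)[OF A] unfolding s_def by simp
  qed
  have bd: "\<bar>measure ?M A - measure ?N A\<bar> \<le> (\<integral>x. \<bar>s x\<bar> \<partial>lborel) / 2" if A: "A \<in> sets borel" for A
  proof -
    have i1: "integrable lborel (\<lambda>x. indicator A x *\<^sub>R s x)"
      using s A by (intro integrable_mult_indicator) auto
    have "2 * (LINT x:A|lborel. s x) = (\<integral>x. 2 * (indicator A x *\<^sub>R s x) - s x \<partial>lborel)"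
      using i1 s s0 by (simp add: set_lebesgue_integral_def)
    also have "\<bar>\<dots>\<bar> \<le> (\<integral>x. \<bar>2 * (indicator A x *\<^sub>R s x) - s x\<bar> \<partial>lborel)"
      using integral_norm_bound[of lborel "\<lambda>x. 2 * (indicator A x *\<^sub>R s x) - s x"] by simp
    also have "\<dots> = (\<integral>x. \<bar>s x\<bar> \<partial>lborel)"
      by (intro Bochner_Integration.integral_cong) (auto simp: indicator_def)
    finally show ?thesis using diff[OF A] by simp
  qed
  let ?B = "{x. 0 < s x}"
  have B: "?B \<in> sets borel" by measurable
  have at: "\<bar>measure ?M ?B - measure ?N ?B\<bar> = (\<integral>x. \<bar>s x\<bar> \<partial>lborel) / 2"
  proof -
    have i1: "integrable lborel (\<lambda>x. indicator ?B x *\<^sub>R s x)"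
      using s B by (intro integrable_mult_indicator) auto
    have "2 * (LINT x:?B|lborel. s x) = (\<integral>x. 2 * (indicator ?B x *\<^sub>R s x) - s x \<partial>lborel)"
      using i1 s s0 by (simp add: set_lebesgue_integral_def)
    also have "\<dots> = (\<integral>x. \<bar>s x\<bar> \<partial>lborel)"
      by (intro Bochner_Integration.integral_cong) (auto simp: indicator_def)
    finally have "2 * (measure ?M ?B - measure ?N ?B) = (\<integral>x. \<bar>s x\<bar> \<partial>lborel)"
      using diff[OF B] by simp
    moreover have "0 \<le> (\<integral>x. \<bar>s x\<bar> \<partial>lborel)" by simp
    moreover have "\<bar>d\<bar> = c / 2" if "2 * d = c" "0 \<le> c" for c d :: real
      using that by linarith
    ultimately show ?thesis by blast
  qed
  have "(SUP A\<in>sets ?M. \<bar>measure ?M A - measure ?N A\<bar>) = (\<integral>x. \<bar>s x\<bar> \<partial>lborel) / 2"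
  proof (rule cSup_eq_maximum)
    show "(\<integral>x. \<bar>s x\<bar> \<partial>lborel) / 2 \<in> (\<lambda>A. \<bar>measure ?M A - measure ?N A\<bar>) ` sets ?M"
      using at B by (intro image_eqI[of _ _ ?B]) auto
  qed (use bd in auto)
  then show ?thesis unfolding tv_norm_diff_def s_def by simp
qed


section \<open>The move-to-front chain\<close>

text \<open>\<open>T i\<close> is the set of instants at which object \<open>i\<close> is requested.\<close>

definition request_times :: "nat \<Rightarrow> (nat \<Rightarrow> real set) \<Rightarrow> real set" where
  "request_times n T = (\<Union>i\<in>{1..n}. T i)"

text \<open>\<open>num_requests_before\<close> is the left limit $N_{t^-}$ of the counting process $N_t$.\<close>

definition num_requests :: "nat \<Rightarrow> (nat \<Rightarrow> real set) \<Rightarrow> real \<Rightarrow> nat" where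
  "num_requests n T t = card (request_times n T \<inter> {0..t})"

definition num_requests_before :: "nat \<Rightarrow> (nat \<Rightarrow> real set) \<Rightarrow> real \<Rightarrow> nat" where
  "num_requests_before n T t = card (request_times n T \<inter> {0..<t})"

text \<open>The label of the \<open>k\<close>-th requested object (\<open>k \<ge> 1\<close>), or \<open>None\<close> if there are fewer than \<open>k\<close>
  requests. Simultaneous requests, which have probability zero, are resolved in favour of the least
  label.\<close>

definition request_label :: "nat \<Rightarrow> (nat \<Rightarrow> real set) \<Rightarrow> nat \<Rightarrow> nat option" where
  "request_label n T k =
     (if \<exists>i\<in>{1..n}. \<exists>s\<in>T i. num_requests n T s = k
      then Some (LEAST i. i \<in> {1..n} \<and> (\<exists>s\<in>T i. num_requests n T s = k))
      else None)"

text \<open>A list is encoded by the function mapping each object to its position (the front is 1).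
  Moving \<open>j\<close> to the front shifts back by one exactly the objects that preceded \<open>j\<close>.\<close>

definition move_to_front :: "nat \<Rightarrow> (nat \<Rightarrow> nat) \<Rightarrow> nat \<Rightarrow> nat" where
  "move_to_front j pos i = (if i = j then 1 else if pos i < pos j then pos i + 1 else pos i)"

primrec position_after ::
  "nat \<Rightarrow> (nat \<Rightarrow> nat) \<Rightarrow> (nat \<Rightarrow> real set) \<Rightarrow> nat \<Rightarrow> nat \<Rightarrow> nat" where
  "position_after n \<pi> T 0 = \<pi>"
| "position_after n \<pi> T (Suc k) =
     (case request_label n T (Suc k) of
        None \<Rightarrow> position_after n \<pi> T k
      | Some j \<Rightarrow> move_to_front j (position_after n \<pi> T k))"

definition position_at ::
  "nat \<Rightarrow> (nat \<Rightarrow> nat) \<Rightarrow> (nat \<Rightarrow> real set) \<Rightarrow> real \<Rightarrow> nat \<Rightarrow> nat" where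
  "position_at n \<pi> T t = position_after n \<pi> T (num_requests_before n T t)"

definition next_label :: "nat \<Rightarrow> (nat \<Rightarrow> real set) \<Rightarrow> real \<Rightarrow> nat option" where
  "next_label n T t = request_label n T (num_requests_before n T t + 1)"

definition search_cost :: "nat \<Rightarrow> (nat \<Rightarrow> nat) \<Rightarrow> (nat \<Rightarrow> real set) \<Rightarrow> real \<Rightarrow> nat" where
  "search_cost n \<pi> T t =
     (\<Sum>i\<in>{1..n}. position_at n \<pi> T t i * of_bool (next_label n T t = Some i))"

definition requested_before :: "nat \<Rightarrow> (nat \<Rightarrow> real set) \<Rightarrow> real \<Rightarrow> nat set" where
  "requested_before n T t = {i \<in> {1..n}. T i \<inter> {0..<t} \<noteq> {}}"

definition search_cost_out :: "nat \<Rightarrow> (nat \<Rightarrow> nat) \<Rightarrow> (nat \<Rightarrow> real set) \<Rightarrow> real \<Rightarrow> nat" where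
  "search_cost_out n \<pi> T t =
     search_cost n \<pi> T t * of_bool (next_label n T t \<notin> Some ` requested_before n T t)"

text \<open>Conditionally on the sub-sigma-algebra \<open>G\<close>, the locally finite random subsets \<open>T i\<close>
  (\<open>i \<in> I\<close>) of $[0,\infty)$ are independent homogeneous Poisson processes with rates \<open>r i\<close>: the
  numbers of points in consecutive intervals are, given \<open>G\<close>, independent Poisson variables, also
  across different \<open>i\<close>. The Poisson weights are spelled out because rates may be zero, which
  \<open>poisson_pmf\<close> does not allow.\<close>

definition cond_indep_poisson_processes ::
  "'a measure \<Rightarrow> 'a measure \<Rightarrow> 'i set \<Rightarrow> ('i \<Rightarrow> 'a \<Rightarrow> real set) \<Rightarrow> ('i \<Rightarrow> 'a \<Rightarrow> real) \<Rightarrow> bool" where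
  "cond_indep_poisson_processes M G I T r \<longleftrightarrow>
     (\<forall>i\<in>I. \<forall>\<omega>\<in>space M. T i \<omega> \<subseteq> {0..} \<and> (\<forall>t. finite (T i \<omega> \<inter> {0..t}))) \<and>
     (\<forall>i\<in>I. \<forall>a b. (\<lambda>\<omega>. card (T i \<omega> \<inter> {a..<b})) \<in> measurable M (count_space UNIV)) \<and>
     (\<forall>(m :: nat) (t :: nat \<Rightarrow> real) (k :: 'i \<Rightarrow> nat \<Rightarrow> nat). 0 \<le> t 0 \<and> mono t \<longrightarrow>
        (AE \<omega> in M.
           real_cond_exp M G
             (indicator {\<omega>' \<in> space M. \<forall>i\<in>I. \<forall>j<m. card (T i \<omega>' \<inter> {t j..<t (Suc j)}) = k i j}) \<omega>
           = (\<Prod>i\<in>I. \<Prod>j<m. (let l = r i \<omega> * (t (Suc j) - t j) in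
                l ^ k i j / fact (k i j) * exp (- l)))))"

text \<open>Division by zero yields zero, as required for the popularities of an all-zero vector.\<close>

definition popularity :: "nat \<Rightarrow> (nat \<Rightarrow> real) \<Rightarrow> nat \<Rightarrow> real" where
  "popularity n x i = x i / (\<Sum>j\<in>{1..n}. x j)"

definition weights_algebra :: "'a measure \<Rightarrow> nat \<Rightarrow> (nat \<Rightarrow> 'a \<Rightarrow> real) \<Rightarrow> 'a measure" where
  "weights_algebra M n w =
     vimage_algebra (space M) (\<lambda>\<omega>. \<lambda>i\<in>{1..n}. w i \<omega>) (PiM {1..n} (\<lambda>_. borel))"

locale move_to_front_chain = prob_space M
  for M :: "'a measure" +
  fixes n :: nat and w :: "nat \<Rightarrow> 'a \<Rightarrow> real" and \<pi> :: "nat \<Rightarrow> nat"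
    and T :: "nat \<Rightarrow> 'a \<Rightarrow> real set"
  assumes weights_measurable: "\<And>i. i \<in> {1..n} \<Longrightarrow> w i \<in> borel_measurable M"
    and weights_nonneg: "\<And>i \<omega>. i \<in> {1..n} \<Longrightarrow> \<omega> \<in> space M \<Longrightarrow> 0 \<le> w i \<omega>"
    and initial_permutation: "\<pi> permutes {1..n}"
    and requests: "cond_indep_poisson_processes M (weights_algebra M n w) {1..n} T
                     (\<lambda>i \<omega>. popularity n (\<lambda>j. w j \<omega>) i)"


section \<open>The laws of large numbers for the weights\<close>

definition LLN :: "real measure \<Rightarrow> (nat \<Rightarrow> 'a measure) \<Rightarrow> (nat \<Rightarrow> nat \<Rightarrow> 'a \<Rightarrow> real) \<Rightarrow> bool" where
  "LLN P M w \<longleftrightarrow>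
     (\<exists>Z :: nat \<Rightarrow> 'a \<Rightarrow> real.
        (\<forall>n. Z n \<in> borel_measurable (M n) \<and> (\<forall>\<omega>\<in>space (M n). 0 < Z n \<omega>)) \<and>
        converges_in_law_to_const weak_topology M
          (\<lambda>n \<omega>. empirical_measure n (\<lambda>i. Z n \<omega> * w n i \<omega>)) P \<and>
        weak_conv_m
          (\<lambda>n. distr (M n) borel (\<lambda>\<omega>. (1 / real n) * (\<Sum>i\<in>{1..n}. Z n \<omega> * w n i \<omega>)))
          (return borel (\<integral>x. x \<partial>P)))"

definition LLN_minus ::
  "real measure \<Rightarrow> (nat \<Rightarrow> 'a measure) \<Rightarrow> (nat \<Rightarrow> nat \<Rightarrow> 'a \<Rightarrow> real) \<Rightarrow> (nat \<Rightarrow> nat \<Rightarrow> nat) \<Rightarrow> bool" where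
  "LLN_minus P M w \<pi> \<longleftrightarrow> LLN P M w \<and> (\<forall>n. \<forall>i\<in>{1..n}. \<pi> n i = i) \<and>
     (\<forall>n. AE \<omega> in M n. \<forall>i\<in>{1..n}. \<forall>j\<in>{1..n}. i \<le> j \<longrightarrow> w n j \<omega> \<le> w n i \<omega>)"

definition LLN_plus ::
  "real measure \<Rightarrow> (nat \<Rightarrow> 'a measure) \<Rightarrow> (nat \<Rightarrow> nat \<Rightarrow> 'a \<Rightarrow> real) \<Rightarrow> (nat \<Rightarrow> nat \<Rightarrow> nat) \<Rightarrow> bool" where
  "LLN_plus P M w \<pi> \<longleftrightarrow> LLN P M w \<and> (\<forall>n. \<forall>i\<in>{1..n}. \<pi> n i = i) \<and>
     (\<forall>n. AE \<omega> in M n. \<forall>i\<in>{1..n}. \<forall>j\<in>{1..n}. i \<le> j \<longrightarrow> w n i \<omega> \<le> w n j \<omega>)"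


section \<open>The limiting densities\<close>

definition laplace :: "real measure \<Rightarrow> real \<Rightarrow> real" where
  "laplace P t = (\<integral>x. exp (- t * x) \<partial>P)"

text \<open>Derivatives are taken within $[0,\infty)$, where the Laplace transform is defined; at 0 they
  are right derivatives.\<close>

definition laplace' :: "real measure \<Rightarrow> real \<Rightarrow> real" where
  "laplace' P t = vector_derivative (laplace P) (at t within {0..})"

definition laplace'' :: "real measure \<Rightarrow> real \<Rightarrow> real" where
  "laplace'' P t = vector_derivative (laplace' P) (at t within {0..})"

definition laplace_inv :: "real measure \<Rightarrow> real \<Rightarrow> real" where
  "laplace_inv P = the_inv_into {0..} (laplace P)"

definition dens_inf :: "real measure \<Rightarrow> real \<Rightarrow> real" where
  "dens_inf P x = - (1 / (\<integral>y. y \<partial>P)) *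
     (laplace'' P (laplace_inv P (1 - x)) / laplace' P (laplace_inv P (1 - x))) *
     indicator {0..1 - measure P {0}} x"

text \<open>Where no \<open>s\<close> qualifies the infimum is infinite in the mathematical convention and an
  unspecified real here. On the interval $[1-\phi(t),1]$, where the inverses below are used, this
  can only happen at an endpoint, so densities are unaffected.\<close>

definition gen_inverse :: "(real \<Rightarrow> real) \<Rightarrow> real \<Rightarrow> real" where
  "gen_inverse g x = Inf {s. 0 \<le> s \<and> x \<le> g s}"

definition g_minus :: "real measure \<Rightarrow> real \<Rightarrow> real \<Rightarrow> real" where
  "g_minus P t y = (LINT z:{0..y}|P. exp (- z * t))"

definition g_plus :: "real measure \<Rightarrow> real \<Rightarrow> real \<Rightarrow> real" where
  "g_plus P t y = (LINT z:{y<..}|P. exp (- z * t))"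

definition g_tilde_minus :: "real measure \<Rightarrow> real \<Rightarrow> real \<Rightarrow> real" where
  "g_tilde_minus P t y = gen_inverse (g_minus P t) (1 - y)"

definition g_tilde_plus :: "real measure \<Rightarrow> real \<Rightarrow> real \<Rightarrow> real" where
  "g_tilde_plus P t y = gen_inverse (\<lambda>s. 1 - g_plus P t s) y"

definition dens :: "real measure \<Rightarrow> (real \<Rightarrow> real \<Rightarrow> real) \<Rightarrow> real \<Rightarrow> real \<Rightarrow> real" where
  "dens P gt t x =
     indicator {0..1 - laplace P t} x * dens_inf P x +
     indicator {1 - laplace P t..1} x * ((1 / (\<integral>y. y \<partial>P)) * gt t x)"

end

theory Submission
  imports Defs
begin

text \<open>Put \<open>x i = n \<mu> p i\<close>, where \<open>p i\<close> is the popularity of object \<open>i\<close>. Under the law of large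
  numbers the empirical measure of the \<open>x i\<close> is close to \<open>P\<close>; the normalizing factors disappear because
  the \<open>x i\<close> have mean exactly \<open>\<mu>\<close>. All that is used afterwards is convergence in mean of averages
  of bounded Lipschitz functions of the \<open>x i\<close> (\<open>average_converges\<close>).

  Look back from time \<open>n \<mu> t\<close> by \<open>n \<mu> s\<close>. Given the weights, the objects are left alone
  during this window independently of each other, object \<open>i\<close> with probability \<open>exp (- s x i)\<close>
  (\<open>requested_in_law\<close>). Hence the number of requested objects, divided by \<open>n\<close>, concentrates at
  \<open>1 - \<phi>(s)\<close>. Moving to the front puts exactly these objects in the first places of the list
  (\<open>position_at_split\<close>). The next object is \<open>i\<close> with probability \<open>p i\<close>, independently of the past
  (\<open>requested_in_next_ge\<close>), so up to vanishing errors it lies beyond the proportion \<open>1 - \<phi>(s)\<close> of the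
  list exactly if it was left alone during the window, which has probability \<open>\<Sum>i. p i exp (- s x i)\<close>,
  tending to \<open>- \<phi>'(s) / \<mu>\<close>. This gives the limit of the distribution function of the search cost
  below \<open>1 - \<phi>(t)\<close> and, for \<open>s = t\<close>, the probability of the out-of-equilibrium part. By the
  fundamental theorem of calculus the stationary density has the same distribution function.

  An object left alone since time 0 is at position \<open>n\<close> minus the number of objects with larger label
  that were left alone as well. To find the probability that the next object is of this kind and lies
  beyond position \<open>n a\<close>, write \<open>p i = (1 / (n \<mu>)) \<integral> indicator {y. y < x i}\<close>, the integral being over \<open>y \<ge> 0\<close>.
  The probability becomes \<open>1 / \<mu>\<close> times an integral over \<open>y\<close> of the expected proportion of
  objects that were left alone, have \<open>x i > y\<close> and lie beyond \<open>n a\<close> (\<open>joint_mean_layer_cake\<close>).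
  As the weights are sorted, each of the last two conditions cuts off an initial or a final segment
  of the objects left alone. Three counts therefore determine the proportion (\<open>count_close\<close>), each of
  them concentrates, and the integrand is dominated by \<open>exp (- t y)\<close>. The limit is the integral of
  the lengths of the superlevel sets of the generalized inverse, that is, the integral of the boundary
  density over \<open>x > a\<close> (\<open>less_gen_inverse_iff\<close>, \<open>layer_cake_interval\<close>).\<close>

section \<open>Positions in the list after a window of requests\<close>

lemma move_to_front_less_iff:
  assumes "i \<noteq> l" "j \<noteq> l" "pos i \<noteq> pos l" "pos j \<noteq> pos l"
  shows "move_to_front l pos i < move_to_front l pos j \<longleftrightarrow> pos i < pos j"
  using assms by (auto simp: move_to_front_def)

lemma move_to_front_bij:
  assumes "bij_betw pos {1..n} {1..n}" "l \<in> {1..n}"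
  shows "bij_betw (move_to_front l pos) {1..n} {1..n}"
proof -
  have inj: "inj_on pos {1..n}" and im: "\<And>i. i \<in> {1..n} \<Longrightarrow> pos i \<in> {1..n}"
    using assms(1) by (auto simp: bij_betw_def)
  have "inj_on (move_to_front l pos) {1..n}"
  proof (rule inj_onI)
    fix i j assume ij: "i \<in> {1..n}" "j \<in> {1..n}" and e: "move_to_front l pos i = move_to_front l pos j"
    have p: "pos i \<ge> 1" "pos j \<ge> 1" using im ij by auto
    show "i = j"
    proof (rule ccontr)
      assume ne: "i \<noteq> j"
      then have "pos i \<noteq> pos j" "i \<noteq> l \<Longrightarrow> pos i \<noteq> pos l" "j \<noteq> l \<Longrightarrow> pos j \<noteq> pos l"
        using inj ij assms(2) by (auto dest: inj_onD)
      then show False using e ne p by (auto simp: move_to_front_def split: if_splits)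
    qed
  qed
  moreover have "move_to_front l pos ` {1..n} \<subseteq> {1..n}"
  proof (intro image_subsetI)
    fix i assume i: "i \<in> {1..n}"
    show "move_to_front l pos i \<in> {1..n}"
      using im[OF i] im[OF assms(2)] by (auto simp: move_to_front_def)
  qed
  ultimately show ?thesis
    by (simp add: bij_betw_def endo_inj_surj)
qed

definition labels_between :: "nat \<Rightarrow> (nat \<Rightarrow> real set) \<Rightarrow> nat \<Rightarrow> nat \<Rightarrow> nat set" where
  "labels_between n T a k = {i. \<exists>l. a < l \<and> l \<le> k \<and> request_label n T l = Some i}"

lemma request_labelD:
  assumes "request_label n T k = Some i"
  shows "i \<in> {1..n} \<and> (\<exists>s\<in>T i. num_requests n T s = k)"
proof -
  from assms have ex: "\<exists>i. i \<in> {1..n} \<and> (\<exists>s\<in>T i. num_requests n T s = k)"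
    and i: "i = (LEAST i. i \<in> {1..n} \<and> (\<exists>s\<in>T i. num_requests n T s = k))"
    by (auto simp: request_label_def split: if_splits)
  show ?thesis unfolding i by (rule LeastI_ex[OF ex])
qed

lemma request_label_in_range: "request_label n T k = Some i \<Longrightarrow> i \<in> {1..n}"
  using request_labelD by blast

lemma position_after_bij:
  assumes "\<pi> permutes {1..n}"
  shows "bij_betw (position_after n \<pi> T k) {1..n} {1..n}"
proof (induction k)
  case 0
  then show ?case using assms by (auto simp: permutes_imp_bij)
next
  case (Suc k)
  then show ?case
    by (auto split: option.splits simp del: One_nat_def atLeastAtMost_iff
        intro!: move_to_front_bij dest: request_label_in_range)
qed

lemma labels_between_Suc:
  "a \<le> k \<Longrightarrow> labels_between n T a (Suc k) =
     (case request_label n T (Suc k) of None \<Rightarrow> labels_between n T a k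
        | Some j \<Rightarrow> insert j (labels_between n T a k))"
  unfolding labels_between_def using le_imp_less_Suc[of a k]
  by (cases "request_label n T (Suc k)") (auto simp: le_Suc_eq, metis less_Suc_eq_le order_refl)

lemma labels_between_subset: "labels_between n T a k \<subseteq> {1..n}"
  by (auto simp: labels_between_def dest: request_label_in_range)

lemma finite_labels_between [simp]: "finite (labels_between n T a k)"
  by (rule finite_subset[OF labels_between_subset]) simp

text \<open>A request moves its object to the front and lets the others keep their order. The objects requested
  after step \<open>a\<close> hence fill the first places, and every other object has moved back past those of them
  that were behind it. The order of the remaining objects is part of the induction because it decides
  which of them a newly requested object overtakes.\<close>

lemma position_after_labels_between:
  fixes T :: "nat \<Rightarrow> real set"
  assumes "\<pi> permutes {1..n}" "a \<le> k"
  defines "C \<equiv> labels_between n T a k" and "pk \<equiv> position_after n \<pi> T k"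
    and "pa \<equiv> position_after n \<pi> T a"
  shows "(\<forall>i\<in>C. pk i \<le> card C) \<and>
         (\<forall>i\<in>{1..n}-C. card C < pk i) \<and>
         (\<forall>i\<in>{1..n}-C. \<forall>j\<in>{1..n}-C. pk i < pk j \<longleftrightarrow> pa i < pa j) \<and>
         (\<forall>i\<in>{1..n}-C. pk i = pa i + card {j\<in>C. pa i < pa j})"
  using assms(2) unfolding C_def pk_def
proof (induction k rule: dec_induct)
  case base
  have [simp]: "labels_between n T a a = {}" by (auto simp: labels_between_def)
  have "bij_betw pa {1..n} {1..n}" unfolding pa_def using position_after_bij[OF assms(1)] .
  then have "i \<in> {1..n} \<Longrightarrow> 0 < pa i" for i
    using bij_betwE[of pa "{1..n}" "{1..n}"] by force
  then show ?case by (auto simp: pa_def)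
next
  case (step k)
  let ?C = "labels_between n T a k" and ?p = "position_after n \<pi> T k"
  have bij: "bij_betw ?p {1..n} {1..n}" by (rule position_after_bij[OF assms(1)])
  have inj: "i \<in> {1..n} \<Longrightarrow> j \<in> {1..n} \<Longrightarrow> ?p i = ?p j \<longleftrightarrow> i = j" for i j
    using bij by (auto simp: bij_betw_def inj_on_eq_iff)
  note IH = step.IH
  have C: "?C \<subseteq> {1..n}" by (rule labels_between_subset)
  show ?case
  proof (cases "request_label n T (Suc k)")
    case None
    then have "labels_between n T a (Suc k) = ?C" "position_after n \<pi> T (Suc k) = ?p"
      using step.hyps(1) by (simp_all add: labels_between_Suc)
    then show ?thesis using IH by (simp only:)
  next
    case (Some l)
    then have l: "l \<in> {1..n}" by (rule request_label_in_range)
    have C': "labels_between n T a (Suc k) = insert l ?C"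
      using Some step.hyps by (simp add: labels_between_Suc)
    have p': "position_after n \<pi> T (Suc k) = move_to_front l ?p" using Some by simp
    have ord: "move_to_front l ?p i < move_to_front l ?p j \<longleftrightarrow> pa i < pa j"
      if "i \<in> {1..n} - insert l ?C" "j \<in> {1..n} - insert l ?C" for i j
    proof -
      have "move_to_front l ?p i < move_to_front l ?p j \<longleftrightarrow> ?p i < ?p j"
        by (rule move_to_front_less_iff) (use that l inj in auto)
      then show ?thesis using IH that by auto
    qed
    show ?thesis
    proof (cases "l \<in> ?C")
      case True
      then have ins: "insert l ?C = ?C" by auto
      have out: "move_to_front l ?p i = ?p i" if "i \<in> {1..n} - ?C" for i
      proof -
        have "?p l \<le> card ?C" "card ?C < ?p i" "i \<noteq> l" using IH True that by blast+
        then show ?thesis by (simp add: move_to_front_def)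
      qed
      have inn: "move_to_front l ?p i \<le> card ?C" if "i \<in> ?C" for i
      proof -
        have "?p l \<le> card ?C" "?p i \<le> card ?C" using IH True that by blast+
        moreover have "card ?C \<ge> 1" using True by (simp add: Suc_le_eq card_gt_0_iff) blast
        ultimately show ?thesis by (auto simp: move_to_front_def)
      qed
      show ?thesis unfolding C' p' ins
        using ord inn IH unfolding ins by (simp add: out del: One_nat_def atLeastAtMost_iff Diff_iff) (metis out)
    next
      case False
      then have cI: "card (insert l ?C) = Suc (card ?C)" by simp
      have pl: "card ?C < ?p l" using IH l False by blast
      have inn: "move_to_front l ?p i \<le> card (insert l ?C)" if "i \<in> insert l ?C" for i
      proof (cases "i = l")
        case True then show ?thesis by (simp add: move_to_front_def cI)
      next
        case ne: False
        then have "?p i \<le> card ?C" using IH that by blast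
        then show ?thesis using pl ne cI by (auto simp: move_to_front_def)
      qed
      have out: "card (insert l ?C) < move_to_front l ?p i \<and>
          move_to_front l ?p i = pa i + card {j\<in>insert l ?C. pa i < pa j}"
        if i: "i \<in> {1..n} - insert l ?C" for i
      proof -
        have a: "card ?C < ?p i" "?p i = pa i + card {j\<in>?C. pa i < pa j}"
          and b: "?p i < ?p l \<longleftrightarrow> pa i < pa l" using IH i l False by blast+
        have ne: "?p i \<noteq> ?p l" "i \<noteq> l" using i l inj by auto
        have "card {j\<in>insert l ?C. pa i < pa j} =
            (if pa i < pa l then Suc (card {j\<in>?C. pa i < pa j}) else card {j\<in>?C. pa i < pa j})"
        proof (cases "pa i < pa l")
          case True
          then have "{j\<in>insert l ?C. pa i < pa j} = insert l {j\<in>?C. pa i < pa j}" by auto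
          then show ?thesis using True False by simp
        next
          case f: False
          then have "{j\<in>insert l ?C. pa i < pa j} = {j\<in>?C. pa i < pa j}" by auto
          then show ?thesis using f by simp
        qed
        then show ?thesis using a b ne pl cI by (auto simp: move_to_front_def)
      qed
      show ?thesis unfolding C' p' using ord inn out by blast
    qed
  qed
qed

definition requested_in :: "nat \<Rightarrow> (nat \<Rightarrow> real set) \<Rightarrow> real \<Rightarrow> real \<Rightarrow> nat set" where
  "requested_in n T a b = {i\<in>{1..n}. T i \<inter> {a..<b} \<noteq> {}}"

text \<open>What holds for every outcome of the request processes. Simultaneous requests of different objects
  may occur here; where they matter, their absence is a separate assumption.\<close>

locale request_configuration =
  fixes n :: nat and T :: "nat \<Rightarrow> real set"
  assumes nonneg: "\<And>i. i \<in> {1..n} \<Longrightarrow> T i \<subseteq> {0..}"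
    and locally_finite: "\<And>i t. i \<in> {1..n} \<Longrightarrow> finite (T i \<inter> {0..t})"
begin

abbreviation "R \<equiv> request_times n T"

lemma R_nonneg: "s \<in> R \<Longrightarrow> 0 \<le> s"
  using nonneg unfolding request_times_def by blast

lemma finite_R: "finite (R \<inter> {0..t})"
proof -
  have eq: "R \<inter> {0..t} = (\<Union>i\<in>{1..n}. T i \<inter> {0..t})" by (auto simp: request_times_def)
  show ?thesis unfolding eq by (intro finite_UN_I[OF finite_atLeastAtMost] locally_finite)
qed

lemma finite_R': "finite (R \<inter> {0..<t})"
  by (rule finite_subset[OF _ finite_R[of t]]) auto

lemma num_requests_less:
  assumes "s \<in> R" "s' < s" shows "num_requests n T s' < num_requests n T s"
proof -
  have "0 \<le> s" using assms(1) by (rule R_nonneg)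
  then have "s \<in> R \<inter> {0..s} - R \<inter> {0..s'}" "R \<inter> {0..s'} \<subseteq> R \<inter> {0..s}"
    using assms by auto
  then have "R \<inter> {0..s'} \<subset> R \<inter> {0..s}" by blast
  then show ?thesis unfolding num_requests_def by (intro psubset_card_mono finite_R)
qed

lemma num_requests_inj:
  "s \<in> R \<Longrightarrow> s' \<in> R \<Longrightarrow> num_requests n T s = num_requests n T s' \<Longrightarrow> s = s'"
  using num_requests_less by (metis less_irrefl linorder_less_linear)

lemma num_requests_le_before:
  "s < v \<Longrightarrow> num_requests n T s \<le> num_requests_before n T v"
  unfolding num_requests_def num_requests_before_def by (intro card_mono finite_R') auto

lemma num_requests_before_less:
  assumes "v \<le> s" "s \<in> R" shows "num_requests_before n T v < num_requests n T s"
proof -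
  have "0 \<le> s" using assms(2) by (rule R_nonneg)
  then have "s \<in> R \<inter> {0..s} - R \<inter> {0..<v}" "R \<inter> {0..<v} \<subseteq> R \<inter> {0..s}"
    using assms by auto
  then have "R \<inter> {0..<v} \<subset> R \<inter> {0..s}" by blast
  then show ?thesis unfolding num_requests_def num_requests_before_def
    by (intro psubset_card_mono finite_R)
qed

lemma request_label_eqI:
  assumes "i \<in> {1..n}" "s \<in> T i" "num_requests n T s = k"
    and "\<And>j. j \<in> {1..n} \<Longrightarrow> s \<in> T j \<Longrightarrow> j = i"
  shows "request_label n T k = Some i"
proof -
  have eq: "i' \<in> {1..n} \<and> (\<exists>s\<in>T i'. num_requests n T s = k) \<longleftrightarrow> i' = i" for i'
  proof
    assume "i' \<in> {1..n} \<and> (\<exists>s\<in>T i'. num_requests n T s = k)"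
    then obtain s' where s': "i' \<in> {1..n}" "s' \<in> T i'" "num_requests n T s' = k" by auto
    have "s' \<in> R" "s \<in> R" using s'(1,2) assms(1,2) unfolding request_times_def by blast+
    then have "s' = s" by (rule num_requests_inj) (simp add: s'(3) assms(3))
    then show "i' = i" using assms(4) s' by auto
  qed (use assms(1-3) in blast)
  have ex: "\<exists>i\<in>{1..n}. \<exists>s\<in>T i. num_requests n T s = k" using assms(1-3) by blast
  have "(LEAST i'. i' \<in> {1..n} \<and> (\<exists>s\<in>T i'. num_requests n T s = k)) = i"
    unfolding eq by (intro Least_equality) auto
  then show ?thesis using ex unfolding request_label_def by simp
qed

text \<open>Without simultaneous requests every request time has exactly one label, so that the requests may be
  selected by time instead of by their number.\<close>

lemma labels_between_times:
  assumes noties: "\<And>i j. i \<in> {1..n} \<Longrightarrow> j \<in> {1..n} \<Longrightarrow> i \<noteq> j \<Longrightarrow> T i \<inter> T j \<inter> {0..<t} = {}"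
  shows "labels_between n T (num_requests_before n T v) (num_requests_before n T t) =
           requested_in n T v t"
proof (intro set_eqI iffI)
  fix i assume "i \<in> labels_between n T (num_requests_before n T v) (num_requests_before n T t)"
  then obtain k where k: "num_requests_before n T v < k" "k \<le> num_requests_before n T t"
    "request_label n T k = Some i" by (auto simp: labels_between_def)
  obtain s where s: "i \<in> {1..n}" "s \<in> T i" "num_requests n T s = k"
    using request_labelD[OF k(3)] by auto
  have "s \<in> R" using s by (auto simp: request_times_def)
  have "v \<le> s" using num_requests_le_before[of s v] s k by (meson leD le_less_linear order_trans)
  moreover have "s < t" using num_requests_before_less[of t s] \<open>s \<in> R\<close> s k by fastforce
  ultimately show "i \<in> requested_in n T v t" using s by (auto simp: requested_in_def)
next
  fix i assume "i \<in> requested_in n T v t"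
  then obtain s where s: "i \<in> {1..n}" "s \<in> T i" "v \<le> s" "s < t" by (auto simp: requested_in_def)
  have R: "s \<in> R" "0 \<le> s" using s nonneg by (auto simp: request_times_def)
  have "request_label n T (num_requests n T s) = Some i"
  proof (rule request_label_eqI[OF s(1,2) refl])
    fix j assume "j \<in> {1..n}" "s \<in> T j"
    then show "j = i" using noties[of i j] s R by fastforce
  qed
  moreover have "num_requests_before n T v < num_requests n T s"
    using num_requests_before_less s R by auto
  moreover have "num_requests n T s \<le> num_requests_before n T t"
    using num_requests_le_before s by auto
  ultimately show "i \<in> labels_between n T (num_requests_before n T v) (num_requests_before n T t)"
    by (auto simp: labels_between_def)
qed

lemma num_requests_before_mono: "v \<le> t \<Longrightarrow> num_requests_before n T v \<le> num_requests_before n T t"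
  unfolding num_requests_before_def by (intro card_mono finite_R') auto

lemma num_requests_before_0 [simp]: "num_requests_before n T 0 = 0"
  by (simp add: num_requests_before_def)

context
  fixes \<pi> t assumes \<pi>: "\<pi> permutes {1..n}"
    and noties: "\<And>i j. i \<in> {1..n} \<Longrightarrow> j \<in> {1..n} \<Longrightarrow> i \<noteq> j \<Longrightarrow> T i \<inter> T j \<inter> {0..<t} = {}"
begin

text \<open>The objects requested between \<open>v\<close> and \<open>t\<close> are exactly the first ones of the list at time \<open>t\<close>. This turns
  the position of an object into a question about the time of its last request.\<close>

lemma position_at_split:
  assumes "v \<le> t"
  defines "C \<equiv> requested_in n T v t" and "pv \<equiv> position_at n \<pi> T v"
    and "pt \<equiv> position_at n \<pi> T t"
  shows "i \<in> C \<Longrightarrow> pt i \<le> card C"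
    and "i \<in> {1..n} - C \<Longrightarrow> card C < pt i"
    and "i \<in> {1..n} - C \<Longrightarrow> pt i = pv i + card {j\<in>C. pv i < pv j}"
proof -
  have eq: "labels_between n T (num_requests_before n T v) (num_requests_before n T t) = C"
    unfolding C_def by (rule labels_between_times[OF noties])
  note * = position_after_labels_between[OF \<pi> num_requests_before_mono[OF assms(1)], of T,
      unfolded eq, folded position_at_def, folded pt_def pv_def]
  show "i \<in> C \<Longrightarrow> pt i \<le> card C" "i \<in> {1..n} - C \<Longrightarrow> card C < pt i"
    "i \<in> {1..n} - C \<Longrightarrow> pt i = pv i + card {j\<in>C. pv i < pv j}"
    using * by blast+
qed

lemma position_at_0: "position_at n \<pi> T 0 = \<pi>"
  by (simp add: position_at_def)

lemmas position_at_requested = position_at_split(1)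
lemmas position_at_not_requested = position_at_split(2)
lemmas position_at_never_requested = position_at_split(3)[of 0, unfolded position_at_0]

end

lemma search_cost_next:
  assumes "next_label n T t = Some i"
  shows "search_cost n \<pi> T t = position_at n \<pi> T t i"
proof -
  have "i \<in> {1..n}" using assms request_label_in_range by (auto simp: next_label_def)
  have "search_cost n \<pi> T t = (\<Sum>j\<in>{1..n}. if j = i then position_at n \<pi> T t j else 0)"
    unfolding search_cost_def using assms by (intro sum.cong) auto
  then show ?thesis using \<open>i \<in> {1..n}\<close> by simp
qed

lemma search_cost_None: "next_label n T t = None \<Longrightarrow> search_cost n \<pi> T t = 0"
  by (simp add: search_cost_def)

lemma position_at_bounds:
  assumes "\<pi> permutes {1..n}" "i \<in> {1..n}" shows "position_at n \<pi> T t i \<in> {1..n}"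
  using position_after_bij[OF assms(1), of T] assms(2) unfolding position_at_def bij_betw_def by blast

lemma search_cost_out_pos_iff:
  assumes "\<pi> permutes {1..n}"
  shows "search_cost_out n \<pi> T t > 0 \<longleftrightarrow>
    (\<exists>i. next_label n T t = Some i \<and> i \<notin> requested_in n T 0 t)"
proof (cases "next_label n T t")
  case None
  then show ?thesis by (simp add: search_cost_out_def search_cost_None)
next
  case (Some i)
  then have "i \<in> {1..n}" using request_label_in_range by (auto simp: next_label_def)
  then have "position_at n \<pi> T t i > 0" using position_at_bounds[OF assms, of i t] by simp
  then show ?thesis using Some search_cost_next[OF Some]
    by (auto simp: search_cost_out_def requested_in_def requested_before_def)
qed

lemma search_cost_le: 
  assumes "\<pi> permutes {1..n}" shows "search_cost n \<pi> T t \<le> n"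
proof (cases "next_label n T t")
  case None
  then show ?thesis by (simp add: search_cost_None)
next
  case (Some i)
  then have "i \<in> {1..n}" using request_label_in_range by (auto simp: next_label_def)
  then show ?thesis using Some search_cost_next position_at_bounds[OF assms, of i t] by simp
qed

text \<open>The earliest request of \<open>i\<close> in the interval from \<open>a\<close> to \<open>b\<close> is the first request of any object after \<open>t\<close>.\<close>

lemma next_label_eqI:
  assumes "t \<le> a" "i \<in> {1..n}" and quiet: "\<And>j. j \<in> {1..n} \<Longrightarrow> T j \<inter> {t..<a} = {}"
    and others: "\<And>j. j \<in> {1..n} \<Longrightarrow> j \<noteq> i \<Longrightarrow> T j \<inter> {a..<b} = {}"
    and "T i \<inter> {a..<b} \<noteq> {}"
  shows "next_label n T t = Some i"
proof -
  have fin: "finite (T i \<inter> {a..<b})"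
    by (rule finite_subset[OF _ locally_finite[OF assms(2), of b]]) (use nonneg[OF assms(2)] in auto)
  define s where "s = Min (T i \<inter> {a..<b})"
  have s: "s \<in> T i" "a \<le> s" "s < b" using Min_in[OF fin assms(5)] by (auto simp: s_def)
  have min: "s \<le> x" if "x \<in> T i" "a \<le> x" "x < b" for x unfolding s_def using fin that by auto
  have s0: "0 \<le> s" using s nonneg assms(2) by auto
  have early: "r = s" if r: "r \<in> R" "t \<le> r" "r \<le> s" for r
  proof -
    obtain j where j: "j \<in> {1..n}" "r \<in> T j" using r by (auto simp: request_times_def)
    have ra: "a \<le> r" using quiet[OF j(1)] j r by fastforce
    have "j = i" using others[of j] j ra r s by fastforce
    then show ?thesis using min j ra r s by force
  qed
  have sR: "s \<in> R" using s assms(2) by (auto simp: request_times_def)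
  have eq: "R \<inter> {0..s} = insert s (R \<inter> {0..<t})"
  proof (intro set_eqI iffI)
    fix r assume "r \<in> R \<inter> {0..s}"
    then show "r \<in> insert s (R \<inter> {0..<t})" using early[of r] by (cases "r < t") auto
  next
    fix r assume "r \<in> insert s (R \<inter> {0..<t})"
    then show "r \<in> R \<inter> {0..s}" using sR s0 s assms(1) by auto
  qed
  have sn: "s \<notin> R \<inter> {0..<t}" using s assms(1) by auto
  have k: "num_requests n T s = num_requests_before n T t + 1"
    unfolding num_requests_def num_requests_before_def eq
    by (simp only: card_insert_disjoint[OF finite_R' sn])
  show ?thesis unfolding next_label_def using s others assms(2)
    by (intro request_label_eqI[OF assms(2) s(1) k]) fastforce
qed

end

section \<open>Measurability of the search cost\<close>

context request_configuration begin

text \<open>A locally finite set has only finitely many points near \<open>s\<close>. Rational times can therefore take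
  the place of request times in the quantifiers below, which keeps all events measurable.\<close>

lemma separating_rats:
  assumes "finite F"
  obtains a b :: rat where "real_of_rat a < s" "s < real_of_rat b"
    "\<And>r. r \<in> F \<Longrightarrow> r < s \<Longrightarrow> r < real_of_rat a" "\<And>r. r \<in> F \<Longrightarrow> s < r \<Longrightarrow> real_of_rat b < r"
proof -
  define l where "l = Max (insert (s - 1) {r\<in>F. r < s})"
  define u where "u = Min (insert (s + 1) {r\<in>F. s < r})"
  have "l < s" "s < u" using assms by (auto simp: l_def u_def)
  then obtain a b where ab: "l < real_of_rat a" "real_of_rat a < s" "s < real_of_rat b" "real_of_rat b < u"
    using of_rat_dense by metis
  have 1: "r \<le> l" if "r \<in> F" "r < s" for r using that assms unfolding l_def by (intro Max_ge) auto
  have 2: "u \<le> r" if "r \<in> F" "s < r" for r using that assms unfolding u_def by (intro Min_le) auto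
  show ?thesis by (rule that[of a b]) (use ab 1 2 in force)+
qed

text \<open>Simultaneous requests count once, so the counts of the single objects do not determine the number
  of request times. This recursion does: split off the last request time.\<close>

lemma Suc_le_num_requests_before_iff:
  "Suc k \<le> num_requests_before n T t \<longleftrightarrow>
     (\<exists>q::rat. k \<le> num_requests_before n T (real_of_rat q) \<and> (\<exists>i\<in>{1..n}. T i \<inter> {real_of_rat q..<t} \<noteq> {}))"
proof
  assume L: "Suc k \<le> num_requests_before n T t"
  let ?A = "R \<inter> {0..<t}"
  have ne: "?A \<noteq> {}" using L by (auto simp: num_requests_before_def)
  define s where "s = Max ?A"
  have s: "s \<in> ?A" and max: "\<And>r. r \<in> ?A \<Longrightarrow> r \<le> s"
    using Max_in[OF finite_R' ne] Max_ge[OF finite_R'] unfolding s_def by auto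
  obtain a b :: rat where a: "real_of_rat a < s" "\<And>r. r \<in> ?A \<Longrightarrow> r < s \<Longrightarrow> r < real_of_rat a"
    using separating_rats[OF finite_R', of s t] by metis
  have sub: "?A \<subseteq> insert s (R \<inter> {0..<real_of_rat a})" using a max by force
  have "card ?A \<le> card (insert s (R \<inter> {0..<real_of_rat a}))"
    by (rule card_mono[OF _ sub]) (simp add: finite_R')
  also have "\<dots> \<le> Suc (card (R \<inter> {0..<real_of_rat a}))" by (rule card_insert_le_m1) auto
  finally have "k \<le> num_requests_before n T (real_of_rat a)"
    using L by (simp add: num_requests_before_def)
  moreover have "\<exists>i\<in>{1..n}. T i \<inter> {real_of_rat a..<t} \<noteq> {}"
    using s a(1) unfolding request_times_def by fastforce
  ultimately show "\<exists>q::rat. k \<le> num_requests_before n T (real_of_rat q) \<and>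
      (\<exists>i\<in>{1..n}. T i \<inter> {real_of_rat q..<t} \<noteq> {})" by blast
next
  assume "\<exists>q::rat. k \<le> num_requests_before n T (real_of_rat q) \<and>
      (\<exists>i\<in>{1..n}. T i \<inter> {real_of_rat q..<t} \<noteq> {})"
  then obtain q i where q: "k \<le> num_requests_before n T (real_of_rat q)"
    and i: "i \<in> {1..n}" "T i \<inter> {real_of_rat q..<t} \<noteq> {}" by blast
  then obtain s where s: "s \<in> T i" "real_of_rat q \<le> s" "s < t" by auto
  have "s \<in> R" using s i unfolding request_times_def by blast
  then show "Suc k \<le> num_requests_before n T t"
    using num_requests_before_less[OF s(2)] num_requests_le_before[OF s(3)] q by linarith
qed

text \<open>Request number \<open>k + 1\<close> can be enclosed in an interval with rational end points that contains no
  other request time.\<close>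

lemma num_requests_eq_Suc_iff:
  assumes "i \<in> {1..n}"
  shows "(\<exists>s\<in>T i. num_requests n T s = Suc k) \<longleftrightarrow>
     (\<exists>a b :: rat. num_requests_before n T (real_of_rat a) = k \<and>
        num_requests_before n T (real_of_rat b) = Suc k \<and> T i \<inter> {real_of_rat a..<real_of_rat b} \<noteq> {})"
proof
  assume "\<exists>s\<in>T i. num_requests n T s = Suc k"
  then obtain s where s: "s \<in> T i" "num_requests n T s = Suc k" by auto
  have sR: "s \<in> R" using s assms unfolding request_times_def by blast
  then have s0: "0 \<le> s" by (rule R_nonneg)
  obtain a b :: rat where a: "real_of_rat a < s" "s < real_of_rat b"
    "\<And>r. r \<in> insert (s+1) (R \<inter> {0..s+1}) \<Longrightarrow> r < s \<Longrightarrow> r < real_of_rat a"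
    "\<And>r. r \<in> insert (s+1) (R \<inter> {0..s+1}) \<Longrightarrow> s < r \<Longrightarrow> real_of_rat b < r"
    using separating_rats[of "insert (s+1) (R \<inter> {0..s+1})" s] finite_R[of "s+1"] by (metis finite_insert)
  have b1: "real_of_rat b < s + 1" using a(4)[of "s+1"] by simp
  have eb: "R \<inter> {0..<real_of_rat b} = R \<inter> {0..s}"
  proof (intro set_eqI iffI)
    fix r assume r: "r \<in> R \<inter> {0..<real_of_rat b}"
    then show "r \<in> R \<inter> {0..s}" using a(4)[of r] b1 by (cases "s < r") auto
  qed (use a(2) in auto)
  have ea: "R \<inter> {0..s} = insert s (R \<inter> {0..<real_of_rat a})"
  proof (intro set_eqI iffI)
    fix r assume r: "r \<in> R \<inter> {0..s}"
    then show "r \<in> insert s (R \<inter> {0..<real_of_rat a})" using a(3)[of r] by (cases "r < s") auto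
  qed (use a(1) sR s0 in auto)
  have "s \<notin> R \<inter> {0..<real_of_rat a}" using a(1) by auto
  then have "num_requests n T s = Suc (num_requests_before n T (real_of_rat a))"
    unfolding num_requests_def num_requests_before_def ea by (intro card_insert_disjoint finite_R')
  moreover have "num_requests n T s = num_requests_before n T (real_of_rat b)"
    unfolding num_requests_def num_requests_before_def eb ..
  moreover have "T i \<inter> {real_of_rat a..<real_of_rat b} \<noteq> {}" using s(1) a(1,2) by force
  ultimately show "\<exists>a b :: rat. num_requests_before n T (real_of_rat a) = k \<and>
        num_requests_before n T (real_of_rat b) = Suc k \<and> T i \<inter> {real_of_rat a..<real_of_rat b} \<noteq> {}"
    using s(2) by (intro exI[of _ a] exI[of _ b]) simp
next
  assume "\<exists>a b :: rat. num_requests_before n T (real_of_rat a) = k \<and>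
        num_requests_before n T (real_of_rat b) = Suc k \<and> T i \<inter> {real_of_rat a..<real_of_rat b} \<noteq> {}"
  then obtain a b :: real where ab: "num_requests_before n T a = k"
        "num_requests_before n T b = Suc k" and "T i \<inter> {a..<b} \<noteq> {}" by blast
  then obtain s where s: "s \<in> T i" "a \<le> s" "s < b" by auto
  have sR: "s \<in> R" using s assms unfolding request_times_def by blast
  have "num_requests n T s = Suc k"
    using num_requests_before_less[OF s(2) sR] num_requests_le_before[OF s(3)] ab by linarith
  then show "\<exists>s\<in>T i. num_requests n T s = Suc k" using s(1) by blast
qed

lemma num_requests_pos: "i \<in> {1..n} \<Longrightarrow> s \<in> T i \<Longrightarrow> num_requests n T s \<noteq> 0"
proof -
  assume "i \<in> {1..n}" "s \<in> T i"
  then have "s \<in> R" unfolding request_times_def by blast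
  then show ?thesis using num_requests_before_less[OF order_refl, of s] by linarith
qed

end

lemma request_label_eq_Some_iff:
  "request_label n T k = Some i \<longleftrightarrow> i \<in> {1..n} \<and> (\<exists>s\<in>T i. num_requests n T s = k) \<and>
     (\<forall>j\<in>{1..n}. j < i \<longrightarrow> \<not> (\<exists>s\<in>T j. num_requests n T s = k))"
proof
  assume L: "request_label n T k = Some i"
  then have "i = (LEAST i. i \<in> {1..n} \<and> (\<exists>s\<in>T i. num_requests n T s = k))"
    by (auto simp: request_label_def split: if_splits)
  then show "i \<in> {1..n} \<and> (\<exists>s\<in>T i. num_requests n T s = k) \<and>
     (\<forall>j\<in>{1..n}. j < i \<longrightarrow> \<not> (\<exists>s\<in>T j. num_requests n T s = k))"
    using request_labelD[OF L] not_less_Least by blast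
next
  assume R: "i \<in> {1..n} \<and> (\<exists>s\<in>T i. num_requests n T s = k) \<and>
     (\<forall>j\<in>{1..n}. j < i \<longrightarrow> \<not> (\<exists>s\<in>T j. num_requests n T s = k))"
  then have "(LEAST i. i \<in> {1..n} \<and> (\<exists>s\<in>T i. num_requests n T s = k)) = i"
  proof (intro Least_equality)
    fix j assume "j \<in> {1..n} \<and> (\<exists>s\<in>T j. num_requests n T s = k)"
    then have "\<not> j < i" using R by blast
    then show "i \<le> j" by simp
  qed (use R in blast)
  moreover have "\<exists>i\<in>{1..n}. \<exists>s\<in>T i. num_requests n T s = k" using R by blast
  ultimately show "request_label n T k = Some i" by (simp only: request_label_def if_True)
qed

context move_to_front_chain begin

abbreviation (input) "cfg \<omega> \<equiv> (\<lambda>i. T i \<omega>)"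

lemma configuration: "\<omega> \<in> space M \<Longrightarrow> request_configuration n (cfg \<omega>)"
  using requests unfolding cond_indep_poisson_processes_def request_configuration_def by blast

lemma count_measurable:
  "i \<in> {1..n} \<Longrightarrow> (\<lambda>\<omega>. card (T i \<omega> \<inter> {a..<b})) \<in> measurable M (count_space UNIV)"
  using requests unfolding cond_indep_poisson_processes_def by blast

lemma finite_interval:
  assumes "i \<in> {1..n}" "\<omega> \<in> space M" shows "finite (T i \<omega> \<inter> {a..<b})"
proof -
  interpret request_configuration n "cfg \<omega>" by (rule configuration[OF assms(2)])
  show ?thesis
    by (rule finite_subset[OF _ locally_finite[OF assms(1), of b]]) (use nonneg[OF assms(1)] in auto)
qed

lemma hit_measurable:
  assumes "i \<in> {1..n}" shows "Measurable.pred M (\<lambda>\<omega>. T i \<omega> \<inter> {a..<b} \<noteq> {})"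
proof -
  have "Measurable.pred M (\<lambda>\<omega>. card (T i \<omega> \<inter> {a..<b}) \<noteq> 0)"
    using count_measurable[OF assms] by measurable
  then show ?thesis
    by (rule measurable_cong[THEN iffD1, rotated]) (use finite_interval[OF assms] in simp)
qed

lemma requested_in_measurable:
  "Measurable.pred M (\<lambda>\<omega>. requested_in n (cfg \<omega>) a b = C)"
proof -
  have eq: "requested_in n (cfg \<omega>) a b = C \<longleftrightarrow>
      C \<subseteq> {1..n} \<and> (\<forall>i\<in>{1..n}. i \<in> C \<longleftrightarrow> T i \<omega> \<inter> {a..<b} \<noteq> {})" for \<omega>
    unfolding requested_in_def by blast
  show ?thesis unfolding eq
    by (intro pred_intros_logic(3,6) pred_intros_finite(3) hit_measurable) auto
qed

lemma le_num_requests_before_measurable: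
  "Measurable.pred M (\<lambda>\<omega>. k \<le> num_requests_before n (cfg \<omega>) t)"
proof (induction k arbitrary: t)
  case 0
  then show ?case by simp
next
  case (Suc k)
  have "Measurable.pred M (\<lambda>\<omega>. \<exists>q::rat. k \<le> num_requests_before n (cfg \<omega>) (real_of_rat q) \<and>
      (\<exists>i\<in>{1..n}. T i \<omega> \<inter> {real_of_rat q..<t} \<noteq> {}))"
    by (intro pred_intros_countable pred_intros_logic(3) Suc.IH pred_intros_finite(4) hit_measurable) auto
  then show ?case
    by (rule measurable_cong[THEN iffD1, rotated])
       (simp only: request_configuration.Suc_le_num_requests_before_iff[OF configuration])
qed

lemma num_requests_before_measurable:
  "(\<lambda>\<omega>. num_requests_before n (cfg \<omega>) t) \<in> measurable M (count_space UNIV)"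
proof -
  have "Measurable.pred M (\<lambda>\<omega>. num_requests_before n (cfg \<omega>) t = k)" for k
  proof -
    have "Measurable.pred M (\<lambda>\<omega>. k \<le> num_requests_before n (cfg \<omega>) t \<and>
        \<not> Suc k \<le> num_requests_before n (cfg \<omega>) t)"
      by (intro pred_intros_logic(2,3) le_num_requests_before_measurable)
    then show ?thesis by (rule measurable_cong[THEN iffD1, rotated]) auto
  qed
  then show ?thesis
    by (subst measurable_count_space_eq2_countable) (auto simp: pred_def vimage_def Int_def conj_commute)
qed

lemma num_requests_at_label_measurable:
  assumes "i \<in> {1..n}" shows "Measurable.pred M (\<lambda>\<omega>. \<exists>s\<in>T i \<omega>. num_requests n (cfg \<omega>) s = k)"
proof (cases k)
  case 0
  have "Measurable.pred M (\<lambda>\<omega>. False)" by simp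
  then show ?thesis
    by (rule measurable_cong[THEN iffD1, rotated])
       (use request_configuration.num_requests_pos[OF configuration assms] 0 in blast)
next
  case (Suc l)
  have [measurable]: "(\<lambda>\<omega>. num_requests_before n (cfg \<omega>) t) \<in> measurable M (count_space UNIV)" for t
    by (rule num_requests_before_measurable)
  have [measurable]: "Measurable.pred M (\<lambda>\<omega>. T i \<omega> \<inter> {a..<b} \<noteq> {})" for a b
    by (rule hit_measurable[OF assms])
  have "Measurable.pred M (\<lambda>\<omega>. \<exists>a b :: rat. num_requests_before n (cfg \<omega>) (real_of_rat a) = l \<and>
        num_requests_before n (cfg \<omega>) (real_of_rat b) = Suc l \<and>
        T i \<omega> \<inter> {real_of_rat a..<real_of_rat b} \<noteq> {})"
    by measurable
  then show ?thesis
    by (rule measurable_cong[THEN iffD1, rotated])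
       (simp only: Suc request_configuration.num_requests_eq_Suc_iff[OF configuration assms])
qed

lemma request_label_measurable:
  "(\<lambda>\<omega>. request_label n (cfg \<omega>) k) \<in> measurable M (count_space UNIV)"
proof -
  have S: "Measurable.pred M (\<lambda>\<omega>. request_label n (cfg \<omega>) k = Some i)" for i
  proof (cases "i \<in> {1..n}")
    case True
    show ?thesis unfolding request_label_eq_Some_iff
      using True by (intro pred_intros_logic(2-4) pred_intros_finite(3) num_requests_at_label_measurable) auto
  next
    case False
    then have "request_label n (cfg \<omega>) k \<noteq> Some i" for \<omega> using request_label_in_range by blast
    then show ?thesis by simp
  qed
  have N: "Measurable.pred M (\<lambda>\<omega>. request_label n (cfg \<omega>) k = None)"
  proof -
    have "Measurable.pred M (\<lambda>\<omega>. \<forall>i. \<not> request_label n (cfg \<omega>) k = Some i)"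
      by (intro pred_intros_countable pred_intros_logic(2) S)
    then show ?thesis by (rule measurable_cong[THEN iffD1, rotated]) auto
  qed
  have "Measurable.pred M (\<lambda>\<omega>. request_label n (cfg \<omega>) k = x)" for x
    using S N by (cases x) auto
  then show ?thesis
    by (subst measurable_count_space_eq2_countable) (auto simp: pred_def vimage_def Int_def conj_commute)
qed

lemma position_after_measurable:
  "(\<lambda>\<omega>. position_after n \<pi> (cfg \<omega>) k i) \<in> measurable M (count_space UNIV)"
proof (induction k arbitrary: i)
  case 0
  then show ?case by simp
next
  case (Suc k)
  have mtf: "(\<lambda>\<omega>. move_to_front j (position_after n \<pi> (cfg \<omega>) k) i) \<in> measurable M (count_space UNIV)" for j
  proof -
    have "(\<lambda>\<omega>. (\<lambda>p q \<omega>. if i = j then 1 else if p < q then p + 1 else p) (position_after n \<pi> (cfg \<omega>) k i)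
        (position_after n \<pi> (cfg \<omega>) k j) \<omega>) \<in> measurable M (count_space UNIV)"
      by (rule measurable_compose_countable[OF measurable_compose_countable[OF _ Suc] Suc]) simp
    then show ?thesis by (simp add: move_to_front_def)
  qed
  have "(\<lambda>\<omega>. (case l of None \<Rightarrow> position_after n \<pi> (cfg \<omega>) k
        | Some j \<Rightarrow> move_to_front j (position_after n \<pi> (cfg \<omega>) k)) i) \<in> measurable M (count_space UNIV)" for l
    by (cases l) (simp_all add: mtf Suc)
  then have "(\<lambda>\<omega>. (case request_label n (cfg \<omega>) (Suc k) of None \<Rightarrow> position_after n \<pi> (cfg \<omega>) k
        | Some j \<Rightarrow> move_to_front j (position_after n \<pi> (cfg \<omega>) k)) i) \<in> measurable M (count_space UNIV)"
    by (rule measurable_compose_countable[OF _ request_label_measurable])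
  then show ?case by simp
qed

lemma position_at_measurable:
  "(\<lambda>\<omega>. position_at n \<pi> (cfg \<omega>) t i) \<in> measurable M (count_space UNIV)"
  unfolding position_at_def
  by (rule measurable_compose_countable[OF position_after_measurable num_requests_before_measurable])

lemma next_label_measurable:
  "(\<lambda>\<omega>. next_label n (cfg \<omega>) t) \<in> measurable M (count_space UNIV)"
  unfolding next_label_def
  by (rule measurable_compose_countable[OF request_label_measurable
      measurable_compose[OF num_requests_before_measurable]]) simp

lemma search_cost_measurable:
  "(\<lambda>\<omega>. search_cost n \<pi> (cfg \<omega>) t) \<in> measurable M (count_space UNIV)"
proof -
  have "(\<lambda>\<omega>. case l of None \<Rightarrow> 0 | Some i \<Rightarrow> position_at n \<pi> (cfg \<omega>) t i) \<in> measurable M (count_space UNIV)" for l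
    by (cases l) (simp_all add: position_at_measurable)
  then have "(\<lambda>\<omega>. case next_label n (cfg \<omega>) t of None \<Rightarrow> 0 | Some i \<Rightarrow> position_at n \<pi> (cfg \<omega>) t i) \<in>
      measurable M (count_space UNIV)"
    by (rule measurable_compose_countable[OF _ next_label_measurable])
  then show ?thesis
  proof (rule measurable_cong[THEN iffD1, rotated])
    fix \<omega> assume \<omega>: "\<omega> \<in> space M"
    show "(case next_label n (cfg \<omega>) t of None \<Rightarrow> 0 | Some i \<Rightarrow> position_at n \<pi> (cfg \<omega>) t i) =
        search_cost n \<pi> (cfg \<omega>) t"
      by (cases "next_label n (cfg \<omega>) t")
         (simp_all add: request_configuration.search_cost_None[OF configuration[OF \<omega>]]
            request_configuration.search_cost_next[OF configuration[OF \<omega>]])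
  qed
qed

end

section \<open>Random subsets with independent membership\<close>

text \<open>The law of a random subset of \<open>A\<close> that contains each \<open>i\<close> with probability \<open>b i\<close>, independently.\<close>

definition subset_prob :: "'i set \<Rightarrow> ('i \<Rightarrow> real) \<Rightarrow> 'i set \<Rightarrow> real" where
  "subset_prob A b C = (\<Prod>i\<in>C. b i) * (\<Prod>i\<in>A - C. 1 - b i)"

definition subset_mean :: "'i set \<Rightarrow> ('i \<Rightarrow> real) \<Rightarrow> ('i set \<Rightarrow> real) \<Rightarrow> real" where
  "subset_mean A b f = (\<Sum>C\<in>Pow A. subset_prob A b C * f C)"

lemma subset_prob_nonneg:
  "C \<subseteq> A \<Longrightarrow> (\<And>i. i \<in> A \<Longrightarrow> 0 \<le> b i \<and> b i \<le> 1) \<Longrightarrow> 0 \<le> subset_prob A b C"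
  unfolding subset_prob_def by (intro mult_nonneg_nonneg prod_nonneg) auto

lemma subset_mean_empty [simp]: "subset_mean {} b f = f {}"
  by (simp add: subset_mean_def subset_prob_def)

lemma subset_mean_insert:
  assumes "finite A" "a \<notin> A"
  shows "subset_mean (insert a A) b f =
    b a * subset_mean A b (\<lambda>C. f (insert a C)) + (1 - b a) * subset_mean A b f"
proof -
  have fin: "C \<subseteq> A \<Longrightarrow> finite C" for C using assms(1) finite_subset by blast
  have inj: "inj_on (insert a) (Pow A)" using assms(2) by (auto simp: inj_on_def)
  have 1: "subset_prob (insert a A) b C = (1 - b a) * subset_prob A b C" if "C \<subseteq> A" for C
  proof -
    have "insert a A - C = insert a (A - C)" using that assms(2) by auto
    then show ?thesis using assms by (simp add: subset_prob_def)
  qed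
  have 2: "subset_prob (insert a A) b (insert a C) = b a * subset_prob A b C" if "C \<subseteq> A" for C
  proof -
    have "insert a A - insert a C = A - C" "a \<notin> C" using that assms(2) by auto
    then show ?thesis using fin[OF that] by (simp add: subset_prob_def)
  qed
  have "subset_mean (insert a A) b f = (\<Sum>C\<in>Pow A \<union> insert a ` Pow A. subset_prob (insert a A) b C * f C)"
    unfolding subset_mean_def Pow_insert ..
  also have "\<dots> = (\<Sum>C\<in>Pow A. subset_prob (insert a A) b C * f C) +
      (\<Sum>C\<in>insert a ` Pow A. subset_prob (insert a A) b C * f C)"
    using assms by (intro sum.union_disjoint) auto
  also have "(\<Sum>C\<in>insert a ` Pow A. subset_prob (insert a A) b C * f C) =
      (\<Sum>C\<in>Pow A. subset_prob (insert a A) b (insert a C) * f (insert a C))"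
    using inj by (simp add: sum.reindex)
  finally show ?thesis
    by (simp add: subset_mean_def 1 2 sum_distrib_left mult.assoc)
qed

lemma subset_mean_const: "finite A \<Longrightarrow> subset_mean A b (\<lambda>_. c) = c"
  by (induction A rule: finite_induct) (auto simp: subset_mean_insert algebra_simps)

lemma subset_mean_add: "subset_mean A b (\<lambda>C. f C + g C) = subset_mean A b f + subset_mean A b g"
  by (simp add: subset_mean_def sum.distrib distrib_left)

lemma subset_mean_cmult: "subset_mean A b (\<lambda>C. c * f C) = c * subset_mean A b f"
  by (simp add: subset_mean_def sum_distrib_left mult.left_commute)

lemma subset_mean_diff: "subset_mean A b (\<lambda>C. f C - g C) = subset_mean A b f - subset_mean A b g"
  by (simp add: subset_mean_def sum_subtractf right_diff_distrib)

lemma subset_mean_sum: "subset_mean A b (\<lambda>C. \<Sum>i\<in>I. f i C) = (\<Sum>i\<in>I. subset_mean A b (f i))"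
  unfolding subset_mean_def by (subst sum.swap) (simp add: sum_distrib_left)

lemma subset_mean_mono:
  assumes "\<And>i. i \<in> A \<Longrightarrow> 0 \<le> b i \<and> b i \<le> 1" "\<And>C. C \<subseteq> A \<Longrightarrow> f C \<le> g C"
  shows "subset_mean A b f \<le> subset_mean A b g"
  unfolding subset_mean_def using assms by (intro sum_mono mult_left_mono subset_prob_nonneg) auto

lemma subset_mean_nonneg:
  assumes "\<And>i. i \<in> A \<Longrightarrow> 0 \<le> b i \<and> b i \<le> 1" "\<And>C. C \<subseteq> A \<Longrightarrow> 0 \<le> f C"
  shows "0 \<le> subset_mean A b f"
  unfolding subset_mean_def using assms by (intro sum_nonneg mult_nonneg_nonneg subset_prob_nonneg) auto

lemma subset_mean_notin:
  assumes "finite A" "a \<in> A"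
  shows "subset_mean A b (\<lambda>C. of_bool (a \<notin> C)) = 1 - b a"
proof -
  have "subset_mean (insert a (A - {a})) b (\<lambda>C. of_bool (a \<notin> C)) =
     (1 - b a) * subset_mean (A - {a}) b (\<lambda>C. of_bool (a \<notin> C))"
    using assms by (subst subset_mean_insert) (auto simp: subset_mean_def)
  also have "subset_mean (A - {a}) b (\<lambda>C. of_bool (a \<notin> C)) = subset_mean (A - {a}) b (\<lambda>_. 1)"
    unfolding subset_mean_def by (intro sum.cong) auto
  finally show ?thesis using assms by (simp add: subset_mean_const insert_absorb)
qed

text \<open>Variance plus squared bias for the number of elements of \<open>J\<close> that are left out. The shift \<open>c\<close> makes
  the induction possible, since conditioning on one element moves the centre.\<close>

lemma subset_mean_complement_deviation:
  assumes "finite A" "J \<subseteq> A"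
  shows "subset_mean A b (\<lambda>C. (real (card (J - C)) - (\<Sum>j\<in>J. 1 - b j) + c)\<^sup>2) =
    (\<Sum>j\<in>J. b j * (1 - b j)) + c\<^sup>2"
  using assms
proof (induction A arbitrary: J c rule: finite_induct)
  case (insert a A)
  show ?case
  proof (cases "a \<in> J")
    case False
    then have J: "J \<subseteq> A" using insert.prems by auto
    have "J - insert a C = J - C" for C using False by auto
    then show ?thesis using insert.IH[OF J] insert.hyps
      by (simp add: subset_mean_insert algebra_simps)
  next
    case True
    define J' where "J' = J - {a}"
    have J': "J' \<subseteq> A" "J = insert a J'" "a \<notin> J'" "finite J'"
      using insert.prems insert.hyps True finite_subset[of J' A] by (auto simp: J'_def)
    have c1: "J - insert a C = J' - C" for C by (auto simp: J'_def)
    have c2: "real (card (J - C)) = 1 + real (card (J' - C))" if "C \<subseteq> A" for C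
    proof -
      have "J - C = insert a (J' - C)" using that insert.hyps J' by auto
      then show ?thesis using J' by simp
    qed
    have s: "(\<Sum>j\<in>J. 1 - b j) = (1 - b a) + (\<Sum>j\<in>J'. 1 - b j)"
      "(\<Sum>j\<in>J. b j * (1 - b j)) = b a * (1 - b a) + (\<Sum>j\<in>J'. b j * (1 - b j))" using J' by simp_all
    have "subset_mean A b (\<lambda>C. (real (card (J - insert a C)) - (\<Sum>j\<in>J. 1 - b j) + c)\<^sup>2) =
       subset_mean A b (\<lambda>C. (real (card (J' - C)) - (\<Sum>j\<in>J'. 1 - b j) + (c - (1 - b a)))\<^sup>2)"
      unfolding c1 s by (simp add: algebra_simps)
    moreover have "subset_mean A b (\<lambda>C. (real (card (J - C)) - (\<Sum>j\<in>J. 1 - b j) + c)\<^sup>2) =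
       subset_mean A b (\<lambda>C. (real (card (J' - C)) - (\<Sum>j\<in>J'. 1 - b j) + (c + b a))\<^sup>2)"
      unfolding s subset_mean_def by (intro sum.cong refl) (simp add: c2 algebra_simps)
    ultimately have "subset_mean (insert a A) b (\<lambda>C. (real (card (J - C)) - (\<Sum>j\<in>J. 1 - b j) + c)\<^sup>2) =
      b a * ((\<Sum>j\<in>J'. b j * (1 - b j)) + (c - (1 - b a))\<^sup>2) +
      (1 - b a) * ((\<Sum>j\<in>J'. b j * (1 - b j)) + (c + b a)\<^sup>2)"
      using insert.hyps insert.IH[OF J'(1)] by (simp add: subset_mean_insert)
    then show ?thesis unfolding s by (simp add: power2_eq_square algebra_simps)
  qed
qed simp

text \<open>The variance of a sum of \<open>card A\<close> indicators is at most \<open>card A\<close>. The bias is at most 1, so its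
  square may be replaced by its absolute value, whose mean over the weights is known to vanish.\<close>

lemma subset_mean_square_deviation:
  assumes A: "finite A" "A \<noteq> {}" "J \<subseteq> A" and b: "\<And>i. i \<in> A \<Longrightarrow> 0 \<le> b i \<and> b i \<le> 1"
    and a: "0 \<le> a" "a \<le> 1"
  shows "subset_mean A b (\<lambda>C. (real (card (J - C)) / card A - a)\<^sup>2) \<le>
    1 / card A + \<bar>(\<Sum>j\<in>J. 1 - b j) / card A - a\<bar>"
proof -
  define N where "N = real (card A)"
  define s where "s = (\<Sum>j\<in>J. 1 - b j)"
  have N: "0 < N" using A by (simp add: N_def card_gt_0_iff)
  have J: "finite J" "real (card J) \<le> N" using A finite_subset by (auto simp: N_def intro: card_mono)
  have s: "0 \<le> s" "s \<le> N"
  proof -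
    show "0 \<le> s" unfolding s_def using b A(3) by (intro sum_nonneg) auto
    have "s \<le> (\<Sum>j\<in>J. 1)" unfolding s_def using b A(3) by (intro sum_mono) auto
    then show "s \<le> N" using J by simp
  qed
  have v: "(\<Sum>j\<in>J. b j * (1 - b j)) \<le> N"
  proof -
    have "(\<Sum>j\<in>J. b j * (1 - b j)) \<le> (\<Sum>j\<in>J. 1)"
    proof (rule sum_mono)
      fix j assume "j \<in> J"
      then have "0 \<le> b j" "b j \<le> 1" using b A(3) by auto
      then show "b j * (1 - b j) \<le> 1" by (intro mult_le_one) auto
    qed
    then show ?thesis using J by simp
  qed
  have eq: "(x / N - a)\<^sup>2 = (1 / N\<^sup>2) * (x - s + (s - a * N))\<^sup>2" for x
    using N by (simp add: power2_eq_square field_simps)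
  have "subset_mean A b (\<lambda>C. (real (card (J - C)) / N - a)\<^sup>2) =
      (1 / N\<^sup>2) * ((\<Sum>j\<in>J. b j * (1 - b j)) + (s - a * N)\<^sup>2)"
    unfolding eq subset_mean_cmult s_def subset_mean_complement_deviation[OF A(1,3)] ..
  also have "\<dots> \<le> (1 / N\<^sup>2) * (N + (s - a * N)\<^sup>2)"
    using v by (intro mult_left_mono) auto
  also have "\<dots> = 1 / N + (s / N - a)\<^sup>2" using N by (simp add: power2_eq_square field_simps)
  also have "(s / N - a)\<^sup>2 \<le> \<bar>s / N - a\<bar>"
  proof -
    have "0 \<le> s / N" "s / N \<le> 1" using s N by auto
    then have "\<bar>s / N - a\<bar> \<le> 1" using a by (auto simp: abs_le_iff)
    then have "\<bar>s / N - a\<bar> * \<bar>s / N - a\<bar> \<le> \<bar>s / N - a\<bar>" by (intro mult_left_le) auto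
    then show ?thesis by (simp add: power2_eq_square)
  qed
  finally show ?thesis by (simp add: N_def s_def)
qed

lemma abs_le_add_square: "0 < d \<Longrightarrow> \<bar>x\<bar> \<le> d + x\<^sup>2 / (d :: real)"
proof -
  assume d: "0 < d"
  show ?thesis
  proof (cases "\<bar>x\<bar> \<le> d")
    case True
    then show ?thesis using d by (intro add_increasing2) auto
  next
    case False
    then have "\<bar>x\<bar> * d \<le> \<bar>x\<bar> * \<bar>x\<bar>" by (intro mult_left_mono) auto
    then have "\<bar>x\<bar> \<le> x\<^sup>2 / d" using d by (simp add: pos_le_divide_eq power2_eq_square)
    then show ?thesis using d by simp
  qed
qed

lemma subset_mean_abs_deviation:
  assumes A: "finite A" "A \<noteq> {}" "J \<subseteq> A" and b: "\<And>i. i \<in> A \<Longrightarrow> 0 \<le> b i \<and> b i \<le> 1"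
    and a: "0 \<le> a" "a \<le> 1" and d: "0 < d"
  shows "subset_mean A b (\<lambda>C. \<bar>real (card (J - C)) / card A - a\<bar>) \<le>
    d + (1 / card A + \<bar>(\<Sum>j\<in>J. 1 - b j) / card A - a\<bar>) / d"
proof -
  have "subset_mean A b (\<lambda>C. \<bar>real (card (J - C)) / card A - a\<bar>) \<le>
      subset_mean A b (\<lambda>C. d + (1 / d) * (real (card (J - C)) / card A - a)\<^sup>2)"
    using b abs_le_add_square[OF d] by (intro subset_mean_mono) auto
  also have "\<dots> = d + (1 / d) * subset_mean A b (\<lambda>C. (real (card (J - C)) / card A - a)\<^sup>2)"
    unfolding subset_mean_add subset_mean_cmult subset_mean_const[OF A(1)] ..
  also have "\<dots> \<le> d + (1 / d) * (1 / card A + \<bar>(\<Sum>j\<in>J. 1 - b j) / card A - a\<bar>)"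
    using d by (intro add_left_mono mult_left_mono subset_mean_square_deviation A b a) auto
  finally show ?thesis by simp
qed

lemma subset_mean_abs_diff_le:
  assumes "finite A" "\<And>i. i \<in> A \<Longrightarrow> 0 \<le> b i \<and> b i \<le> 1"
  shows "\<bar>subset_mean A b f - c\<bar> \<le> subset_mean A b (\<lambda>C. \<bar>f C - c\<bar>)"
proof -
  have e: "subset_mean A b f - c = subset_mean A b (\<lambda>C. f C - c)"
    using assms(1) by (simp add: subset_mean_diff subset_mean_const)
  have "subset_mean A b (\<lambda>C. f C - c) \<le> subset_mean A b (\<lambda>C. \<bar>f C - c\<bar>)"
    "subset_mean A b (\<lambda>C. (- 1) * \<bar>f C - c\<bar>) \<le> subset_mean A b (\<lambda>C. f C - c)"
    by (rule subset_mean_mono[OF assms(2)]; simp)+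
  then show ?thesis unfolding e subset_mean_cmult by linarith
qed

section \<open>Counting by rank\<close>

text \<open>The ranks of the elements of \<open>D\<close> are the numbers below \<open>card D\<close>, each taken once.\<close>

lemma card_rank_less:
  fixes D :: "nat set"
  assumes "finite D" shows "card {i\<in>D. card {j\<in>D. i < j} < k} = min (card D) k"
  using assms
proof (induction D rule: finite_linorder_min_induct)
  case (insert b A)
  have b: "b \<notin> A" using insert.hyps by auto
  have r: "{j\<in>insert b A. a < j} = {j\<in>A. a < j}" if "a \<in> A" for a using insert.hyps that by auto
  have rb: "{j\<in>insert b A. b < j} = A" using insert.hyps by auto
  have "{i\<in>insert b A. card {j\<in>insert b A. i < j} < k} =
      {i\<in>A. card {j\<in>A. i < j} < k} \<union> (if card A < k then {b} else {})"
  proof (intro set_eqI iffI)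
    fix i assume "i \<in> {i\<in>insert b A. card {j\<in>insert b A. i < j} < k}"
    then show "i \<in> {i\<in>A. card {j\<in>A. i < j} < k} \<union> (if card A < k then {b} else {})"
      using r[of i] rb by (cases "i = b") simp_all
  next
    fix i assume "i \<in> {i\<in>A. card {j\<in>A. i < j} < k} \<union> (if card A < k then {b} else {})"
    then show "i \<in> {i\<in>insert b A. card {j\<in>insert b A. i < j} < k}"
      using r[of i] rb b by (cases "i = b") (simp_all split: if_splits)
  qed
  then show ?case using insert b by (auto simp: min_def)
qed simp

text \<open>Two upper sets are nested.\<close>

lemma card_upper_upper:
  fixes D :: "'b :: linorder set"
  assumes "finite D" "U \<subseteq> D" "V \<subseteq> D"
    and "\<And>i j. i \<in> U \<Longrightarrow> j \<in> D \<Longrightarrow> i < j \<Longrightarrow> j \<in> U" "\<And>i j. i \<in> V \<Longrightarrow> j \<in> D \<Longrightarrow> i < j \<Longrightarrow> j \<in> V"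
  shows "card (U \<inter> V) = min (card U) (card V)"
proof -
  have "U \<subseteq> V \<or> V \<subseteq> U" using assms(2-) by (metis in_mono linorder_neqE subsetI)
  moreover have "finite U" "finite V" using finite_subset[OF _ assms(1)] assms(2,3) by blast+
  ultimately show ?thesis by (auto simp: Int_absorb1 Int_absorb2 min_def dest: card_mono)
qed

text \<open>An upper and a lower set are disjoint, or else they cover \<open>D\<close>. In the first case the difference on
  the right is truncated to 0.\<close>

lemma card_upper_lower:
  fixes D :: "'b :: linorder set"
  assumes "finite D" "U \<subseteq> D" "V \<subseteq> D"
    and "\<And>i j. i \<in> U \<Longrightarrow> j \<in> D \<Longrightarrow> i < j \<Longrightarrow> j \<in> U" "\<And>i j. i \<in> V \<Longrightarrow> j \<in> D \<Longrightarrow> j < i \<Longrightarrow> j \<in> V"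
  shows "card (U \<inter> V) = card U + card V - card D"
proof -
  have fin: "finite U" "finite V" using finite_subset[OF _ assms(1)] assms(2,3) by blast+
  have "U \<inter> V = {} \<or> U \<union> V = D"
  proof (rule ccontr)
    assume "\<not> (U \<inter> V = {} \<or> U \<union> V = D)"
    then obtain i x where "i \<in> U" "i \<in> V" "x \<in> D" "x \<notin> U" "x \<notin> V" using assms(2,3) by blast
    then show False using assms(4)[of i x] assms(5)[of i x] by (metis linorder_neqE)
  qed
  then show ?thesis
  proof
    assume e: "U \<inter> V = {}"
    then have "card (U \<union> V) = card U + card V" using fin by (simp add: card_Un_disjoint)
    moreover have "card (U \<union> V) \<le> card D" using assms by (intro card_mono) auto
    ultimately show ?thesis using e by simp
  next
    assume e: "U \<union> V = D"
    show ?thesis using card_Un_Int[OF fin] e by simp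
  qed
qed

lemma sum_of_bool_card: "finite A \<Longrightarrow> (\<Sum>i\<in>A. of_bool (Q i)) = real (card {i\<in>A. Q i})"
  by (simp add: of_bool_def sum.If_cases Int_def)

section \<open>Joint law of the requested objects and the next request\<close>

text \<open>The parameter 0, which gives the point mass at 0, occurs for objects of weight zero.\<close>

definition poisson_weight :: "real \<Rightarrow> nat \<Rightarrow> real" where
  "poisson_weight l k = l ^ k / fact k * exp (- l)"

definition poisson_measure :: "real \<Rightarrow> nat set \<Rightarrow> ennreal" where
  "poisson_measure l K = (\<integral>\<^sup>+k. ennreal (poisson_weight l k) \<partial>count_space K)"

lemma poisson_weight_nonneg: "0 \<le> l \<Longrightarrow> 0 \<le> poisson_weight l k"
  by (simp add: poisson_weight_def)

lemma poisson_measure_singleton: "poisson_measure l {k} = ennreal (poisson_weight l k)"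
  by (simp add: poisson_measure_def nn_integral_count_space_finite)

lemma poisson_measure_UNIV:
  assumes "0 \<le> l" shows "poisson_measure l UNIV = 1"
proof -
  have "(\<lambda>k. exp (- l) * (l ^ k /\<^sub>R fact k)) sums (exp (- l) * exp l)"
    by (intro sums_mult exp_converges)
  moreover have "exp (- l) * exp l = 1" by (simp flip: exp_add)
  ultimately have s: "(\<lambda>k. poisson_weight l k) sums 1"
    by (simp add: poisson_weight_def divide_inverse mult_ac)
  show ?thesis unfolding poisson_measure_def nn_integral_count_space_nat
    using s poisson_weight_nonneg[OF assms] by (simp add: suminf_ennreal2 sums_iff)
qed

lemma poisson_measure_0: "poisson_measure l {0} = ennreal (exp (- l))"
  by (simp add: poisson_measure_singleton poisson_weight_def)

lemma poisson_measure_pos: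
  assumes "0 \<le> l" shows "poisson_measure l {0<..} = ennreal (1 - exp (- l))"
proof -
  have "poisson_measure l UNIV = (\<integral>\<^sup>+k. ennreal (poisson_weight l k) * indicator {0} k +
      ennreal (poisson_weight l k) * indicator {0<..} k \<partial>count_space UNIV)"
    unfolding poisson_measure_def by (intro nn_integral_cong) (auto simp: indicator_def)
  also have "\<dots> = poisson_measure l {0} + poisson_measure l {0<..}"
    by (subst nn_integral_add) (auto simp: poisson_measure_def nn_integral_count_space_indicator)
  finally have e: "1 = ennreal (exp (- l)) + poisson_measure l {0<..}"
    using poisson_measure_UNIV[OF assms] by (simp add: poisson_measure_0)
  have "1 - ennreal (exp (- l)) = poisson_measure l {0<..}"
    by (subst e) (simp add: ennreal_add_diff_cancel_left)
  moreover have "1 - ennreal (exp (- l)) = ennreal (1 - exp (- l))"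
    by (simp add: ennreal_minus flip: ennreal_1)
  ultimately show ?thesis by simp
qed

context move_to_front_chain begin

definition pop :: "nat \<Rightarrow> 'a \<Rightarrow> real" where "pop i \<omega> = popularity n (\<lambda>j. w j \<omega>) i"

definition positive_weight :: "'a \<Rightarrow> bool" where
  "positive_weight \<omega> \<longleftrightarrow> (\<Sum>j\<in>{1..n}. w j \<omega>) \<noteq> 0"

lemma pop_nonneg: "i \<in> {1..n} \<Longrightarrow> \<omega> \<in> space M \<Longrightarrow> 0 \<le> pop i \<omega>"
  unfolding pop_def popularity_def
  by (intro divide_nonneg_nonneg sum_nonneg weights_nonneg) auto

lemma sum_pop: "(\<Sum>i\<in>{1..n}. pop i \<omega>) = of_bool (positive_weight \<omega>)"
  by (simp add: pop_def popularity_def positive_weight_def flip: sum_divide_distrib)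

lemma pop_le_1: "i \<in> {1..n} \<Longrightarrow> \<omega> \<in> space M \<Longrightarrow> pop i \<omega> \<le> 1"
proof -
  assume i: "i \<in> {1..n}" and \<omega>: "\<omega> \<in> space M"
  have "pop i \<omega> \<le> (\<Sum>i\<in>{1..n}. pop i \<omega>)"
    using i \<omega> pop_nonneg by (intro member_le_sum) auto
  also have "\<dots> \<le> 1" by (simp only: sum_pop) simp
  finally show ?thesis .
qed

lemma pop_measurable: "i \<in> {1..n} \<Longrightarrow> pop i \<in> borel_measurable M"
  unfolding pop_def popularity_def
  by (intro borel_measurable_divide borel_measurable_sum weights_measurable)

lemma positive_weight_measurable: "Measurable.pred M positive_weight"
proof -
  have [measurable]: "(\<lambda>\<omega>. \<Sum>j\<in>{1..n}. w j \<omega>) \<in> borel_measurable M"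
    by (intro borel_measurable_sum weights_measurable)
  show ?thesis unfolding positive_weight_def by measurable
qed

lemma subalgebra_weights: "subalgebra M (weights_algebra M n w)"
proof -
  have "(\<lambda>\<omega>. \<lambda>i\<in>{1..n}. w i \<omega>) \<in> measurable M (PiM {1..n} (\<lambda>_. borel))"
    by (intro measurable_restrict weights_measurable)
  then show ?thesis unfolding subalgebra_def weights_algebra_def
    by (intro conjI sets_image_in_sets) (simp_all only: space_vimage_algebra)
qed

lemma poisson_weight_measurable:
  assumes "f \<in> borel_measurable M" shows "(\<lambda>\<omega>. poisson_weight (f \<omega>) k) \<in> borel_measurable M"
  using assms unfolding poisson_weight_def by measurable

lemma count_set_measurable:
  "Measurable.pred M (\<lambda>\<omega>. \<forall>i\<in>{1..n}. \<forall>j<m. card (T i \<omega> \<inter> {t j..<t (Suc j)}) \<in> K (i, j))"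
proof -
  have "Measurable.pred M (\<lambda>\<omega>. \<forall>i\<in>{1..n}. \<forall>j\<in>{..<m}. card (T i \<omega> \<inter> {t j..<t (Suc j)}) \<in> K (i, j))"
    by (intro pred_intros_finite(3) measurable_compose[OF count_measurable]) auto
  then show ?thesis by (simp only: Ball_def lessThan_iff)
qed

lemma count_law_singletons:
  fixes t :: "nat \<Rightarrow> real" and k :: "nat \<times> nat \<Rightarrow> nat"
  assumes "0 \<le> t 0" "mono t"
  shows "emeasure M {\<omega>\<in>space M. \<forall>i\<in>{1..n}. \<forall>j<m. card (T i \<omega> \<inter> {t j..<t (Suc j)}) = k (i, j)} =
    (\<integral>\<^sup>+\<omega>. (\<Prod>p\<in>{1..n} \<times> {..<m}.
        ennreal (poisson_weight (pop (fst p) \<omega> * (t (Suc (snd p)) - t (snd p))) (k p))) \<partial>M)"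
proof -
  interpret finite_measure_subalgebra M "weights_algebra M n w"
    by unfold_locales (rule subalgebra_weights)
  define A where "A = {\<omega>\<in>space M. \<forall>i\<in>{1..n}. \<forall>j<m. card (T i \<omega> \<inter> {t j..<t (Suc j)}) = k (i, j)}"
  let ?f = "\<lambda>\<omega>. \<Prod>p\<in>{1..n} \<times> {..<m}. poisson_weight (pop (fst p) \<omega> * (t (Suc (snd p)) - t (snd p))) (k p)"
  have A: "A \<in> sets M" using count_set_measurable[of m t "\<lambda>p. {k p}"]
    unfolding pred_def A_def by (simp only: singleton_iff)
  then have iA: "integrable M (indicator A :: 'a \<Rightarrow> real)"
    by (intro integrable_real_indicator) (simp_all add: emeasure_eq_measure)
  have inc: "t j \<le> t (Suc j)" for j using assms(2) by (simp add: mono_iff_le_Suc)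
  have fm: "?f \<in> borel_measurable M"
    by (intro borel_measurable_prod poisson_weight_measurable borel_measurable_times pop_measurable) auto
  have "AE \<omega> in M. real_cond_exp M (weights_algebra M n w) (indicator A) \<omega> =
     (\<Prod>i\<in>{1..n}. \<Prod>j<m. (let l = popularity n (\<lambda>j. w j \<omega>) i * (t (Suc j) - t j) in
                l ^ (\<lambda>i j. k (i, j)) i j / fact ((\<lambda>i j. k (i, j)) i j) * exp (- l)))"
    unfolding A_def
    by (rule requests[unfolded cond_indep_poisson_processes_def, THEN conjunct2, THEN conjunct2,
        THEN spec[of _ m], THEN spec[of _ t], THEN spec[of _ "\<lambda>i j. k (i, j)"], THEN mp, OF conjI[OF assms]])
  then have ae: "AE \<omega> in M. real_cond_exp M (weights_algebra M n w) (indicator A) \<omega> = ?f \<omega>"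
    by eventually_elim (simp add: prod.cartesian_product poisson_weight_def pop_def Let_def case_prod_unfold)
  have int: "integrable M ?f"
    by (rule integrable_cong_AE_imp[OF real_cond_exp_int(1)[OF iA] fm]) (use ae in \<open>auto\<close>)
  have nn: "\<omega> \<in> space M \<Longrightarrow> p \<in> {1..n} \<times> {..<m} \<Longrightarrow>
      0 \<le> poisson_weight (pop (fst p) \<omega> * (t (Suc (snd p)) - t (snd p))) (k p)" for \<omega> p
    using inc pop_nonneg by (intro poisson_weight_nonneg mult_nonneg_nonneg) auto
  have "emeasure M A = ennreal (\<integral>\<omega>. indicator A \<omega> \<partial>M)"
    using A by (simp add: emeasure_eq_measure)
  also have "(\<integral>\<omega>. indicator A \<omega> \<partial>M) = (\<integral>\<omega>. real_cond_exp M (weights_algebra M n w) (indicator A) \<omega> \<partial>M)"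
    by (rule real_cond_exp_int(2)[OF iA, symmetric])
  also have "\<dots> = (\<integral>\<omega>. ?f \<omega> \<partial>M)"
    using ae fm by (intro integral_cong_AE) auto
  also have "ennreal \<dots> = (\<integral>\<^sup>+\<omega>. ennreal (?f \<omega>) \<partial>M)"
    using int nn by (intro nn_integral_eq_integral[symmetric]) (auto intro!: AE_I2 prod_nonneg)
  also have "\<dots> = (\<integral>\<^sup>+\<omega>. (\<Prod>p\<in>{1..n} \<times> {..<m}.
        ennreal (poisson_weight (pop (fst p) \<omega> * (t (Suc (snd p)) - t (snd p))) (k p))) \<partial>M)"
    using nn by (intro nn_integral_cong) (auto simp: prod_ennreal)
  finally show ?thesis unfolding A_def .
qed

lemma poisson_measure_measurable:
  assumes "f \<in> borel_measurable M" shows "(\<lambda>\<omega>. poisson_measure (f \<omega>) K) \<in> borel_measurable M"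
proof -
  note [measurable] = assms
  have "(\<lambda>\<omega>. poisson_measure (f \<omega>) K) =
      (\<lambda>\<omega>. \<Sum>k. ennreal (poisson_weight (f \<omega>) k) * indicator K k)"
    by (simp add: poisson_measure_def nn_integral_count_space_indicator nn_integral_count_space_nat)
  also have "\<dots> \<in> borel_measurable M" unfolding poisson_weight_def by measurable
  finally show ?thesis .
qed

text \<open>The assumption on the processes prescribes every count. They are set free one at a time: adding the
  formulas for all admissible values of one count replaces its Poisson weight by a Poisson probability.\<close>

lemma count_law:
  fixes t :: "nat \<Rightarrow> real" and K :: "nat \<times> nat \<Rightarrow> nat set"
  assumes t: "0 \<le> t 0" "mono t"
  shows "emeasure M {\<omega>\<in>space M. \<forall>i\<in>{1..n}. \<forall>j<m. card (T i \<omega> \<inter> {t j..<t (Suc j)}) \<in> K (i, j)} =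
    (\<integral>\<^sup>+\<omega>. (\<Prod>p\<in>{1..n} \<times> {..<m}.
        poisson_measure (pop (fst p) \<omega> * (t (Suc (snd p)) - t (snd p))) (K p)) \<partial>M)"
proof -
  define S where "S = {1..n} \<times> {..<m}"
  define E where "E K = {\<omega>\<in>space M. \<forall>i\<in>{1..n}. \<forall>j<m. card (T i \<omega> \<inter> {t j..<t (Suc j)}) \<in> K (i, j)}" for K
  define l where "l p \<omega> = pop (fst p) \<omega> * (t (Suc (snd p)) - t (snd p))" for p \<omega>
  have finS: "finite S" by (simp add: S_def)
  have Em: "E K \<in> sets M" for K
    using count_set_measurable[of m t K] unfolding pred_def E_def .
  have lm: "p \<in> S \<Longrightarrow> (\<lambda>\<omega>. poisson_measure (l p \<omega>) K) \<in> borel_measurable M" for p K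
    unfolding l_def S_def by (intro poisson_measure_measurable borel_measurable_times pop_measurable) auto
  have "emeasure M (E K) = (\<integral>\<^sup>+\<omega>. (\<Prod>p\<in>S. poisson_measure (l p \<omega>) (K p)) \<partial>M)"
    if "finite D" "D \<subseteq> S" "\<And>p. p \<in> S - D \<Longrightarrow> \<exists>k. K p = {k}" for D K
    using that
  proof (induction D arbitrary: K rule: finite_induct)
    case empty
    then have "\<forall>p\<in>S. \<exists>k. K p = {k}" by auto
    then obtain k where k: "\<forall>p\<in>S. K p = {k p}" by metis
    have "E K = {\<omega>\<in>space M. \<forall>i\<in>{1..n}. \<forall>j<m. card (T i \<omega> \<inter> {t j..<t (Suc j)}) = k (i, j)}"
      unfolding E_def using k by (auto simp: S_def)
    then have "emeasure M (E K) = (\<integral>\<^sup>+\<omega>. (\<Prod>p\<in>S. ennreal (poisson_weight (l p \<omega>) (k p))) \<partial>M)"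
      using count_law_singletons[OF t, of m k] by (simp add: S_def l_def)
    then show ?case using k by (simp add: poisson_measure_singleton)
  next
    case (insert q D)
    have q: "q \<in> S" "q = (fst q, snd q)" using insert.prems by auto
    define K' where "K' c = K(q := {c})" for c
    have IH: "emeasure M (E (K' c)) = (\<integral>\<^sup>+\<omega>. (\<Prod>p\<in>S. poisson_measure (l p \<omega>) (K' c p)) \<partial>M)" for c
      by (rule insert.IH) (use insert.prems in \<open>auto simp: K'_def\<close>)
    have un: "E K = (\<Union>c\<in>K q. E (K' c))"
      unfolding E_def K'_def using q by (auto simp: S_def fun_upd_def)
    have disj: "disjoint_family_on (\<lambda>c. E (K' c)) (K q)"
      unfolding disjoint_family_on_def E_def K'_def using q
      by (auto simp: S_def fun_upd_def mem_Times_iff split: if_splits)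
    have "emeasure M (E K) = (\<integral>\<^sup>+c. emeasure M (E (K' c)) \<partial>count_space (K q))"
      unfolding un by (intro emeasure_UN_countable Em disj) auto
    also have "\<dots> = (\<integral>\<^sup>+c. (\<integral>\<^sup>+\<omega>. (\<Prod>p\<in>S. poisson_measure (l p \<omega>) (K' c p)) \<partial>M) \<partial>count_space (K q))"
      by (simp only: IH)
    also have "\<dots> = (\<integral>\<^sup>+\<omega>. (\<integral>\<^sup>+c. (\<Prod>p\<in>S. poisson_measure (l p \<omega>) (K' c p)) \<partial>count_space (K q)) \<partial>M)"
      by (intro nn_integral_count_space_nn_integral[symmetric] borel_measurable_prod_ennreal lm) auto
    also have "\<dots> = (\<integral>\<^sup>+\<omega>. (\<Prod>p\<in>S. poisson_measure (l p \<omega>) (K p)) \<partial>M)"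
    proof (rule nn_integral_cong)
      fix \<omega>
      have "(\<Prod>p\<in>S. poisson_measure (l p \<omega>) (K' c p)) =
         ennreal (poisson_weight (l q \<omega>) c) * (\<Prod>p\<in>S - {q}. poisson_measure (l p \<omega>) (K p))" for c
        by (subst prod.remove[OF finS q(1)])
           (auto simp: K'_def poisson_measure_singleton intro!: arg_cong2[where f = "(*)"] prod.cong)
      then have "(\<integral>\<^sup>+c. (\<Prod>p\<in>S. poisson_measure (l p \<omega>) (K' c p)) \<partial>count_space (K q)) =
         poisson_measure (l q \<omega>) (K q) * (\<Prod>p\<in>S - {q}. poisson_measure (l p \<omega>) (K p))"
        by (simp add: nn_integral_multc poisson_measure_def)
      also have "\<dots> = (\<Prod>p\<in>S. poisson_measure (l p \<omega>) (K p))"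
        by (rule prod.remove[OF finS q(1), symmetric])
      finally show "(\<integral>\<^sup>+c. (\<Prod>p\<in>S. poisson_measure (l p \<omega>) (K' c p)) \<partial>count_space (K q)) =
         (\<Prod>p\<in>S. poisson_measure (l p \<omega>) (K p))" .
    qed
    finally show ?case .
  qed
  from this[OF finS order_refl, of K] show ?thesis by (simp add: E_def S_def l_def)
qed

lemma prod_lessThan_1_pairs: "(\<Prod>p\<in>A \<times> {..<Suc 0}. f p) = (\<Prod>i\<in>A. f (i, 0))"
  by (simp add: prod.cartesian_product[symmetric, of "\<lambda>i j. f (i, j)", simplified])

definition hit_prob :: "real \<Rightarrow> 'a \<Rightarrow> nat \<Rightarrow> real" where
  "hit_prob u \<omega> i = 1 - exp (- (pop i \<omega> * u))"

lemma hit_prob_range: "0 \<le> u \<Longrightarrow> i \<in> {1..n} \<Longrightarrow> \<omega> \<in> space M \<Longrightarrow> 0 \<le> hit_prob u \<omega> i \<and> hit_prob u \<omega> i \<le> 1"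
  using pop_nonneg[of i \<omega>] by (simp add: hit_prob_def)

lemma hit_prob_measurable: "i \<in> {1..n} \<Longrightarrow> (\<lambda>\<omega>. hit_prob u \<omega> i) \<in> borel_measurable M"
  unfolding hit_prob_def using pop_measurable by (intro borel_measurable_diff borel_measurable_exp borel_measurable_uminus borel_measurable_times) auto

lemma subset_prob_measurable:
  "C \<subseteq> {1..n} \<Longrightarrow> (\<lambda>\<omega>. subset_prob {1..n} (hit_prob u \<omega>) C) \<in> borel_measurable M"
  unfolding subset_prob_def
  by (intro borel_measurable_times borel_measurable_prod borel_measurable_diff hit_prob_measurable) auto

lemma prod_if_subset:
  assumes "finite A" "C \<subseteq> A"
  shows "(\<Prod>i\<in>A. if i \<in> C then f i else g i) = (\<Prod>i\<in>C. f i) * (\<Prod>i\<in>A - C. g i :: 'b :: comm_monoid_mult)"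
proof -
  have "(\<Prod>i\<in>A. if i \<in> C then f i else g i) =
      (\<Prod>i\<in>A - C. if i \<in> C then f i else g i) * (\<Prod>i\<in>C. if i \<in> C then f i else g i)"
    by (rule prod.subset_diff[OF assms(2,1)])
  then show ?thesis by (simp add: mult.commute)
qed

lemma card_interval_pos_iff:
  assumes "i \<in> {1..n}" "\<omega> \<in> space M"
  shows "card (T i \<omega> \<inter> {a..<b}) > 0 \<longleftrightarrow> T i \<omega> \<inter> {a..<b} \<noteq> {}"
    and "card (T i \<omega> \<inter> {a..<b}) = 0 \<longleftrightarrow> T i \<omega> \<inter> {a..<b} = {}"
  using finite_interval[OF assms, of a b] by (auto simp: card_gt_0_iff)

text \<open>Having been requested is having a nonzero count.\<close>

lemma subset_prob_eq_prod:
  assumes "C \<subseteq> {1..n}" "0 \<le> u" "\<omega> \<in> space M"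
  shows "ennreal (subset_prob {1..n} (hit_prob u \<omega>) C) =
    (\<Prod>i\<in>{1..n}. poisson_measure (pop i \<omega> * u) (if i \<in> C then {0<..} else {0}))"
proof -
  have "subset_prob {1..n} (hit_prob u \<omega>) C =
      (\<Prod>i\<in>{1..n}. if i \<in> C then hit_prob u \<omega> i else 1 - hit_prob u \<omega> i)"
    unfolding subset_prob_def by (subst prod_if_subset) (use assms in auto)
  then have "ennreal (subset_prob {1..n} (hit_prob u \<omega>) C) =
      (\<Prod>i\<in>{1..n}. ennreal (if i \<in> C then hit_prob u \<omega> i else 1 - hit_prob u \<omega> i))"
    using hit_prob_range assms by (subst prod_ennreal) auto
  also have "\<dots> = (\<Prod>i\<in>{1..n}. poisson_measure (pop i \<omega> * u) (if i \<in> C then {0<..} else {0}))"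
  proof (intro prod.cong refl)
    fix i assume "i \<in> {1..n}"
    then have "0 \<le> pop i \<omega> * u" using pop_nonneg assms by auto
    then show "ennreal (if i \<in> C then hit_prob u \<omega> i else 1 - hit_prob u \<omega> i) =
        poisson_measure (pop i \<omega> * u) (if i \<in> C then {0<..} else {0})"
      by (simp add: poisson_measure_0 poisson_measure_pos hit_prob_def)
  qed
  finally show ?thesis .
qed

lemma integrable_subset_prob:
  assumes "C \<subseteq> {1..n}" "0 \<le> u"
  shows "integrable M (\<lambda>\<omega>. subset_prob {1..n} (hit_prob u \<omega>) C)"
proof (rule integrable_const_bound[where B = 1])
  show "AE \<omega> in M. norm (subset_prob {1..n} (hit_prob u \<omega>) C) \<le> 1"
  proof (rule AE_I2)
    fix \<omega> assume \<omega>: "\<omega> \<in> space M"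
    have "subset_prob {1..n} (hit_prob u \<omega>) C \<le> subset_mean {1..n} (hit_prob u \<omega>) (\<lambda>_. 1)"
      unfolding subset_mean_def
      using assms hit_prob_range[OF assms(2) _ \<omega>] subset_prob_nonneg[of _ "{1..n}" "hit_prob u \<omega>"]
      by (simp only: mult_1_right) (intro member_le_sum, auto)
    moreover have "0 \<le> subset_prob {1..n} (hit_prob u \<omega>) C"
      using assms hit_prob_range[OF assms(2) _ \<omega>] by (intro subset_prob_nonneg) auto
    ultimately show "norm (subset_prob {1..n} (hit_prob u \<omega>) C) \<le> 1"
      by (simp add: subset_mean_const)
  qed
qed (rule subset_prob_measurable[OF assms(1)])

lemma requested_in_law:
  assumes "0 \<le> a" "a \<le> b" "C \<subseteq> {1..n}"
  shows "prob {\<omega>\<in>space M. requested_in n (cfg \<omega>) a b = C} =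
     expectation (\<lambda>\<omega>. subset_prob {1..n} (hit_prob (b - a) \<omega>) C)"
proof -
  define t where "t j = (if j = (0::nat) then a else b)" for j
  have t: "0 \<le> t 0" "mono t" using assms by (auto simp: t_def mono_def)
  let ?K = "\<lambda>p::nat\<times>nat. if fst p \<in> C then {0<..} else {0::nat}"
  have "{\<omega>\<in>space M. requested_in n (cfg \<omega>) a b = C} =
     {\<omega>\<in>space M. \<forall>i\<in>{1..n}. \<forall>j<Suc 0. card (T i \<omega> \<inter> {t j..<t (Suc j)}) \<in> ?K (i, j)}"
  proof (intro Collect_cong conj_cong refl)
    fix \<omega> assume \<omega>: "\<omega> \<in> space M"
    have "requested_in n (cfg \<omega>) a b = C \<longleftrightarrow> (\<forall>i\<in>{1..n}. i \<in> C \<longleftrightarrow> T i \<omega> \<inter> {a..<b} \<noteq> {})"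
      unfolding requested_in_def using assms(3) by blast
    also have "\<dots> \<longleftrightarrow> (\<forall>i\<in>{1..n}. \<forall>j<Suc 0. card (T i \<omega> \<inter> {t j..<t (Suc j)}) \<in> ?K (i, j))"
      by (intro ball_cong refl) (use card_interval_pos_iff[OF _ \<omega>, of _ a b] in \<open>auto simp: t_def\<close>)
    finally show "requested_in n (cfg \<omega>) a b = C \<longleftrightarrow>
        (\<forall>i\<in>{1..n}. \<forall>j<Suc 0. card (T i \<omega> \<inter> {t j..<t (Suc j)}) \<in> ?K (i, j))" .
  qed
  then have "emeasure M {\<omega>\<in>space M. requested_in n (cfg \<omega>) a b = C} =
     (\<integral>\<^sup>+\<omega>. (\<Prod>i\<in>{1..n}. poisson_measure (pop i \<omega> * (b - a)) (if i \<in> C then {0<..} else {0})) \<partial>M)"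
    using count_law[OF t, of "Suc 0" ?K] unfolding prod_lessThan_1_pairs by (simp add: t_def)
  also have "\<dots> = (\<integral>\<^sup>+\<omega>. ennreal (subset_prob {1..n} (hit_prob (b - a) \<omega>) C) \<partial>M)"
    using assms by (intro nn_integral_cong subset_prob_eq_prod[symmetric]) auto
  also have "\<dots> = ennreal (expectation (\<lambda>\<omega>. subset_prob {1..n} (hit_prob (b - a) \<omega>) C))"
    using assms hit_prob_range
    by (intro nn_integral_eq_integral integrable_subset_prob AE_I2 subset_prob_nonneg) auto
  finally have e: "ennreal (prob {\<omega>\<in>space M. requested_in n (cfg \<omega>) a b = C}) =
      ennreal (expectation (\<lambda>\<omega>. subset_prob {1..n} (hit_prob (b - a) \<omega>) C))"
    by (simp only: emeasure_eq_measure)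
  have "0 \<le> expectation (\<lambda>\<omega>. subset_prob {1..n} (hit_prob (b - a) \<omega>) C)"
    using assms hit_prob_range by (intro integral_nonneg_AE AE_I2 subset_prob_nonneg) auto
  then show ?thesis using e by (simp only: ennreal_inj measure_nonneg)
qed

text \<open>If the time interval is divided into \<open>m\<close> cells, two simultaneous requests fall into the same cell.
  As rates are at most 1, this has probability at most \<open>m (u / m)\<^sup>2\<close>, for every \<open>m\<close>.\<close>

lemma no_ties:
  assumes "i \<in> {1..n}" "j \<in> {1..n}" "i \<noteq> j" "0 \<le> u"
  shows "AE \<omega> in M. T i \<omega> \<inter> T j \<omega> \<inter> {0..<u} = {}"
proof -
  define F where "F m k = {\<omega>\<in>space M. T i \<omega> \<inter> {u * real k / real m..<u * real (Suc k) / real m} \<noteq> {} \<and>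
     T j \<omega> \<inter> {u * real k / real m..<u * real (Suc k) / real m} \<noteq> {}}" for m k
  have Fm: "F m k \<in> sets M" for m k
    using pred_intros_logic(3)[OF hit_measurable[OF assms(1)] hit_measurable[OF assms(2)]]
    unfolding F_def pred_def .
  have F_le: "prob (F m k) \<le> (u / real m)\<^sup>2" if m: "m > 0" for m k
  proof -
    define t where "t l = u * real (k + l) / real m" for l
    have t: "0 \<le> t 0" "mono t" using assms(4) by (auto simp: t_def mono_def intro!: divide_right_mono mult_left_mono)
    let ?K = "\<lambda>p::nat\<times>nat. if fst p \<in> {i, j} then {0<..} else UNIV :: nat set"
    have dt: "t (Suc 0) - t 0 = u / real m" by (simp add: t_def add_divide_distrib distrib_left)
    have Feq: "F m k = {\<omega>\<in>space M. \<forall>i\<in>{1..n}. \<forall>j<Suc 0. card (T i \<omega> \<inter> {t j..<t (Suc j)}) \<in> ?K (i, j)}"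
      unfolding F_def using assms(1,2)
      by (intro Collect_cong conj_cong refl)
         (auto simp: t_def card_interval_pos_iff simp del: atLeastAtMost_iff)
    have "emeasure M (F m k) = (\<integral>\<^sup>+\<omega>. (\<Prod>l\<in>{1..n}. poisson_measure (pop l \<omega> * (u / real m)) (?K (l, 0))) \<partial>M)"
      unfolding Feq count_law[OF t, of "Suc 0" ?K] prod_lessThan_1_pairs by (simp add: dt)
    also have "\<dots> \<le> (\<integral>\<^sup>+\<omega>. ennreal ((u / real m)\<^sup>2) \<partial>M)"
    proof (rule nn_integral_mono)
      fix \<omega> assume \<omega>: "\<omega> \<in> space M"
      have l0: "0 \<le> pop l \<omega> * (u / real m)" if "l \<in> {1..n}" for l
        using pop_nonneg[OF that \<omega>] assms(4) by simp
      have le: "poisson_measure (pop l \<omega> * (u / real m)) {0<..} \<le> ennreal (u / real m)" if "l \<in> {1..n}" for l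
      proof -
        have "1 - exp (- (pop l \<omega> * (u / real m))) \<le> pop l \<omega> * (u / real m)"
          using exp_ge_add_one_self[of "- (pop l \<omega> * (u / real m))"] by linarith
        also have "\<dots> \<le> u / real m" using pop_le_1[OF that \<omega>] assms(4) by (intro mult_left_le_one_le) (use pop_nonneg[OF that \<omega>] in auto)
        finally show ?thesis using poisson_measure_pos[OF l0[OF that]] by (simp add: ennreal_leI)
      qed
      have "(\<Prod>l\<in>{1..n}. poisson_measure (pop l \<omega> * (u / real m)) (?K (l, 0))) =
         (\<Prod>l\<in>{1..n}. if l \<in> {i, j} then poisson_measure (pop l \<omega> * (u / real m)) {0<..} else 1)"
        by (intro prod.cong refl) (use poisson_measure_UNIV[OF l0] in auto)
      also have "\<dots> = (\<Prod>l\<in>{i, j}. poisson_measure (pop l \<omega> * (u / real m)) {0<..})"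
        by (subst prod_if_subset) (use assms(1,2) in auto)
      also have "\<dots> \<le> ennreal (u / real m) * ennreal (u / real m)"
        using assms(3) le[OF assms(1)] le[OF assms(2)] by (simp add: mult_mono)
      also have "\<dots> = ennreal ((u / real m)\<^sup>2)"
        unfolding power2_eq_square using assms(4) by (intro ennreal_mult[symmetric]) auto
      finally show "(\<Prod>l\<in>{1..n}. poisson_measure (pop l \<omega> * (u / real m)) (?K (l, 0))) \<le> ennreal ((u / real m)\<^sup>2)" .
    qed
    finally have "ennreal (prob (F m k)) \<le> ennreal ((u / real m)\<^sup>2)"
      by (simp only: nn_integral_const emeasure_space_1 mult_1_right emeasure_eq_measure)
        (simp add: prob_space)
    then show ?thesis by (simp add: ennreal_le_iff)
  qed
  have cover: "{\<omega>\<in>space M. T i \<omega> \<inter> T j \<omega> \<inter> {0..<u} \<noteq> {}} \<subseteq> (\<Union>k<m. F m k)" if m: "m > 0" for m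
  proof
    fix \<omega> assume "\<omega> \<in> {\<omega>\<in>space M. T i \<omega> \<inter> T j \<omega> \<inter> {0..<u} \<noteq> {}}"
    then obtain s where \<omega>: "\<omega> \<in> space M" and s: "s \<in> T i \<omega>" "s \<in> T j \<omega>" "0 \<le> s" "s < u" by auto
    (* the cell that contains s *)
    define k where "k = nat \<lfloor>s * real m / u\<rfloor>"
    have u: "0 < u" using s by simp
    have pos: "0 \<le> s * real m / u" using s u by simp
    then have k: "real k \<le> s * real m / u" "s * real m / u < real (Suc k)"
      unfolding k_def by linarith+
    have "s * real m / u < real m" using s u m by (simp add: field_simps)
    then have "k < m" using k(1) by linarith
    moreover have "u * real k / real m \<le> s" "s < u * real (Suc k) / real m"
      using k u m by (simp_all add: field_simps)
    then have "s \<in> {u * real k / real m..<u * real (Suc k) / real m}" by simp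
    then have "\<omega> \<in> F m k" using s \<omega> unfolding F_def by blast
    ultimately show "\<omega> \<in> (\<Union>k<m. F m k)" by blast
  qed
  define N where "N = (\<Inter>m. \<Union>k<Suc m. F (Suc m) k)"
  have Nm: "N \<in> sets M" unfolding N_def using Fm by auto
  have "prob N \<le> u\<^sup>2 / real (Suc m)" for m
  proof -
    have "prob N \<le> prob (\<Union>k<Suc m. F (Suc m) k)"
      using Fm by (intro finite_measure_mono) (auto simp: N_def)
    also have "\<dots> \<le> (\<Sum>k<Suc m. prob (F (Suc m) k))"
      using Fm by (intro finite_measure_subadditive_finite) auto
    also have "\<dots> \<le> (\<Sum>k<Suc m. (u / real (Suc m))\<^sup>2)" by (intro sum_mono F_le) simp
    also have "\<dots> = u\<^sup>2 / real (Suc m)" by (simp add: power2_eq_square del: of_nat_Suc)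
    finally show ?thesis .
  qed
  moreover have "(\<lambda>m. u\<^sup>2 / real (Suc m)) \<longlonglongrightarrow> 0"
    using LIMSEQ_Suc[OF lim_const_over_n[of "u\<^sup>2"]] by simp
  ultimately have "prob N \<le> 0" by (intro LIMSEQ_le_const) auto
  then have "prob N = 0" using measure_nonneg[of M N] by linarith
  then have "N \<in> null_sets M" using Nm by (simp add: null_sets_def emeasure_eq_measure)
  moreover have "{\<omega>\<in>space M. \<not> (T i \<omega> \<inter> T j \<omega> \<inter> {0..<u} = {})} \<subseteq> N"
    unfolding N_def by (rule INT_greatest) (rule cover, simp)
  ultimately show ?thesis by (rule AE_I')
qed

lemma no_ties_all:
  assumes "0 \<le> u"
  shows "AE \<omega> in M. \<forall>i\<in>{1..n}. \<forall>j\<in>{1..n}. i \<noteq> j \<longrightarrow> T i \<omega> \<inter> T j \<omega> \<inter> {0..<u} = {}"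
proof -
  have "AE \<omega> in M. \<forall>i\<in>{1..n}. \<forall>j\<in>{1..n} - {i}. T i \<omega> \<inter> T j \<omega> \<inter> {0..<u} = {}"
  proof (intro AE_finite_allI finite_atLeastAtMost finite_Diff)
    fix i j assume "i \<in> {1..n}" "j \<in> {1..n} - {i}"
    then show "AE \<omega> in M. T i \<omega> \<inter> T j \<omega> \<inter> {0..<u} = {}" by (intro no_ties assms) blast+
  qed
  then show ?thesis by eventually_elim blast
qed

lemma requested_in_next_measurable:
  "{\<omega>\<in>space M. requested_in n (cfg \<omega>) a b = C \<and> next_label n (cfg \<omega>) b = x} \<in> sets M"
proof -
  have "Measurable.pred M (\<lambda>\<omega>. next_label n (cfg \<omega>) b = x)"
    by (rule measurable_compose[OF next_label_measurable]) simp
  then have "Measurable.pred M (\<lambda>\<omega>. requested_in n (cfg \<omega>) a b = C \<and> next_label n (cfg \<omega>) b = x)"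
    by (intro pred_intros_logic(3) requested_in_measurable)
  then show ?thesis unfolding pred_def .
qed

lemma integrable_subset_prob_pop:
  assumes "C \<subseteq> {1..n}" "0 \<le> u" "i \<in> {1..n}"
  shows "integrable M (\<lambda>\<omega>. subset_prob {1..n} (hit_prob u \<omega>) C * pop i \<omega>)"
proof (rule Bochner_Integration.integrable_bound[OF integrable_subset_prob[OF assms(1,2)]])
  show "AE \<omega> in M. norm (subset_prob {1..n} (hit_prob u \<omega>) C * pop i \<omega>) \<le> norm (subset_prob {1..n} (hit_prob u \<omega>) C)"
    using pop_nonneg[OF assms(3)] pop_le_1[OF assms(3)]
    by (intro AE_I2) (auto simp: abs_mult intro!: mult_left_le)
qed (intro borel_measurable_times subset_prob_measurable pop_measurable assms)

text \<open>The waiting time for the next request, rounded down to the multiple \<open>k\<close> of a cell length \<open>d\<close>: the assumption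
  on the processes speaks of counts in intervals only.\<close>

definition next_in_cell :: "real \<Rightarrow> real \<Rightarrow> nat \<Rightarrow> nat \<Rightarrow> 'a \<Rightarrow> bool" where
  "next_in_cell b d i k \<omega> \<longleftrightarrow> (\<forall>j\<in>{1..n}. T j \<omega> \<inter> {b..<b + real k * d} = {} \<and>
     (j = i \<longleftrightarrow> T j \<omega> \<inter> {b + real k * d..<b + (real k + 1) * d} \<noteq> {}))"

text \<open>Given the weights, the three intervals involved are independent. As the total rate is at most 1, the quiet
  period contributes at least \<open>exp (- k d)\<close>, and the last cell at least
  \<open>(1 - exp (- p d)) exp (- (1 - p) d) \<ge> p d exp (- d)\<close> with \<open>p\<close> the popularity of \<open>i\<close>.\<close>

lemma requested_in_next_cell:
  assumes "0 \<le> a" "a \<le> b" "C \<subseteq> {1..n}" "i \<in> {1..n}" "0 < d"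
  shows "d * exp (- d) * exp (- d) ^ k * expectation (\<lambda>\<omega>. subset_prob {1..n} (hit_prob (b - a) \<omega>) C * pop i \<omega>) \<le>
    prob {\<omega>\<in>space M. requested_in n (cfg \<omega>) a b = C \<and> next_in_cell b d i k \<omega>}" (is "_ \<le> prob ?E")
proof -
  define t where "t l = (if l = 0 then a else if l = 1 then b else if l = 2 then b + real k * d else b + (real k + 1) * d)"
    for l :: nat
  have t: "0 \<le> t 0" "mono t" using assms by (auto simp: t_def mono_iff_le_Suc algebra_simps)
  let ?K = "\<lambda>p::nat\<times>nat. if snd p = 0 then (if fst p \<in> C then {0<..} else {0})
     else if snd p = 1 then {0} else if fst p = i then {0<..} else {0 :: nat}"
  have lt3: "(\<forall>j<3. Q j) \<longleftrightarrow> Q 0 \<and> Q 1 \<and> Q 2" for Q :: "nat \<Rightarrow> bool"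
    by (auto simp: less_Suc_eq numeral_3_eq_3 numeral_2_eq_2)
  have t3: "t 0 = a" "t (Suc 0) = b" "t 1 = b" "t (Suc 1) = b + real k * d" "t 2 = b + real k * d"
      "t (Suc 2) = b + (real k + 1) * d"
    by (simp_all add: t_def)
  have Eeq: "?E = {\<omega>\<in>space M. \<forall>i\<in>{1..n}. \<forall>j<3. card (T i \<omega> \<inter> {t j..<t (Suc j)}) \<in> ?K (i, j)}"
  proof (intro Collect_cong conj_cong refl)
    fix \<omega> assume \<omega>: "\<omega> \<in> space M"
    have R: "requested_in n (cfg \<omega>) a b = C \<longleftrightarrow> (\<forall>i\<in>{1..n}. i \<in> C \<longleftrightarrow> T i \<omega> \<inter> {a..<b} \<noteq> {})"
      unfolding requested_in_def using assms(3) by blast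
    show "(requested_in n (cfg \<omega>) a b = C \<and> next_in_cell b d i k \<omega>) \<longleftrightarrow>
        (\<forall>i\<in>{1..n}. \<forall>j<3. card (T i \<omega> \<inter> {t j..<t (Suc j)}) \<in> ?K (i, j))"
      unfolding R next_in_cell_def lt3 t3 ball_conj_distrib[symmetric]
    proof (intro ball_cong refl)
      fix j assume j: "j \<in> {1..n}"
      show "((j \<in> C) = (T j \<omega> \<inter> {a..<b} \<noteq> {}) \<and> T j \<omega> \<inter> {b..<b + real k * d} = {} \<and>
          (j = i) = (T j \<omega> \<inter> {b + real k * d..<b + (real k + 1) * d} \<noteq> {})) \<longleftrightarrow>
         card (T j \<omega> \<inter> {a..<b}) \<in> ?K (j, 0) \<and> card (T j \<omega> \<inter> {b..<b + real k * d}) \<in> ?K (j, 1) \<and>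
         card (T j \<omega> \<inter> {b + real k * d..<b + (real k + 1) * d}) \<in> ?K (j, 2)"
        by (cases "j \<in> C"; cases "j = i")
           (simp_all add: card_interval_pos_iff[OF j \<omega>] card_interval_pos_iff[OF assms(4) \<omega>])
    qed
  qed
  have "ennreal (prob ?E) = (\<integral>\<^sup>+\<omega>. (\<Prod>p\<in>{1..n} \<times> {..<3}.
        poisson_measure (pop (fst p) \<omega> * (t (Suc (snd p)) - t (snd p))) (?K p)) \<partial>M)"
    unfolding Eeq emeasure_eq_measure[symmetric] by (rule count_law[OF t])
  also have "\<dots> \<ge> (\<integral>\<^sup>+\<omega>. ennreal (d * exp (- d) * exp (- d) ^ k * (subset_prob {1..n} (hit_prob (b - a) \<omega>) C * pop i \<omega>)) \<partial>M)"
  proof (rule nn_integral_mono)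
    fix \<omega> assume \<omega>: "\<omega> \<in> space M"
    have p0: "0 \<le> pop l \<omega>" if "l \<in> {1..n}" for l using pop_nonneg[OF that \<omega>] .
    have s1: "(\<Sum>l\<in>{1..n}. pop l \<omega>) \<le> 1" by (simp only: sum_pop) simp
    have kd: "0 \<le> real k * d" using assms(5) by simp
    have S0: "0 \<le> subset_prob {1..n} (hit_prob (b - a) \<omega>) C"
      using assms hit_prob_range[OF _ _ \<omega>] by (intro subset_prob_nonneg) auto
    have B0: "0 \<le> 1 - exp (- (pop i \<omega> * d))" using p0[OF assms(4)] assms(5) by simp
    have cell: "(real k + 1) * d - real k * d = d" by (simp add: algebra_simps)
    have "(\<Prod>p\<in>{1..n} \<times> {..<3}. poisson_measure (pop (fst p) \<omega> * (t (Suc (snd p)) - t (snd p))) (?K p)) =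
       (\<Prod>l\<in>{1..n}. \<Prod>j<3. poisson_measure (pop l \<omega> * (t (Suc j) - t j)) (?K (l, j)))"
      by (simp only: prod.cartesian_product) (rule prod.cong, auto)
    also have "\<dots> = (\<Prod>l\<in>{1..n}. poisson_measure (pop l \<omega> * (b - a)) (if l \<in> C then {0<..} else {0}) *
        (ennreal (exp (- (pop l \<omega> * (real k * d)))) *
         ennreal (if l = i then 1 - exp (- (pop l \<omega> * d)) else exp (- (pop l \<omega> * d)))))"
      using p0 assms(5) by (intro prod.cong refl)
       (simp add: t_def numeral_3_eq_3 poisson_measure_0 poisson_measure_pos mult.assoc cell)
    also have "\<dots> = ennreal (subset_prob {1..n} (hit_prob (b - a) \<omega>) C) *
        ((\<Prod>l\<in>{1..n}. ennreal (exp (- (pop l \<omega> * (real k * d))))) *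
         (\<Prod>l\<in>{1..n}. ennreal (if l = i then 1 - exp (- (pop l \<omega> * d)) else exp (- (pop l \<omega> * d)))))"
      using assms(2) by (subst subset_prob_eq_prod[OF assms(3) _ \<omega>]) (simp_all only: prod.distrib diff_ge_0_iff_ge)
    also have "(\<Prod>l\<in>{1..n}. ennreal (exp (- (pop l \<omega> * (real k * d))))) = ennreal (exp (- (real k * d * (\<Sum>l\<in>{1..n}. pop l \<omega>))))"
      by (subst prod_ennreal) (auto simp: sum_distrib_left sum_negf mult_ac simp flip: exp_sum)
    also have "(\<Prod>l\<in>{1..n}. ennreal (if l = i then 1 - exp (- (pop l \<omega> * d)) else exp (- (pop l \<omega> * d)))) =
       ennreal ((1 - exp (- (pop i \<omega> * d))) * exp (- (d * (\<Sum>l\<in>{1..n} - {i}. pop l \<omega>))))"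
    proof -
      have "(\<Prod>l\<in>{1..n}. ennreal (if l = i then 1 - exp (- (pop l \<omega> * d)) else exp (- (pop l \<omega> * d)))) =
        ennreal (\<Prod>l\<in>{1..n}. if l \<in> {i} then 1 - exp (- (pop l \<omega> * d)) else exp (- (pop l \<omega> * d)))"
        using p0 assms(5) by (subst prod_ennreal) auto
      also have "(\<Prod>l\<in>{1..n}. if l \<in> {i} then 1 - exp (- (pop l \<omega> * d)) else exp (- (pop l \<omega> * d))) =
         (1 - exp (- (pop i \<omega> * d))) * exp (- (d * (\<Sum>l\<in>{1..n} - {i}. pop l \<omega>)))"
        using assms(4) by (subst prod_if_subset)
          (auto simp: sum_distrib_left sum_negf mult_ac simp flip: exp_sum)
      finally show ?thesis .
    qed
    finally have eq: "(\<Prod>p\<in>{1..n} \<times> {..<3}. poisson_measure (pop (fst p) \<omega> * (t (Suc (snd p)) - t (snd p))) (?K p)) =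
      ennreal (subset_prob {1..n} (hit_prob (b - a) \<omega>) C *
        (exp (- (real k * d * (\<Sum>l\<in>{1..n}. pop l \<omega>))) *
         ((1 - exp (- (pop i \<omega> * d))) * exp (- (d * (\<Sum>l\<in>{1..n} - {i}. pop l \<omega>))))))"
      by (simp only: ennreal_mult'[OF S0] ennreal_mult'[OF B0] ennreal_mult'[OF exp_ge_zero])
    have 1: "exp (- d) ^ k \<le> exp (- (real k * d * (\<Sum>l\<in>{1..n}. pop l \<omega>)))"
    proof -
      have "exp (- d) ^ k = exp (- (real k * d))" by (simp flip: exp_of_nat_mult)
      also have "\<dots> \<le> exp (- (real k * d * (\<Sum>l\<in>{1..n}. pop l \<omega>)))"
        using mult_left_le[OF s1 kd] by simp
      finally show ?thesis .
    qed
    have 2: "d * exp (- d) * pop i \<omega> \<le> (1 - exp (- (pop i \<omega> * d))) * exp (- (d * (\<Sum>l\<in>{1..n} - {i}. pop l \<omega>)))"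
    proof -
      let ?q = "pop i \<omega> * d" and ?r = "\<Sum>l\<in>{1..n} - {i}. pop l \<omega>"
      have q: "0 \<le> ?q" using p0[OF assms(4)] assms(5) by simp
      have sp: "pop i \<omega> + ?r \<le> 1" using s1 assms(4) by (subst (asm) sum.remove[of _ i]) auto
      have "?q * exp (- ?q) \<le> 1 - exp (- ?q)"
      proof -
        have "(1 + ?q) * exp (- ?q) \<le> exp ?q * exp (- ?q)"
          by (intro mult_right_mono) auto
        then show ?thesis by (simp add: distrib_right flip: exp_add)
      qed
      then have "?q * exp (- ?q) * exp (- (d * ?r)) \<le> (1 - exp (- ?q)) * exp (- (d * ?r))"
        by (intro mult_right_mono) auto
      moreover have "?q * exp (- ?q) * exp (- (d * ?r)) = ?q * exp (- (d * (pop i \<omega> + ?r)))"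
        by (simp add: mult.assoc algebra_simps flip: exp_add)
      moreover have "?q * exp (- d) \<le> ?q * exp (- (d * (pop i \<omega> + ?r)))"
        using q mult_left_le[OF sp, of d] assms(5) by (intro mult_left_mono) auto
      moreover have "d * exp (- d) * pop i \<omega> = ?q * exp (- d)" by simp
      ultimately show ?thesis by linarith
    qed
    have "exp (- d) ^ k * (d * exp (- d) * pop i \<omega>) \<le> exp (- (real k * d * (\<Sum>l\<in>{1..n}. pop l \<omega>))) *
         ((1 - exp (- (pop i \<omega> * d))) * exp (- (d * (\<Sum>l\<in>{1..n} - {i}. pop l \<omega>))))"
      by (rule mult_mono[OF 1 2]) (use p0[OF assms(4)] assms(5) in auto)
    then have "subset_prob {1..n} (hit_prob (b - a) \<omega>) C * (exp (- d) ^ k * (d * exp (- d) * pop i \<omega>)) \<le>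
       subset_prob {1..n} (hit_prob (b - a) \<omega>) C * (exp (- (real k * d * (\<Sum>l\<in>{1..n}. pop l \<omega>))) *
         ((1 - exp (- (pop i \<omega> * d))) * exp (- (d * (\<Sum>l\<in>{1..n} - {i}. pop l \<omega>)))))"
      using assms hit_prob_range[OF _ _ \<omega>] by (intro mult_left_mono subset_prob_nonneg) auto
    then show "ennreal (d * exp (- d) * exp (- d) ^ k * (subset_prob {1..n} (hit_prob (b - a) \<omega>) C * pop i \<omega>)) \<le>
      (\<Prod>p\<in>{1..n} \<times> {..<3}. poisson_measure (pop (fst p) \<omega> * (t (Suc (snd p)) - t (snd p))) (?K p))"
      unfolding eq by (intro ennreal_leI) (simp add: mult_ac)
  qed
  also have "(\<integral>\<^sup>+\<omega>. ennreal (d * exp (- d) * exp (- d) ^ k * (subset_prob {1..n} (hit_prob (b - a) \<omega>) C * pop i \<omega>)) \<partial>M) =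
     ennreal (d * exp (- d) * exp (- d) ^ k * expectation (\<lambda>\<omega>. subset_prob {1..n} (hit_prob (b - a) \<omega>) C * pop i \<omega>))"
  proof (subst nn_integral_eq_integral)
    show "integrable M (\<lambda>\<omega>. d * exp (- d) * exp (- d) ^ k * (subset_prob {1..n} (hit_prob (b - a) \<omega>) C * pop i \<omega>))"
      using assms by (intro integrable_mult_right integrable_subset_prob_pop) auto
    show "AE \<omega> in M. 0 \<le> d * exp (- d) * exp (- d) ^ k * (subset_prob {1..n} (hit_prob (b - a) \<omega>) C * pop i \<omega>)"
      using assms hit_prob_range pop_nonneg
      by (intro AE_I2 mult_nonneg_nonneg subset_prob_nonneg) auto
  qed simp
  finally show ?thesis by (simp add: ennreal_le_iff)
qed

text \<open>As the cells get finer, the sum of the previous bounds tends to the left side. One inequality is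
  enough, because the left sides add up to the probability that some weight is nonzero, which tends
  to 1 for the sequences of chains considered later.\<close>

lemma requested_in_next_ge:
  assumes "0 \<le> a" "a \<le> b" "C \<subseteq> {1..n}" "i \<in> {1..n}"
  shows "expectation (\<lambda>\<omega>. subset_prob {1..n} (hit_prob (b - a) \<omega>) C * pop i \<omega>) \<le>
    prob {\<omega>\<in>space M. requested_in n (cfg \<omega>) a b = C \<and> next_label n (cfg \<omega>) b = Some i}"
    (is "?I \<le> prob ?E")
proof (rule LIMSEQ_le_const2)
  have I0: "0 \<le> ?I"
    using assms hit_prob_range pop_nonneg
    by (intro integral_nonneg_AE AE_I2 mult_nonneg_nonneg subset_prob_nonneg) auto
  have "(\<lambda>m. exp (- (1 / real (Suc m))) * (1 - exp (- real (Suc m)))) \<longlonglongrightarrow> 1" by real_asymp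
  then show "(\<lambda>m. exp (- (1 / real (Suc m))) * (1 - exp (- real (Suc m))) * ?I) \<longlonglongrightarrow> ?I"
    using tendsto_mult_right[of _ 1 sequentially ?I] by simp
  show "\<exists>N. \<forall>m\<ge>N. exp (- (1 / real (Suc m))) * (1 - exp (- real (Suc m))) * ?I \<le> prob ?E"
  proof (intro exI[of _ 0] allI impI)
    fix m :: nat
    define d where "d = 1 / real (Suc m)"
    (* the cells cover a time of length Suc m, so the first request is missed with probability tending to 0 *)
    define N where "N = Suc m * Suc m"
    have d: "0 < d" by (simp add: d_def)
    have Nd: "real N * d = real (Suc m)" unfolding N_def d_def of_nat_mult by (simp del: of_nat_Suc)
    define E where "E k = {\<omega>\<in>space M. requested_in n (cfg \<omega>) a b = C \<and> next_in_cell b d i k \<omega>}" for k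
    have Em: "E k \<in> sets M" for k
    proof -
      have free: "Measurable.pred M (\<lambda>\<omega>. T j \<omega> \<inter> {x..<y} = {})" if "j \<in> {1..n}" for j x y
        using pred_intros_logic(2)[OF hit_measurable[OF that]] by simp
      have "Measurable.pred M (\<lambda>\<omega>. requested_in n (cfg \<omega>) a b = C \<and> next_in_cell b d i k \<omega>)"
        unfolding next_in_cell_def
        by (intro pred_intros_logic(3,6) pred_intros_finite(3) free hit_measurable requested_in_measurable) auto
      then show ?thesis unfolding pred_def E_def .
    qed
    have disj: "disjoint_family_on E {..<N}"
    proof -
      have "E k \<inter> E l = {}" if "k < l" for k l
      proof -
        have "(real k + 1) * d \<le> real l * d" using that d by (intro mult_right_mono) auto
        moreover have "0 \<le> real k * d" using d by simp
        ultimately have "{b + real k * d..<b + (real k + 1) * d} \<subseteq> {b..<b + real l * d}" by auto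
        then show ?thesis unfolding E_def next_in_cell_def using assms(4) by blast
      qed
      then show ?thesis unfolding disjoint_family_on_def by (metis Int_commute linorder_neqE_nat)
    qed
    have sub: "E k \<subseteq> ?E" for k
    proof
      fix \<omega> assume "\<omega> \<in> E k"
      then have \<omega>: "\<omega> \<in> space M" "requested_in n (cfg \<omega>) a b = C" and e: "next_in_cell b d i k \<omega>"
        unfolding E_def by blast+
      have "next_label n (cfg \<omega>) b = Some i"
        by (rule request_configuration.next_label_eqI[OF configuration[OF \<omega>(1)], where a = "b + real k * d" and b = "b + (real k + 1) * d"])
           (use assms(4) d e in \<open>auto simp: next_in_cell_def\<close>)
      then show "\<omega> \<in> ?E" using \<omega> by simp
    qed
    have q: "exp (- d) < 1" using d by simp
    have "exp (- d) * (1 - exp (- real (Suc m))) \<le> d * exp (- d) * (\<Sum>k<N. exp (- d) ^ k)"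
    proof -
      have "(1 - exp (- d)) * (\<Sum>k<N. exp (- d) ^ k) = 1 - exp (- d) ^ N"
        by (simp add: one_diff_power_eq)
      also have "exp (- d) ^ N = exp (- real (Suc m))"
        using Nd by (simp flip: exp_of_nat_mult)
      finally have "1 - exp (- real (Suc m)) = (1 - exp (- d)) * (\<Sum>k<N. exp (- d) ^ k)" by simp
      also have "\<dots> \<le> d * (\<Sum>k<N. exp (- d) ^ k)"
        using exp_ge_add_one_self[of "- d"] by (intro mult_right_mono sum_nonneg) auto
      finally show ?thesis by (simp add: mult_ac)
    qed
    then have "exp (- d) * (1 - exp (- real (Suc m))) * ?I \<le> d * exp (- d) * (\<Sum>k<N. exp (- d) ^ k) * ?I"
      using I0 by (intro mult_right_mono) auto
    also have "\<dots> = (\<Sum>k<N. d * exp (- d) * exp (- d) ^ k * ?I)"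
      by (simp add: sum_distrib_left sum_distrib_right mult_ac)
    also have "\<dots> \<le> (\<Sum>k<N. prob (E k))"
      unfolding E_def by (intro sum_mono requested_in_next_cell assms d)
    also have "\<dots> = prob (\<Union>k<N. E k)"
      using Em disj by (intro finite_measure_finite_Union[symmetric]) auto
    also have "\<dots> \<le> prob ?E"
      using sub requested_in_next_measurable by (intro finite_measure_mono) auto
    finally show "exp (- (1 / real (Suc m))) * (1 - exp (- real (Suc m))) * ?I \<le> prob ?E"
      by (simp add: d_def)
  qed
qed

end

context move_to_front_chain begin

lemma requested_in_subset: "requested_in n (cfg \<omega>) a b \<subseteq> {1..n}"
  by (auto simp: requested_in_def)

lemma requested_in_sets: "{\<omega>\<in>space M. requested_in n (cfg \<omega>) a b = C} \<in> sets M"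
  using requested_in_measurable[of a b C] unfolding pred_def .

lemma subset_mean_measurable:
  "(\<lambda>\<omega>. subset_mean {1..n} (hit_prob u \<omega>) f) \<in> borel_measurable M"
  unfolding subset_mean_def
  by (intro borel_measurable_sum borel_measurable_times subset_prob_measurable borel_measurable_const) auto

lemma requested_in_event:
  "{\<omega>\<in>space M. \<Psi> (requested_in n (cfg \<omega>) a b)} =
    (\<Union>C\<in>{C\<in>Pow {1..n}. \<Psi> C}. {\<omega>\<in>space M. requested_in n (cfg \<omega>) a b = C})"
  using requested_in_subset by blast

lemma requested_in_event_sets: "{\<omega>\<in>space M. \<Psi> (requested_in n (cfg \<omega>) a b)} \<in> sets M"
  unfolding requested_in_event by (intro sets.finite_UN requested_in_sets) simp

lemma requested_in_event_law:
  assumes "0 \<le> a" "a \<le> b"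
  shows "prob {\<omega>\<in>space M. \<Psi> (requested_in n (cfg \<omega>) a b)} =
    expectation (\<lambda>\<omega>. subset_mean {1..n} (hit_prob (b - a) \<omega>) (\<lambda>C. of_bool (\<Psi> C)))"
proof -
  let ?S = "{C\<in>Pow {1..n}. \<Psi> C}"
  have "prob {\<omega>\<in>space M. \<Psi> (requested_in n (cfg \<omega>) a b)} =
      (\<Sum>C\<in>?S. prob {\<omega>\<in>space M. requested_in n (cfg \<omega>) a b = C})"
    unfolding requested_in_event
  proof (intro finite_measure_finite_Union image_subsetI requested_in_sets)
    show "disjoint_family_on (\<lambda>C. {\<omega>\<in>space M. requested_in n (cfg \<omega>) a b = C}) ?S"
      unfolding disjoint_family_on_def by auto
  qed simp
  also have "\<dots> = (\<Sum>C\<in>?S. expectation (\<lambda>\<omega>. subset_prob {1..n} (hit_prob (b - a) \<omega>) C))"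
    using assms by (intro sum.cong refl requested_in_law) auto
  also have "\<dots> = (\<Sum>C\<in>Pow {1..n}. expectation (\<lambda>\<omega>. subset_prob {1..n} (hit_prob (b - a) \<omega>) C * of_bool (\<Psi> C)))"
    by (intro sum.mono_neutral_cong_left) auto
  also have "\<dots> = expectation (\<lambda>\<omega>. subset_mean {1..n} (hit_prob (b - a) \<omega>) (\<lambda>C. of_bool (\<Psi> C)))"
    unfolding subset_mean_def
    by (intro Bochner_Integration.integral_sum[symmetric] integrable_mult_left integrable_subset_prob) (use assms in auto)
  finally show ?thesis .
qed

definition joint_event :: "real \<Rightarrow> real \<Rightarrow> (nat set \<Rightarrow> nat \<Rightarrow> bool) \<Rightarrow> 'a set" where
  "joint_event a b \<Phi> = {\<omega>\<in>space M. \<exists>i. next_label n (cfg \<omega>) b = Some i \<and> \<Phi> (requested_in n (cfg \<omega>) a b) i}"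

text \<open>The probability of \<open>joint_event\<close>, if the next label were drawn according to the popularities
  independently of the set of requested objects, and did not exist when all weights vanish.\<close>

definition joint_mean :: "real \<Rightarrow> (nat set \<Rightarrow> nat \<Rightarrow> bool) \<Rightarrow> real" where
  "joint_mean u \<Phi> = expectation (\<lambda>\<omega>. \<Sum>i\<in>{1..n}. pop i \<omega> * subset_mean {1..n} (hit_prob u \<omega>) (\<lambda>C. of_bool (\<Phi> C i)))"

lemma joint_event_eq:
  "joint_event a b \<Phi> = (\<Union>p\<in>{p\<in>Pow {1..n} \<times> {1..n}. \<Phi> (fst p) (snd p)}.
     {\<omega>\<in>space M. requested_in n (cfg \<omega>) a b = fst p \<and> next_label n (cfg \<omega>) b = Some (snd p)})"
proof -
  have "next_label n (cfg \<omega>) b = Some i \<Longrightarrow> i \<in> {1..n}" for \<omega> i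
    using request_label_in_range unfolding next_label_def by blast
  then show ?thesis unfolding joint_event_def using requested_in_subset[of _ a b] by fastforce
qed

lemma finite_joint_index: "finite {p\<in>Pow {1..n} \<times> {1..n}. \<Phi> (fst p) (snd p)}"
  by (rule finite_subset[of _ "Pow {1..n} \<times> {1..n}"]) auto

lemma joint_event_sets: "joint_event a b \<Phi> \<in> sets M"
  unfolding joint_event_eq
  by (intro sets.finite_UN finite_joint_index requested_in_next_measurable)

lemma joint_mean_integrable:
  assumes "0 \<le> u" "i \<in> {1..n}"
  shows "integrable M (\<lambda>\<omega>. pop i \<omega> * subset_mean {1..n} (hit_prob u \<omega>) (\<lambda>C. of_bool (\<Phi> C i)))"
  unfolding subset_mean_def sum_distrib_left
proof (intro Bochner_Integration.integrable_sum)
  fix C assume C: "C \<in> Pow {1..n}"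
  have "integrable M (\<lambda>\<omega>. subset_prob {1..n} (hit_prob u \<omega>) C * pop i \<omega> * of_bool (\<Phi> C i))"
    using assms C by (intro integrable_mult_left integrable_subset_prob_pop) auto
  then show "integrable M (\<lambda>\<omega>. pop i \<omega> * (subset_prob {1..n} (hit_prob u \<omega>) C * of_bool (\<Phi> C i)))"
    by (simp only: mult_ac)
qed

lemma joint_event_ge:
  assumes "0 \<le> a" "a \<le> b"
  shows "joint_mean (b - a) \<Phi> \<le> prob (joint_event a b \<Phi>)"
proof -
  let ?S = "{p\<in>Pow {1..n} \<times> {1..n}. \<Phi> (fst p) (snd p)}"
  let ?E = "\<lambda>p. {\<omega>\<in>space M. requested_in n (cfg \<omega>) a b = fst p \<and> next_label n (cfg \<omega>) b = Some (snd p)}"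
  let ?e = "\<lambda>C i. expectation (\<lambda>\<omega>. subset_prob {1..n} (hit_prob (b - a) \<omega>) C * pop i \<omega>)"
  have J: "joint_event a b \<Phi> = (\<Union>p\<in>?S. ?E p)" by (rule joint_event_eq)
  have "joint_mean (b - a) \<Phi> = (\<Sum>i\<in>{1..n}. expectation (\<lambda>\<omega>. pop i \<omega> * subset_mean {1..n} (hit_prob (b - a) \<omega>) (\<lambda>C. of_bool (\<Phi> C i))))"
    unfolding joint_mean_def using assms by (intro Bochner_Integration.integral_sum joint_mean_integrable) auto
  also have "\<dots> = (\<Sum>i\<in>{1..n}. \<Sum>C\<in>Pow {1..n}. of_bool (\<Phi> C i) * ?e C i)"
  proof (rule sum.cong[OF refl])
    fix i assume i: "i \<in> {1..n}"
    have "(\<lambda>\<omega>. pop i \<omega> * subset_mean {1..n} (hit_prob (b - a) \<omega>) (\<lambda>C. of_bool (\<Phi> C i))) =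
      (\<lambda>\<omega>. \<Sum>C\<in>Pow {1..n}. of_bool (\<Phi> C i) * (subset_prob {1..n} (hit_prob (b - a) \<omega>) C * pop i \<omega>))"
      unfolding subset_mean_def sum_distrib_left by (simp only: mult_ac)
    then have "expectation (\<lambda>\<omega>. pop i \<omega> * subset_mean {1..n} (hit_prob (b - a) \<omega>) (\<lambda>C. of_bool (\<Phi> C i))) =
       (\<Sum>C\<in>Pow {1..n}. expectation (\<lambda>\<omega>. of_bool (\<Phi> C i) * (subset_prob {1..n} (hit_prob (b - a) \<omega>) C * pop i \<omega>)))"
      using assms i by (simp only:) (intro Bochner_Integration.integral_sum integrable_mult_right integrable_subset_prob_pop, auto)
    then show "expectation (\<lambda>\<omega>. pop i \<omega> * subset_mean {1..n} (hit_prob (b - a) \<omega>) (\<lambda>C. of_bool (\<Phi> C i))) =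
       (\<Sum>C\<in>Pow {1..n}. of_bool (\<Phi> C i) * ?e C i)" by simp
  qed
  also have "\<dots> = (\<Sum>C\<in>Pow {1..n}. \<Sum>i\<in>{1..n}. of_bool (\<Phi> C i) * ?e C i)" by (rule sum.swap)
  also have "\<dots> = (\<Sum>(C, i)\<in>Pow {1..n} \<times> {1..n}. of_bool (\<Phi> C i) * ?e C i)" by (rule sum.cartesian_product)
  also have "\<dots> = (\<Sum>p\<in>?S. ?e (fst p) (snd p))"
    by (intro sum.mono_neutral_cong_right) auto
  also have "\<dots> \<le> (\<Sum>p\<in>?S. prob (?E p))"
  proof (rule sum_mono)
    fix p assume "p \<in> ?S"
    then show "?e (fst p) (snd p) \<le> prob (?E p)" by (intro requested_in_next_ge assms) auto
  qed
  also have "\<dots> = prob (joint_event a b \<Phi>)"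
    unfolding J
  proof (intro finite_measure_finite_Union[symmetric] finite_joint_index image_subsetI requested_in_next_measurable)
    show "disjoint_family_on ?E ?S" unfolding disjoint_family_on_def by (auto simp: prod_eq_iff)
  qed
  finally show ?thesis .
qed

lemma joint_mean_compl:
  assumes "0 \<le> u"
  shows "joint_mean u \<Phi> + joint_mean u (\<lambda>C i. \<not> \<Phi> C i) = 1 - prob {\<omega>\<in>space M. \<not> positive_weight \<omega>}"
proof -
  have "joint_mean u \<Phi> + joint_mean u (\<lambda>C i. \<not> \<Phi> C i) =
    expectation (\<lambda>\<omega>. (\<Sum>i\<in>{1..n}. pop i \<omega> * subset_mean {1..n} (hit_prob u \<omega>) (\<lambda>C. of_bool (\<Phi> C i))) +
      (\<Sum>i\<in>{1..n}. pop i \<omega> * subset_mean {1..n} (hit_prob u \<omega>) (\<lambda>C. of_bool (\<not> \<Phi> C i))))"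
    unfolding joint_mean_def
    by (intro Bochner_Integration.integral_add[symmetric] Bochner_Integration.integrable_sum joint_mean_integrable assms)
  also have "\<dots> = expectation (\<lambda>\<omega>. of_bool (positive_weight \<omega>))"
  proof (rule Bochner_Integration.integral_cong[OF refl])
    fix \<omega>
    have one: "subset_mean {1..n} (hit_prob u \<omega>) (\<lambda>C. of_bool (\<Phi> C i)) +
        subset_mean {1..n} (hit_prob u \<omega>) (\<lambda>C. of_bool (\<not> \<Phi> C i)) = 1" for i
    proof -
      have "(\<lambda>C. of_bool (\<Phi> C i) + of_bool (\<not> \<Phi> C i) :: real) = (\<lambda>_. 1)" by auto
      then show ?thesis unfolding subset_mean_add[symmetric] by (simp add: subset_mean_const)
    qed
    show "(\<Sum>i\<in>{1..n}. pop i \<omega> * subset_mean {1..n} (hit_prob u \<omega>) (\<lambda>C. of_bool (\<Phi> C i))) +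
      (\<Sum>i\<in>{1..n}. pop i \<omega> * subset_mean {1..n} (hit_prob u \<omega>) (\<lambda>C. of_bool (\<not> \<Phi> C i))) = of_bool (positive_weight \<omega>)"
      unfolding sum.distrib[symmetric] distrib_left[symmetric] one mult_1_right by (rule sum_pop)
  qed
  also have "\<dots> = prob {\<omega>\<in>space M. positive_weight \<omega>}"
  proof -
    have m: "{\<omega>\<in>space M. positive_weight \<omega>} \<in> sets M" using positive_weight_measurable unfolding pred_def .
    have "expectation (\<lambda>\<omega>. of_bool (positive_weight \<omega>)) = expectation (indicator {\<omega>\<in>space M. positive_weight \<omega>})"
      by (intro Bochner_Integration.integral_cong refl) auto
    also have "\<dots> = prob ({\<omega>\<in>space M. positive_weight \<omega>} \<inter> space M)" by (rule Bochner_Integration.integral_indicator)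
    finally show ?thesis using m by (simp only: sets.Int_space_eq2)
  qed
  also have "\<dots> = 1 - prob {\<omega>\<in>space M. \<not> positive_weight \<omega>}"
    using prob_neg[of positive_weight] positive_weight_measurable unfolding pred_def by simp
  finally show ?thesis .
qed

text \<open>Apply the lower bound to the complementary condition.\<close>

lemma joint_event_le:
  assumes "0 \<le> a" "a \<le> b"
  shows "prob (joint_event a b \<Phi>) \<le> joint_mean (b - a) \<Phi> + prob {\<omega>\<in>space M. \<not> positive_weight \<omega>}"
proof -
  have "prob (joint_event a b \<Phi>) + prob (joint_event a b (\<lambda>C i. \<not> \<Phi> C i)) =
     prob (joint_event a b \<Phi> \<union> joint_event a b (\<lambda>C i. \<not> \<Phi> C i))"
    by (intro finite_measure_Union[symmetric] joint_event_sets) (auto simp: joint_event_def)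
  then have "prob (joint_event a b \<Phi>) + prob (joint_event a b (\<lambda>C i. \<not> \<Phi> C i)) \<le> 1" by simp
  then show ?thesis
    using joint_event_ge[OF assms, of "\<lambda>C i. \<not> \<Phi> C i"] joint_mean_compl[of "b - a" \<Phi>] assms by simp
qed

text \<open>The object has moved back past the requested objects behind it; behind it remain the others with
  larger label.\<close>

lemma never_requested_position:
  assumes \<pi>: "\<And>i. i \<in> {1..n} \<Longrightarrow> \<pi> i = i" and \<omega>: "\<omega> \<in> space M" and t: "0 \<le> t"
    and noties: "\<forall>i\<in>{1..n}. \<forall>j\<in>{1..n}. i \<noteq> j \<longrightarrow> T i \<omega> \<inter> T j \<omega> \<inter> {0..<t} = {}"
    and i: "i \<in> {1..n} - requested_in n (cfg \<omega>) 0 t"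
  shows "real (position_at n \<pi> (cfg \<omega>) t i) =
    real n - real (card {j\<in>{1..n} - requested_in n (cfg \<omega>) 0 t. i < j})"
proof -
  interpret request_configuration n "cfg \<omega>" by (rule configuration[OF \<omega>])
  let ?C = "requested_in n (cfg \<omega>) 0 t"
  have C: "?C \<subseteq> {1..n}" by (rule requested_in_subset)
  have "position_at n \<pi> (cfg \<omega>) t i = \<pi> i + card {j\<in>?C. \<pi> i < \<pi> j}"
    by (rule position_at_never_requested[OF initial_permutation _ t i]) (use noties in blast)
  also have "{j\<in>?C. \<pi> i < \<pi> j} = {j\<in>?C. i < j}" using \<pi> C i by auto
  also have "\<pi> i = i" using \<pi> i by blast
  finally have p: "position_at n \<pi> (cfg \<omega>) t i = i + card {j\<in>?C. i < j}" .
  have "{j\<in>?C. i < j} \<union> {j\<in>{1..n} - ?C. i < j} = {i<..n}" using C i by auto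
  moreover have "card ({j\<in>?C. i < j} \<union> {j\<in>{1..n} - ?C. i < j}) =
      card {j\<in>?C. i < j} + card {j\<in>{1..n} - ?C. i < j}"
    using finite_subset[OF C] by (intro card_Un_disjoint) auto
  ultimately have "card {j\<in>?C. i < j} + card {j\<in>{1..n} - ?C. i < j} = n - i" by simp
  then have "i + card {j\<in>?C. i < j} + card {j\<in>{1..n} - ?C. i < j} = n" using i by auto
  then show ?thesis unfolding p by linarith
qed

end

section \<open>Laplace transform and stationary density\<close>

locale mean_law =
  fixes P :: "real measure" and \<mu> :: real
  assumes P: "P \<in> nonneg_distributions"
    and finite_mean: "integrable P (\<lambda>x. x)"
    and mean: "\<mu> = (\<integral>x. x \<partial>P)" "\<mu> \<noteq> 0"
begin

sublocale real_distribution P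
  using P by (simp add: nonneg_distributions_def)

lemma AE_nonneg: "AE x in P. 0 \<le> x"
  using P by (simp add: nonneg_distributions_def)

lemma mean_pos: "0 < \<mu>"
proof -
  have "0 \<le> \<mu>" unfolding mean by (rule integral_nonneg_AE[OF AE_nonneg])
  then show ?thesis using mean(2) by simp
qed

definition moment :: "nat \<Rightarrow> real \<Rightarrow> real" where
  "moment k t = (\<integral>x. x ^ k * exp (- t * x) \<partial>P)"

lemma power_exp_le:
  fixes x t :: real assumes "0 \<le> x" "0 < t" shows "x ^ k * exp (- t * x) \<le> fact k / t ^ k"
proof -
  have "(t * x) ^ k / fact k \<le> exp (t * x)"
  proof -
    have "(\<Sum>i\<in>{k}. (t * x) ^ i /\<^sub>R fact i) \<le> (\<Sum>i. (t * x) ^ i /\<^sub>R fact i)"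
      using assms exp_converges[of "t * x"] by (intro sum_le_suminf) (auto simp: sums_iff)
    then show ?thesis using exp_converges[of "t * x"] by (simp add: sums_iff divide_inverse mult.commute)
  qed
  then have "x ^ k * t ^ k \<le> fact k * exp (t * x)"
    by (simp add: divide_le_eq power_mult_distrib mult_ac)
  then have "x ^ k * t ^ k * exp (- t * x) \<le> fact k * (exp (t * x) * exp (- t * x))"
    using mult_right_mono[of _ _ "exp (- t * x)"] by (simp add: mult.assoc)
  also have "exp (t * x) * exp (- t * x) = 1" by (simp flip: exp_add)
  finally show ?thesis using assms by (simp add: le_divide_eq mult_ac)
qed

lemma integrable_moment:
  assumes "0 < t \<or> 0 \<le> t \<and> k \<le> 1" shows "integrable P (\<lambda>x. x ^ k * exp (- t * x))"
proof (cases "0 < t")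
  case True
  show ?thesis
  proof (rule integrable_const_bound[where B = "fact k / t ^ k"])
    show "AE x in P. norm (x ^ k * exp (- t * x)) \<le> fact k / t ^ k"
      using AE_nonneg by eventually_elim (use power_exp_le[OF _ True] in auto)
  qed simp
next
  case False
  then have "k \<le> 1" "t = 0" using assms by auto
  then have "k = 0 \<or> k = 1" by auto
  then show ?thesis using finite_mean \<open>t = 0\<close> by auto
qed

lemma exp_diff_le:
  fixes s t c x :: real assumes "c \<le> s" "c \<le> t" "0 \<le> x"
  shows "\<bar>exp (- s * x) - exp (- t * x)\<bar> \<le> \<bar>s - t\<bar> * (x * exp (- c * x))"
proof -
  have *: "\<bar>exp (- s * x) - exp (- t * x)\<bar> \<le> \<bar>s - t\<bar> * (x * exp (- c * x))"
    if st: "c \<le> s" "s \<le> t" for s t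
  proof -
    have "exp (- s * x) - exp (- t * x) = exp (- s * x) * (1 - exp (- ((t - s) * x)))"
      by (simp add: algebra_simps flip: exp_add)
    also have "\<dots> \<le> exp (- c * x) * ((t - s) * x)"
    proof (rule mult_mono)
      show "1 - exp (- ((t - s) * x)) \<le> (t - s) * x"
        using exp_ge_add_one_self[of "- ((t - s) * x)"] by linarith
    qed (use st assms(3) in \<open>auto intro: mult_right_mono\<close>)
    finally have "exp (- s * x) - exp (- t * x) \<le> (t - s) * (x * exp (- c * x))" by (simp add: algebra_simps)
    moreover have "exp (- t * x) \<le> exp (- s * x)" using st assms(3) by (auto intro: mult_right_mono)
    ultimately show ?thesis using st by simp
  qed
  show ?thesis
    using *[of s t] *[of t s] assms by (cases "s \<le> t") (auto simp: abs_minus_commute)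
qed

text \<open>The difference quotients of \<open>x ^ k * exp (- t * x)\<close> are dominated by \<open>x ^ Suc k * exp (- c * x)\<close>.
  This is integrable for \<open>c > 0\<close>, and for \<open>c = 0\<close>, \<open>k = 0\<close> because the mean of \<open>P\<close> is finite.\<close>

lemma moment_has_derivative:
  assumes c: "0 < c \<or> c = 0 \<and> k = 0" and t: "c \<le> t"
  shows "(moment k has_real_derivative - moment (Suc k) t) (at t within {c..})"
  unfolding has_field_derivative_iff tendsto_at_iff_sequentially
proof (intro allI impI)
  fix X assume X: "\<forall>i. X i \<in> {c..} - {t}" "X \<longlonglongrightarrow> t"
  have c': "0 < c \<or> 0 \<le> c \<and> Suc k \<le> 1" and c0: "0 \<le> c" using c by auto
  have int: "integrable P (\<lambda>x. x ^ k * exp (- s * x))" if "c \<le> s" for s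
    using c that by (intro integrable_moment) auto
  let ?g = "\<lambda>i x. (x ^ k * exp (- X i * x) - x ^ k * exp (- t * x)) / (X i - t)"
  have eq: "((\<lambda>s. (moment k s - moment k t) / (s - t)) \<circ> X) = (\<lambda>i. \<integral>x. ?g i x \<partial>P)"
    using X int t by (intro ext) (simp add: moment_def)
  have lim: "(\<lambda>i. ?g i x) \<longlonglongrightarrow> - (x ^ Suc k * exp (- t * x))" for x :: real
  proof -
    have "((\<lambda>s. x ^ k * exp (- s * x)) has_real_derivative - (x ^ Suc k * exp (- t * x))) (at t)"
      by (auto intro!: derivative_eq_intros)
    then have "((\<lambda>s. (x ^ k * exp (- s * x) - x ^ k * exp (- t * x)) / (s - t)) \<longlongrightarrow>
        - (x ^ Suc k * exp (- t * x))) (at t)"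
      by (simp add: has_field_derivative_iff)
    then show ?thesis using X unfolding tendsto_at_iff_sequentially by (auto simp: comp_def)
  qed
  have "(\<lambda>i. \<integral>x. ?g i x \<partial>P) \<longlonglongrightarrow> (\<integral>x. - (x ^ Suc k * exp (- t * x)) \<partial>P)"
  proof (rule integral_dominated_convergence[where w = "\<lambda>x. x ^ Suc k * exp (- c * x)"])
    show "integrable P (\<lambda>x. x ^ Suc k * exp (- c * x))" by (rule integrable_moment[OF c'])
    show "AE x in P. norm (?g i x) \<le> x ^ Suc k * exp (- c * x)" for i
      using AE_nonneg
    proof eventually_elim
      case (elim x)
      have "X i \<noteq> t" "c \<le> X i" using X by auto
      have "norm (?g i x) = x ^ k * (\<bar>exp (- X i * x) - exp (- t * x)\<bar> / \<bar>X i - t\<bar>)"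
        using elim by (simp add: abs_mult flip: right_diff_distrib)
      also have "\<dots> \<le> x ^ k * (x * exp (- c * x))"
        using exp_diff_le[OF \<open>c \<le> X i\<close> t elim] \<open>X i \<noteq> t\<close> elim
        by (intro mult_left_mono) (auto simp: divide_le_eq mult.commute)
      finally show ?case by (simp add: mult_ac)
    qed
  qed (use lim in auto)
  then show "((\<lambda>s. (moment k s - moment k t) / (s - t)) \<circ> X) \<longlonglongrightarrow> - moment (Suc k) t"
    unfolding eq by (simp add: moment_def)
qed

lemma laplace_eq: "laplace P = moment 0"
  by (simp add: laplace_def moment_def fun_eq_iff)

lemma moment_deriv:
  assumes "0 < t" shows "(moment k has_real_derivative - moment (Suc k) t) (at t)"
proof -
  have "t \<in> interior {t / 2..}" using assms by simp
  then have "at t within {t / 2..} = at t" by (rule at_within_interior)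
  then show ?thesis using moment_has_derivative[of "t / 2" k t] assms by simp
qed

lemma isCont_moment: "0 < t \<Longrightarrow> isCont (moment k) t"
  using moment_deriv DERIV_isCont by blast

lemma within_nonneg_nontrivial: "0 \<le> t \<Longrightarrow> at (t::real) within {0..} \<noteq> bot"
proof -
  assume t: "0 \<le> t"
  have "at_right t \<le> at t within {0..}" using t by (intro at_le) auto
  then show ?thesis using trivial_limit_at_right_real[of t] by (metis bot.extremum_uniqueI)
qed

lemma laplace'_eq: assumes "0 \<le> t" shows "laplace' P t = - moment 1 t"
proof -
  have "(moment 0 has_vector_derivative - moment 1 t) (at t within {0..})"
    using moment_has_derivative[of 0 0 t] assms
    by (simp add: has_real_derivative_iff_has_vector_derivative)
  then show ?thesis unfolding laplace'_def laplace_eq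
    by (rule vector_derivative_within[OF within_nonneg_nontrivial[OF assms]])
qed

lemma laplace''_eq: assumes "0 < t" shows "laplace'' P t = moment 2 t"
proof -
  have "(moment 1 has_real_derivative - moment 2 t) (at t within {0..})"
    by (rule has_field_derivative_at_within) (use moment_deriv[OF assms, of 1] in \<open>simp add: numeral_2_eq_2\<close>)
  then have "((\<lambda>t. - moment 1 t) has_real_derivative moment 2 t) (at t within {0..})"
    using DERIV_minus by fastforce
  then have "(laplace' P has_vector_derivative moment 2 t) (at t within {0..})"
    unfolding has_real_derivative_iff_has_vector_derivative
    by (rule has_vector_derivative_transform_within[of _ _ _ _ 1])
       (use assms laplace'_eq in auto)
  then show ?thesis unfolding laplace''_def
    using assms by (intro vector_derivative_within within_nonneg_nontrivial) auto
qed

lemma moment_pos: assumes "0 < t \<or> 0 \<le> t \<and> k \<le> 1" shows "0 < moment k t"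
proof -
  have nn: "AE x in P. 0 \<le> x ^ k * exp (- t * x)"
    using AE_nonneg by eventually_elim auto
  have "moment k t \<noteq> 0"
  proof
    assume "moment k t = 0"
    then have "AE x in P. x ^ k * exp (- t * x) = 0"
      using integral_nonneg_eq_0_iff_AE[OF integrable_moment[OF assms] nn] by (simp add: moment_def)
    then have "AE x in P. x = 0" by eventually_elim auto
    then have "(\<integral>x. x \<partial>P) = (\<integral>x. 0 \<partial>P)" by (intro integral_cong_AE) auto
    then show False using mean by simp
  qed
  moreover have "0 \<le> moment k t" unfolding moment_def by (rule integral_nonneg_AE[OF nn])
  ultimately show ?thesis by simp
qed

lemma moment_1_0 [simp]: "moment 1 0 = \<mu>" by (simp add: moment_def mean)

lemma continuous_on_moment: assumes "k \<le> 1" shows "continuous_on {0..} (moment k)"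
proof (cases "k = 0")
  case True
  then show ?thesis
    using moment_has_derivative[of 0 0] by (intro DERIV_continuous_on) auto
next
  case False
  then have k: "k = 1" using assms by simp
  show ?thesis unfolding continuous_on_sequentially k
  proof (intro allI ballI impI, elim conjE)
    fix X and t :: real assume X: "\<forall>i. X i \<in> {0..}" "X \<longlonglongrightarrow> t" "t \<in> {0..}"
    have "(\<lambda>i. \<integral>x. x ^ 1 * exp (- X i * x) \<partial>P) \<longlonglongrightarrow> (\<integral>x. x ^ 1 * exp (- t * x) \<partial>P)"
    proof (rule integral_dominated_convergence[where w = "\<lambda>x. x"])
      show "AE x in P. norm (x ^ 1 * exp (- X i * x)) \<le> x" for i
        using AE_nonneg by eventually_elim (use X in \<open>auto simp: abs_mult intro!: mult_left_le\<close>)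
      show "AE x in P. (\<lambda>i. x ^ 1 * exp (- X i * x)) \<longlonglongrightarrow> x ^ 1 * exp (- t * x)"
        by (intro AE_I2 tendsto_intros X)
    qed (auto simp: finite_mean)
    then show "(moment 1 \<circ> X) \<longlonglongrightarrow> moment 1 t" by (simp add: comp_def moment_def)
  qed
qed

lemma laplace_0 [simp]: "laplace P 0 = 1" using prob_space by (simp add: laplace_def)

lemma laplace_strict: assumes "0 \<le> s" "s < t" shows "laplace P t < laplace P s"
  unfolding laplace_eq
proof (rule DERIV_neg_imp_decreasing_open[OF assms(2)])
  fix x assume "s < x" "x < t"
  then show "\<exists>y. DERIV (moment 0) x :> y \<and> y < 0"
    using assms moment_deriv[of x 0] moment_pos[of x 1] by auto
qed (use continuous_on_moment[of 0] assms in \<open>auto intro: continuous_on_subset\<close>)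

lemma laplace_mono: "0 \<le> s \<Longrightarrow> s \<le> t \<Longrightarrow> laplace P t \<le> laplace P s"
  using laplace_strict[of s t] by (cases "s = t") auto

abbreviation "p0 \<equiv> measure P {0}"

lemma laplace_at_top: "(\<lambda>n. laplace P (real n)) \<longlonglongrightarrow> p0"
proof -
  have "(\<lambda>n. \<integral>x. exp (- real n * x) \<partial>P) \<longlonglongrightarrow> (\<integral>x. indicator {0} x \<partial>P)"
  proof (rule integral_dominated_convergence[where w = "\<lambda>x. 1"])
    show "AE x in P. (\<lambda>n. exp (- real n * x)) \<longlonglongrightarrow> indicator {0} x"
      using AE_nonneg
    proof eventually_elim
      case (elim x)
      show ?case
      proof (cases "x = 0")
        case False
        then have "0 < x" using elim by simp
        have "exp (- real n * x) = exp (- x) ^ n" for n by (simp add: exp_of_nat_mult[symmetric])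
        then show ?thesis using \<open>0 < x\<close> False by (simp add: LIMSEQ_realpow_zero)
      qed simp
    qed
    show "AE x in P. norm (exp (- real n * x)) \<le> 1" for n
      using AE_nonneg by eventually_elim auto
  qed auto
  then show ?thesis by (simp add: laplace_def)
qed

lemma moment_1_at_top: "(\<lambda>n. moment 1 (real n)) \<longlonglongrightarrow> 0"
proof (rule tendsto_sandwich[where f = "\<lambda>_. 0" and h = "\<lambda>n. 1 / real n"])
  show "\<forall>\<^sub>F n in sequentially. 0 \<le> moment 1 (real n)"
    using moment_pos[of _ 1] by (intro always_eventually) (auto simp: less_imp_le)
  show "\<forall>\<^sub>F n in sequentially. moment 1 (real n) \<le> 1 / real n"
    using eventually_gt_at_top[of 0]
  proof eventually_elim
    case (elim n)
    have "moment 1 (real n) \<le> (\<integral>x. 1 / real n \<partial>P)" unfolding moment_def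
    proof (rule integral_mono_AE)
      show "AE x in P. x ^ 1 * exp (- real n * x) \<le> 1 / real n"
        using AE_nonneg by eventually_elim (use power_exp_le[of _ "real n" 1] elim in auto)
    qed (use elim integrable_moment[of "real n" 1] in auto)
    then show ?case using prob_space by simp
  qed
qed (auto intro: lim_1_over_n)

lemma laplace_gt: assumes "0 \<le> s" shows "p0 < laplace P s"
proof -
  have "p0 \<le> laplace P (s + 1)"
  proof (rule LIMSEQ_le_const2[OF laplace_at_top])
    show "\<exists>N. \<forall>n\<ge>N. laplace P (real n) \<le> laplace P (s + 1)"
      using assms by (intro exI[of _ "nat \<lceil>s + 1\<rceil>"] allI impI laplace_mono) linarith+
  qed
  also have "\<dots> < laplace P s" using assms by (intro laplace_strict) auto
  finally show ?thesis .
qed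

lemma laplace_le_1: "0 \<le> s \<Longrightarrow> laplace P s \<le> 1"
  using laplace_mono[of 0 s] by simp

lemma inj_on_laplace: "inj_on (laplace P) {0..}"
  by (rule linorder_inj_onI) (use laplace_strict in force)+

lemma laplace_inv_laplace: "0 \<le> s \<Longrightarrow> laplace_inv P (laplace P s) = s"
  unfolding laplace_inv_def by (rule the_inv_into_f_f[OF inj_on_laplace]) auto

lemma laplace_surj: assumes "p0 < y" "y \<le> 1" obtains s where "0 \<le> s" "laplace P s = y"
proof -
  obtain n where n: "laplace P (real n) < y"
    using order_tendstoD(2)[OF laplace_at_top assms(1)] by (auto simp: eventually_sequentially)
  have "continuous_on {0..real n} (laplace P)"
    unfolding laplace_eq by (rule continuous_on_subset[OF continuous_on_moment]) auto
  then have "\<exists>s\<ge>0. s \<le> real n \<and> laplace P s = y"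
    by (intro IVT2') (use n assms in auto)
  then show ?thesis using that by auto
qed

lemma isCont_laplace_inv: assumes "0 < s" shows "isCont (laplace_inv P) (laplace P s)"
proof (rule isCont_inverse_function[where f = "laplace P" and x = s and d = "s / 2"])
  show "\<And>z. \<bar>z - s\<bar> \<le> s / 2 \<Longrightarrow> laplace_inv P (laplace P z) = z"
    using assms by (intro laplace_inv_laplace) (auto simp: abs_if field_simps split: if_splits)
  show "\<And>z. \<bar>z - s\<bar> \<le> s / 2 \<Longrightarrow> isCont (laplace P) z"
    using assms unfolding laplace_eq by (intro isCont_moment) (auto simp: abs_if field_simps split: if_splits)
qed (use assms in auto)

text \<open>Looking back this long, a proportion of about \<open>x\<close> of a large number of objects has been requested.\<close>

definition rank_time :: "real \<Rightarrow> real" where "rank_time x = laplace_inv P (1 - x)"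

lemma rank_time_eq: "0 \<le> s \<Longrightarrow> rank_time (1 - laplace P s) = s"
  by (simp add: rank_time_def laplace_inv_laplace)

lemma rank_time_cases:
  assumes "0 < x" "x < 1 - p0" obtains s where "0 < s" "x = 1 - laplace P s" "rank_time x = s"
proof -
  obtain s where s: "0 \<le> s" "laplace P s = 1 - x" using laplace_surj[of "1 - x"] assms by auto
  then have "s \<noteq> 0" using assms(1) by auto
  then show ?thesis using s rank_time_eq[of s] by (intro that[of s]) auto
qed

lemma isCont_rank_time: assumes "0 < s" shows "isCont rank_time (1 - laplace P s)"
proof -
  have "isCont (\<lambda>x. laplace_inv P (1 - x)) (1 - laplace P s)"
    by (rule isCont_o2[of _ "\<lambda>x. 1 - x"]) (use isCont_laplace_inv[OF assms] in auto)
  then show ?thesis by (simp add: rank_time_def[abs_def])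
qed

lemma rank_time_deriv:
  assumes "0 < s" shows "(rank_time has_real_derivative 1 / moment 1 s) (at (1 - laplace P s))"
proof -
  have "(rank_time has_real_derivative inverse (moment 1 s)) (at (1 - laplace P s))"
  proof (rule DERIV_inverse_function[where f = "\<lambda>s. 1 - laplace P s" and a = 0 and b = "1 - p0"])
    have "rank_time (1 - laplace P s) = s" using assms by (simp add: rank_time_eq)
    then show "((\<lambda>s. 1 - laplace P s) has_real_derivative moment 1 s) (at (rank_time (1 - laplace P s)))"
      unfolding laplace_eq using moment_deriv[OF assms, of 0]
      by (auto intro!: derivative_eq_intros)
    show "moment 1 s \<noteq> 0" using moment_pos[of s 1] assms by auto
    show "0 < 1 - laplace P s" using laplace_strict[of 0 s] assms by simp
    show "1 - laplace P s < 1 - p0" using laplace_gt[of s] assms by simp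
    show "1 - laplace P (rank_time y) = y" if "0 < y" "y < 1 - p0" for y
      using rank_time_cases[OF that] by metis
    show "isCont rank_time (1 - laplace P s)" by (rule isCont_rank_time[OF assms])
  qed
  then show ?thesis by (simp add: inverse_eq_divide)
qed

lemma dens_inf_eq:
  assumes "0 < s" shows "dens_inf P (1 - laplace P s) = moment 2 s / (\<mu> * moment 1 s)"
proof -
  have "1 - laplace P s \<in> {0..1 - p0}" using laplace_gt[of s] laplace_le_1[of s] assms by auto
  moreover have "laplace_inv P (1 - (1 - laplace P s)) = s" using assms by (simp add: laplace_inv_laplace)
  ultimately show ?thesis using assms
    by (simp add: dens_inf_def laplace'_eq laplace''_eq mean)
qed

lemma dens_inf_outside: "x \<notin> {0..1 - p0} \<Longrightarrow> dens_inf P x = 0"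
  by (simp add: dens_inf_def)

lemma dens_inf_nonneg: assumes "x \<noteq> 0" "x \<noteq> 1 - p0" shows "0 \<le> dens_inf P x"
proof (cases "x \<in> {0<..<1 - p0}")
  case True
  then obtain s where s: "0 < s" "x = 1 - laplace P s" using rank_time_cases[of x] by auto
  then show ?thesis using dens_inf_eq[OF s(1)] moment_pos[of s 1] moment_pos[of s 2] mean_pos by auto
next
  case False
  then show ?thesis using assms dens_inf_outside[of x] by auto
qed

lemma dens_inf_measurable [measurable]: "dens_inf P \<in> borel_measurable borel"
proof -
  let ?h = "\<lambda>x. moment 2 (rank_time x) / (\<mu> * moment 1 (rank_time x))"
  have cont: "continuous_on {0<..<1 - p0} ?h"
  proof (rule continuous_at_imp_continuous_on, rule ballI)
    fix x assume "x \<in> {0<..<1 - p0}"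
    then obtain s where s: "0 < s" "x = 1 - laplace P s" "rank_time x = s"
      using rank_time_cases[of x] by auto
    have "isCont (\<lambda>x. moment k (rank_time x)) x" for k
      by (rule isCont_o2[of _ rank_time]) (use s isCont_rank_time isCont_moment in auto)
    moreover have "moment 1 (rank_time x) \<noteq> 0" using s moment_pos[of s 1] by auto
    ultimately show "isCont ?h x" using mean_pos by (intro continuous_intros) auto
  qed
  have "(\<lambda>x. indicator {0<..<1 - p0} x *\<^sub>R ?h x) \<in> borel_measurable borel"
    by (rule borel_measurable_continuous_on_indicator[OF _ cont]) auto
  then show ?thesis
  proof (rule measurable_discrete_difference[where X = "{0, 1 - p0}"])
    fix x :: real assume x: "x \<in> space borel" "x \<notin> {0, 1 - p0}"
    show "indicator {0<..<1 - p0} x *\<^sub>R ?h x = dens_inf P x"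
    proof (cases "x \<in> {0<..<1 - p0}")
      case True
      then obtain s where s: "0 < s" "x = 1 - laplace P s" "rank_time x = s"
        using rank_time_cases[of x] by auto
      then show ?thesis using True dens_inf_eq[OF s(1)] by simp
    next
      case False
      then show ?thesis using x dens_inf_outside[of x] by auto
    qed
  qed auto
qed

abbreviation "law_inf \<equiv> density lborel (\<lambda>x. ennreal (dens_inf P x))"

text \<open>By the inverse function rule \<open>- moment 1 (rank_time x) / \<mu>\<close> is an antiderivative of the density.\<close>

lemma emeasure_law_inf_interval:
  assumes "0 < a" "a \<le> s"
  shows "emeasure law_inf {1 - laplace P a..1 - laplace P s} = ennreal ((moment 1 a - moment 1 s) / \<mu>)"
proof -
  let ?F = "\<lambda>x. - moment 1 (rank_time x) / \<mu>"
  have le: "1 - laplace P a \<le> 1 - laplace P s" using assms laplace_mono[of a s] by auto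
  have range: "\<exists>r. 0 < r \<and> x = 1 - laplace P r"
    if "1 - laplace P a \<le> x" "x \<le> 1 - laplace P s" for x
  proof -
    have "0 < x" "x < 1 - p0" using that laplace_strict[of 0 a] laplace_gt[of s] assms by auto
    then show ?thesis using rank_time_cases by metis
  qed
  have "(\<integral>\<^sup>+x. ennreal (dens_inf P x) * indicator {1 - laplace P a..1 - laplace P s} x \<partial>lborel) =
     ennreal (?F (1 - laplace P s) - ?F (1 - laplace P a))"
  proof (rule nn_integral_FTC_Icc[where F = ?F])
    fix x assume x: "x \<in> {1 - laplace P a..1 - laplace P s}"
    then obtain r where r: "0 < r" "x = 1 - laplace P r" using range[of x] by auto
    have rt: "rank_time x = r" using r rank_time_eq by simp
    have "((\<lambda>x. moment 1 (rank_time x)) has_real_derivative (- moment 2 r) * (1 / moment 1 r)) (at x)"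
      by (rule DERIV_chain2[of "moment 1" _ rank_time])
         (use moment_deriv[OF r(1), of 1] rank_time_deriv[OF r(1)] rt r(2) in \<open>auto simp: numeral_2_eq_2\<close>)
    then have "(?F has_real_derivative - ((- moment 2 r) * (1 / moment 1 r)) / \<mu>) (at x)"
      by (intro DERIV_cdivide DERIV_minus)
    then have "(?F has_real_derivative dens_inf P x) (at x)"
      using dens_inf_eq[OF r(1)] r(2) mean_pos by (simp add: mult.commute)
    then show "(?F has_real_derivative dens_inf P x) (at x)" .
  next
    fix x assume x: "x \<in> {1 - laplace P a..1 - laplace P s}"
    then obtain r where r: "0 < r" "x = 1 - laplace P r" using range[of x] by auto
    show "0 \<le> dens_inf P x"
      using dens_inf_eq[OF r(1)] r moment_pos[of r 1] moment_pos[of r 2] mean_pos by auto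
  qed (use le in auto)
  then show ?thesis using assms mean_pos
    by (simp add: emeasure_density rank_time_eq diff_divide_distrib)
qed

text \<open>The second derivative of the Laplace transform may be infinite at 0, so the left end point is
  reached by a limit; the first derivative is continuous there.\<close>

lemma emeasure_law_inf_greaterThanAtMost:
  assumes "0 < s"
  shows "emeasure law_inf {0<..1 - laplace P s} = ennreal (1 - moment 1 s / \<mu>)"
proof -
  define a where "a k = s / (real k + 1)" for k :: nat
  have a: "0 < a k" "a k \<le> s" for k using assms by (auto simp: a_def field_simps)
  have a_lim: "a \<longlonglongrightarrow> 0" unfolding a_def by real_asymp
  have a_mono: "a l \<le> a k" if "k \<le> l" for k l
    using that assms unfolding a_def by (intro divide_left_mono) auto
  let ?A = "\<lambda>k. {1 - laplace P (a k)..1 - laplace P s}"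
  have phi_lim: "(\<lambda>k. laplace P (a k)) \<longlonglongrightarrow> laplace P 0"
    using continuous_on_moment[of 0] a_lim a(1)[THEN less_imp_le]
    unfolding laplace_eq continuous_on_sequentially by (auto simp: comp_def)
  have m_lim: "(\<lambda>k. moment 1 (a k)) \<longlonglongrightarrow> moment 1 0"
    using continuous_on_moment[of 1] a_lim a(1)[THEN less_imp_le]
    unfolding continuous_on_sequentially by (auto simp: comp_def)
  have inc: "incseq ?A"
  proof (rule incseq_SucI)
    fix k show "?A k \<subseteq> ?A (Suc k)"
      using laplace_mono[of "a (Suc k)" "a k"] a[of "Suc k"] a_mono[of k "Suc k"] by auto
  qed
  have un: "(\<Union>k. ?A k) = {0<..1 - laplace P s}"
  proof (intro set_eqI iffI)
    fix x assume "x \<in> (\<Union>k. ?A k)"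
    then obtain k where "x \<in> ?A k" by auto
    then show "x \<in> {0<..1 - laplace P s}" using laplace_strict[of 0 "a k"] a[of k] by auto
  next
    fix x assume x: "x \<in> {0<..1 - laplace P s}"
    have "\<forall>\<^sub>F k in sequentially. 1 - x < laplace P (a k)"
      using x by (intro order_tendstoD(1)[OF phi_lim]) auto
    then obtain k where "1 - x < laplace P (a k)" by (auto simp: eventually_sequentially)
    then show "x \<in> (\<Union>k. ?A k)" using x by (auto intro!: exI[of _ k])
  qed
  have "(\<lambda>k. emeasure law_inf (?A k)) \<longlonglongrightarrow> emeasure law_inf (\<Union>k. ?A k)"
    by (rule Lim_emeasure_incseq[OF _ inc]) auto
  moreover have "(\<lambda>k. emeasure law_inf (?A k)) \<longlonglongrightarrow> ennreal ((moment 1 0 - moment 1 s) / \<mu>)"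
    unfolding emeasure_law_inf_interval[OF a] by (intro tendsto_intros m_lim) (use mean_pos in auto)
  ultimately have "emeasure law_inf {0<..1 - laplace P s} = ennreal ((moment 1 0 - moment 1 s) / \<mu>)"
    unfolding un by (rule LIMSEQ_unique)
  then show ?thesis using mean_pos by (simp add: diff_divide_distrib del: One_nat_def)
qed

lemma emeasure_law_inf_null: "countable X \<Longrightarrow> emeasure law_inf X = 0"
proof -
  assume "countable X"
  then have "X \<in> null_sets lborel" by (rule countable_imp_null_set_lborel)
  then have "X \<in> sets borel" "AE x in lborel. x \<notin> X" by (auto intro: AE_not_in)
  then have "X \<in> null_sets law_inf" by (subst null_sets_density_iff) auto
  then show ?thesis by auto
qed

lemma emeasure_law_inf_UNIV: "emeasure law_inf UNIV = 1"
proof -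
  let ?A = "\<lambda>k. {0<..1 - laplace P (real k + 1)}"
  have phi_lim: "(\<lambda>k. laplace P (real k + 1)) \<longlonglongrightarrow> p0" and m_lim: "(\<lambda>k. moment 1 (real k + 1)) \<longlonglongrightarrow> 0"
    using LIMSEQ_Suc[OF laplace_at_top] LIMSEQ_Suc[OF moment_1_at_top] by (simp_all add: add.commute)
  have inc: "incseq ?A"
  proof (rule incseq_SucI)
    fix k show "?A k \<subseteq> ?A (Suc k)" using laplace_mono[of "real k + 1" "real (Suc k) + 1"] by auto
  qed
  have un: "(\<Union>k. ?A k) = {0<..<1 - p0}"
  proof (intro set_eqI iffI)
    fix x assume "x \<in> (\<Union>k. ?A k)"
    then obtain k where "x \<in> ?A k" by auto
    then show "x \<in> {0<..<1 - p0}" using laplace_gt[of "real k + 1"] by auto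
  next
    fix x assume x: "x \<in> {0<..<1 - p0}"
    have "\<forall>\<^sub>F k in sequentially. laplace P (real k + 1) < 1 - x"
      using x by (intro order_tendstoD(2)[OF phi_lim]) auto
    then obtain k where "laplace P (real k + 1) < 1 - x" by (auto simp: eventually_sequentially)
    then show "x \<in> (\<Union>k. ?A k)" using x by (auto intro!: exI[of _ k])
  qed
  have "(\<lambda>k. emeasure law_inf (?A k)) \<longlonglongrightarrow> emeasure law_inf (\<Union>k. ?A k)"
    by (rule Lim_emeasure_incseq[OF _ inc]) auto
  moreover have "(\<lambda>k. emeasure law_inf (?A k)) \<longlonglongrightarrow> ennreal (1 - 0 / \<mu>)"
  proof -
    have "emeasure law_inf (?A k) = ennreal (1 - moment 1 (real k + 1) / \<mu>)" for k
      by (rule emeasure_law_inf_greaterThanAtMost) simp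
    then show ?thesis by (simp only:) (intro tendsto_intros m_lim, use mean_pos in auto)
  qed
  ultimately have "emeasure law_inf {0<..<1 - p0} = ennreal (1 - 0 / \<mu>)"
    unfolding un by (rule LIMSEQ_unique)
  then have 1: "emeasure law_inf {0<..<1 - p0} = 1" by simp
  have "emeasure law_inf UNIV = emeasure law_inf {0<..<1 - p0}"
  proof -
    have "(\<integral>\<^sup>+ x. ennreal (dens_inf P x) * indicator UNIV x \<partial>lborel) =
       (\<integral>\<^sup>+ x. ennreal (dens_inf P x) * indicator {0<..<1 - p0} x \<partial>lborel)"
    proof (rule nn_integral_cong_AE)
      have "AE x in lborel. x \<notin> {0, 1 - p0}"
        by (intro AE_not_in countable_imp_null_set_lborel) auto
      then show "AE x in lborel. ennreal (dens_inf P x) * indicator UNIV x =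
          ennreal (dens_inf P x) * indicator {0<..<1 - p0} x"
        by eventually_elim (use dens_inf_outside in \<open>auto simp: indicator_def\<close>)
    qed
    then show ?thesis by (subst (1 2) emeasure_density) auto
  qed
  then show ?thesis using 1 by simp
qed

lemma probability_density_dens_inf: "probability_density (dens_inf P)"
  unfolding probability_density_def
proof (intro conjI)
  have "AE x in lborel. x \<notin> {0, 1 - p0}"
    by (intro AE_not_in countable_imp_null_set_lborel) auto
  then show "AE x in lborel. 0 \<le> dens_inf P x"
    by eventually_elim (use dens_inf_nonneg in auto)
  show "(\<integral>\<^sup>+x. ennreal (dens_inf P x) \<partial>lborel) = 1"
    using emeasure_law_inf_UNIV by (simp add: emeasure_density)
qed simp

end

section \<open>Generalized inverses and the boundary density\<close>

text \<open>Both integrals are the area under the graph of \<open>h\<close>. Measurability of \<open>h\<close> comes for free, as the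
  superlevel sets are intervals.\<close>

lemma layer_cake_interval:
  fixes h l u :: "real \<Rightarrow> real"
  assumes nonneg: "\<And>x. x \<in> {a<..<b} \<Longrightarrow> 0 \<le> h x"
    and level: "\<And>y. 0 \<le> y \<Longrightarrow> {x\<in>{a<..<b}. y < h x} = {l y<..<u y}"
  shows "(\<lambda>x. indicator {a<..<b} x * h x) \<in> borel_measurable borel"
    and "(\<integral>\<^sup>+x. ennreal (h x) * indicator {a<..<b} x \<partial>lborel) =
      (\<integral>\<^sup>+y. ennreal (max 0 (u y - l y)) * indicator {0..} y \<partial>lborel)"
proof -
  define h' where "h' x = indicator {a<..<b} x * h x" for x
  have h'0: "0 \<le> h' x" for x using nonneg[of x] by (auto simp: h'_def indicator_def)
  have lev: "{x. y < h' x} = {l y<..<u y}" if "0 \<le> y" for y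
    using level[OF that] that by (auto simp: h'_def indicator_def set_eq_iff split: if_splits)
  have h'm [measurable]: "h' \<in> borel_measurable borel"
  proof (rule borel_measurable_iff_greater[THEN iffD2], rule allI)
    fix y :: real
    show "{x \<in> space borel. y < h' x} \<in> sets borel"
    proof (cases "0 \<le> y")
      case True then show ?thesis using lev by simp
    next
      case False
      then have "{x \<in> space borel. y < h' x} = UNIV" using less_le_trans[OF _ h'0] by (auto simp: not_le)
      then show ?thesis by simp
    qed
  qed
  then show "(\<lambda>x. indicator {a<..<b} x * h x) \<in> borel_measurable borel" by (simp add: h'_def[abs_def])
  have "(\<integral>\<^sup>+x. ennreal (h x) * indicator {a<..<b} x \<partial>lborel) = (\<integral>\<^sup>+x. ennreal (h' x) \<partial>lborel)"
    by (intro nn_integral_cong) (auto simp: h'_def indicator_def)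
  also have "\<dots> = (\<integral>\<^sup>+x. (\<integral>\<^sup>+y. indicator {(x, y). 0 \<le> y \<and> y < h' x} (x, y) \<partial>lborel) \<partial>lborel)"
  proof (rule nn_integral_cong)
    fix x
    have "(\<integral>\<^sup>+y. indicator {(x, y). 0 \<le> y \<and> y < h' x} (x, y) \<partial>lborel) = (\<integral>\<^sup>+y. indicator {0..<h' x} y \<partial>lborel)"
      by (intro nn_integral_cong) (auto simp: indicator_def)
    then show "ennreal (h' x) = (\<integral>\<^sup>+y. indicator {(x, y). 0 \<le> y \<and> y < h' x} (x, y) \<partial>lborel)"
      using h'0[of x] by simp
  qed
  also have "\<dots> = (\<integral>\<^sup>+y. (\<integral>\<^sup>+x. indicator {(x, y). 0 \<le> y \<and> y < h' x} (x, y) \<partial>lborel) \<partial>lborel)"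
  proof -
    have "(\<lambda>p. indicator {(x, y). 0 \<le> y \<and> y < h' x} p :: ennreal) \<in> borel_measurable (lborel \<Otimes>\<^sub>M lborel)"
      by measurable
    then have "(\<lambda>(x, y). indicator {(x, y). 0 \<le> y \<and> y < h' x} (x, y) :: ennreal) \<in> borel_measurable (lborel \<Otimes>\<^sub>M lborel)"
      by (simp add: case_prod_eta)
    then show ?thesis by (rule lborel_pair.Fubini'[symmetric])
  qed
  also have "\<dots> = (\<integral>\<^sup>+y. ennreal (max 0 (u y - l y)) * indicator {0..} y \<partial>lborel)"
  proof (rule nn_integral_cong)
    fix y :: real
    show "(\<integral>\<^sup>+x. indicator {(x, y). 0 \<le> y \<and> y < h' x} (x, y) \<partial>lborel) =
        ennreal (max 0 (u y - l y)) * indicator {0..} y"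
    proof (cases "0 \<le> y")
      case True
      have "(\<integral>\<^sup>+x. indicator {(x, y). 0 \<le> y \<and> y < h' x} (x, y) \<partial>lborel) =
          (\<integral>\<^sup>+x. indicator {l y<..<u y} x \<partial>lborel)"
        using lev[OF True] True by (intro nn_integral_cong) (auto simp: indicator_def set_eq_iff)
      also have "\<dots> = ennreal (max 0 (u y - l y))"
        by (cases "l y \<le> u y") (auto simp: max_def)
      finally show ?thesis using True by simp
    next
      case False
      then have "(\<integral>\<^sup>+x. indicator {(x, y). 0 \<le> y \<and> y < h' x} (x, y) \<partial>lborel) = (\<integral>\<^sup>+x. 0 \<partial>lborel :: real measure)"
        by (intro nn_integral_cong) auto
      then show ?thesis using False by simp
    qed
  qed
  finally show "(\<integral>\<^sup>+x. ennreal (h x) * indicator {a<..<b} x \<partial>lborel) =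
      (\<integral>\<^sup>+y. ennreal (max 0 (u y - l y)) * indicator {0..} y \<partial>lborel)" .
qed

lemma (in finite_measure) measure_split:
  assumes "A \<in> sets M" "B \<in> sets M"
  shows "measure M A = measure M (A - B) + measure M (A \<inter> B)"
proof -
  have "measure M ((A - B) \<union> (A \<inter> B)) = measure M (A - B) + measure M (A \<inter> B)"
    by (intro finite_measure_Union) (use assms in auto)
  moreover have "(A - B) \<union> (A \<inter> B) = A" by auto
  ultimately show ?thesis by simp
qed

context mean_law begin

lemma integrable_exp_indicator:
  assumes "0 \<le> t" "A \<in> sets borel"
  shows "integrable P (\<lambda>z. indicator A z *\<^sub>R exp (- z * t))"
proof (rule integrable_const_bound[where B = 1])
  show "AE z in P. norm (indicator A z *\<^sub>R exp (- z * t)) \<le> 1"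
    using AE_nonneg by eventually_elim (use assms in \<open>auto simp: indicator_def\<close>)
qed (use assms in auto)

lemma g_minus_nonneg: "0 \<le> g_minus P t y"
  unfolding g_minus_def set_lebesgue_integral_def by (intro integral_nonneg_AE AE_I2) auto

lemma g_minus_mono: assumes "0 \<le> t" "y \<le> y'" shows "g_minus P t y \<le> g_minus P t y'"
  unfolding g_minus_def set_lebesgue_integral_def
  by (intro integral_mono integrable_exp_indicator assms) (use assms in \<open>auto simp: indicator_def\<close>)

lemma g_plus_eq:
  assumes "0 \<le> t" "0 \<le> y" shows "g_plus P t y = laplace P t - g_minus P t y"
proof -
  have "g_minus P t y + g_plus P t y =
      (\<integral>z. indicator {0..y} z *\<^sub>R exp (- z * t) + indicator {y<..} z *\<^sub>R exp (- z * t) \<partial>P)"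
    unfolding g_minus_def g_plus_def set_lebesgue_integral_def
    using assms by (intro Bochner_Integration.integral_add[symmetric] integrable_exp_indicator) auto
  also have "\<dots> = (\<integral>z. exp (- t * z) \<partial>P)"
  proof (rule integral_cong_AE)
    show "AE z in P. indicator {0..y} z *\<^sub>R exp (- z * t) + indicator {y<..} z *\<^sub>R exp (- z * t) = exp (- t * z)"
      using AE_nonneg by eventually_elim (use assms in \<open>auto simp: indicator_def mult.commute\<close>)
  qed auto
  finally show ?thesis by (simp add: laplace_def)
qed

lemma g_plus_nonneg: "0 \<le> g_plus P t y"
  unfolding g_plus_def set_lebesgue_integral_def by (intro integral_nonneg_AE AE_I2) auto

lemma g_minus_le: "0 \<le> t \<Longrightarrow> 0 \<le> y \<Longrightarrow> g_minus P t y \<le> laplace P t"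
  using g_plus_eq[of t y] g_plus_nonneg[of t y] by simp

lemma g_minus_seq:
  assumes t: "0 \<le> t" and Y: "\<And>z. 0 \<le> z \<Longrightarrow> (\<lambda>k. indicator {0..Y k} z :: real) \<longlonglongrightarrow> indicator A z"
    and A: "A \<in> sets borel"
  shows "(\<lambda>k. g_minus P t (Y k)) \<longlonglongrightarrow> (LINT z:A|P. exp (- z * t))"
  unfolding g_minus_def set_lebesgue_integral_def
proof (rule integral_dominated_convergence[where w = "\<lambda>_. 1"])
  show "AE z in P. (\<lambda>k. indicator {0..Y k} z *\<^sub>R exp (- z * t)) \<longlonglongrightarrow> indicator A z *\<^sub>R exp (- z * t)"
    using AE_nonneg by eventually_elim (intro tendsto_intros Y)
  show "AE z in P. norm (indicator {0..Y k} z *\<^sub>R exp (- z * t)) \<le> 1" for k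
    using AE_nonneg by eventually_elim (use t in \<open>auto simp: indicator_def\<close>)
qed (use A in auto)

lemma g_minus_right_continuous:
  assumes t: "0 \<le> t" and "g_minus P t y < r"
  obtains y' where "y < y'" "g_minus P t y' < r"
proof -
  let ?Y = "\<lambda>k. y + 1 / real (Suc k)"
  have "(\<lambda>k. g_minus P t (?Y k)) \<longlonglongrightarrow> (LINT z:{0..y}|P. exp (- z * t))"
  proof (rule g_minus_seq[OF t])
    fix z :: real assume z: "0 \<le> z"
    show "(\<lambda>k. indicator {0..?Y k} z :: real) \<longlonglongrightarrow> indicator {0..y} z"
    proof (cases "z \<le> y")
      case True
      then have "indicator {0..?Y k} z = (indicator {0..y} z :: real)" for k
        using z by (auto simp: indicator_def intro: add_increasing2)
      then show ?thesis by simp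
    next
      case False
      have "?Y \<longlonglongrightarrow> y + 0" using LIMSEQ_Suc[OF lim_1_over_n] by (intro tendsto_add tendsto_const)
      then have "\<forall>\<^sub>F k in sequentially. ?Y k < z" using False by (intro order_tendstoD(2)) auto
      then have "\<forall>\<^sub>F k in sequentially. indicator {0..?Y k} z = (indicator {0..y} z :: real)"
        by eventually_elim (use False in \<open>auto simp: indicator_def\<close>)
      then show ?thesis by (rule tendsto_eventually)
    qed
  qed simp
  then have "(\<lambda>k. g_minus P t (?Y k)) \<longlonglongrightarrow> g_minus P t y" by (simp add: g_minus_def)
  then have "\<forall>\<^sub>F k in sequentially. g_minus P t (?Y k) < r" using assms(2) by (rule order_tendstoD(2))
  then obtain k where "g_minus P t (?Y k) < r" by (auto simp: eventually_sequentially)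
  then show ?thesis by (intro that[of "?Y k"]) auto
qed

lemma g_minus_approaches:
  assumes t: "0 \<le> t" and "r < laplace P t" obtains y where "0 \<le> y" "r \<le> g_minus P t y"
proof -
  have "(\<lambda>k. g_minus P t (real k)) \<longlonglongrightarrow> (LINT z:UNIV|P. exp (- z * t))"
  proof (rule g_minus_seq[OF t])
    fix z :: real assume z: "0 \<le> z"
    have "\<forall>\<^sub>F k in sequentially. indicator {0..real k} z = (indicator UNIV z :: real)"
      using eventually_ge_at_top[of "nat \<lceil>z\<rceil>"]
      by eventually_elim (use z in \<open>auto simp: indicator_def nat_le_iff ceiling_le_iff\<close>)
    then show "(\<lambda>k. indicator {0..real k} z :: real) \<longlonglongrightarrow> indicator UNIV z" by (rule tendsto_eventually)
  qed simp
  then have "(\<lambda>k. g_minus P t (real k)) \<longlonglongrightarrow> laplace P t"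
    by (simp add: laplace_def set_lebesgue_integral_def mult.commute)
  then have "\<forall>\<^sub>F k in sequentially. r < g_minus P t (real k)" using assms(2) by (rule order_tendstoD(1))
  then obtain k where "r < g_minus P t (real k)" by (auto simp: eventually_sequentially)
  then show ?thesis by (intro that[of "real k"]) auto
qed

text \<open>For right-continuous functions the infimum in the generalized inverse is attained, which makes it an
  adjoint of the function. Below \<open>laplace P t\<close>, the limit of \<open>g_minus P t\<close> at infinity, the infimum is
  over a nonempty set.\<close>

lemma less_gen_inverse_iff:
  assumes t: "0 \<le> t" and r: "r < laplace P t"
  shows "0 \<le> gen_inverse (g_minus P t) r"
    and "0 \<le> y \<Longrightarrow> y < gen_inverse (g_minus P t) r \<longleftrightarrow> g_minus P t y < r"
proof -
  let ?A = "{s. 0 \<le> s \<and> r \<le> g_minus P t s}"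
  have ne: "?A \<noteq> {}" using g_minus_approaches[OF t r] by blast
  have bdd: "bdd_below ?A" by (rule bdd_belowI[of _ 0]) auto
  show "0 \<le> gen_inverse (g_minus P t) r" unfolding gen_inverse_def by (rule cInf_greatest[OF ne]) auto
  assume y: "0 \<le> y"
  show "y < gen_inverse (g_minus P t) r \<longleftrightarrow> g_minus P t y < r"
  proof
    assume "y < gen_inverse (g_minus P t) r"
    then have "y \<notin> ?A" unfolding gen_inverse_def using cInf_lower[OF _ bdd, of y] by force
    then show "g_minus P t y < r" using y by auto
  next
    assume "g_minus P t y < r"
    then obtain y' where y': "y < y'" "g_minus P t y' < r" by (rule g_minus_right_continuous[OF t])
    have "y' \<le> Inf ?A"
    proof (rule cInf_greatest[OF ne])
      fix s assume s: "s \<in> ?A"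
      show "y' \<le> s"
      proof (rule ccontr)
        assume "\<not> y' \<le> s"
        then have "g_minus P t s \<le> g_minus P t y'" by (intro g_minus_mono t) simp
        then show False using s y' by auto
      qed
    qed
    then show "y < gen_inverse (g_minus P t) r" using y' by (simp add: gen_inverse_def)
  qed
qed

text \<open>Both boundary densities are inverses of the same function, read in opposite directions.\<close>

lemma g_tilde_plus_eq:
  assumes "0 \<le> t" shows "g_tilde_plus P t x = gen_inverse (g_minus P t) (x - (1 - laplace P t))"
proof -
  have "{s. 0 \<le> s \<and> x \<le> 1 - g_plus P t s} = {s. 0 \<le> s \<and> x - (1 - laplace P t) \<le> g_minus P t s}"
    using g_plus_eq[OF assms] by auto
  then show ?thesis by (simp add: g_tilde_plus_def gen_inverse_def)
qed

text \<open>The length of the set of all \<open>x\<close> between \<open>a\<close> and 1 where the boundary density for decreasing weights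
  exceeds \<open>y\<close>; \<open>width_plus\<close> is its counterpart for increasing weights.\<close>

definition width_minus :: "real \<Rightarrow> real \<Rightarrow> real \<Rightarrow> real" where
  "width_minus t a y = max 0 (1 - a - g_minus P t y)"

definition width_plus :: "real \<Rightarrow> real \<Rightarrow> real \<Rightarrow> real" where
  "width_plus t a y = min (1 - a) (laplace P t - g_minus P t y)"

text \<open>Pairs the boundary densities with the lengths of their superlevel sets, so that most of the argument
  treats both orders of the weights at once.\<close>

definition boundary_case :: "(real \<Rightarrow> real \<Rightarrow> real) \<Rightarrow> (real \<Rightarrow> real \<Rightarrow> real \<Rightarrow> real) \<Rightarrow> bool" where
  "boundary_case gt \<beta> \<longleftrightarrow> gt = g_tilde_minus P \<and> \<beta> = width_minus \<or> gt = g_tilde_plus P \<and> \<beta> = width_plus"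

lemma boundary_case_nonneg:
  assumes "boundary_case gt \<beta>" "0 \<le> t" "1 - laplace P t < x" "x < 1"
  shows "0 \<le> gt t x"
  using assms less_gen_inverse_iff(1)[OF assms(2), of "1 - x"]
    less_gen_inverse_iff(1)[OF assms(2), of "x - (1 - laplace P t)"]
  by (auto simp: boundary_case_def g_tilde_plus_eq g_tilde_minus_def)

lemma boundary_layer_cake:
  assumes bc: "boundary_case gt \<beta>" and t: "0 \<le> t" and a: "1 - laplace P t \<le> a" "a \<le> 1"
  shows "(\<lambda>x. indicator {a<..<1} x * gt t x) \<in> borel_measurable borel"
    and "(\<integral>\<^sup>+x. ennreal (gt t x) * indicator {a<..<1} x \<partial>lborel) =
       (\<integral>\<^sup>+y. ennreal (\<beta> t a y) * indicator {0..} y \<partial>lborel)"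
proof -
  have nn: "0 \<le> gt t x" if "x \<in> {a<..<1}" for x
    using boundary_case_nonneg[OF bc t, of x] that a by auto
  have *: "(\<lambda>x. indicator {a<..<1} x * gt t x) \<in> borel_measurable borel \<and>
    (\<integral>\<^sup>+x. ennreal (gt t x) * indicator {a<..<1} x \<partial>lborel) =
       (\<integral>\<^sup>+y. ennreal (\<beta> t a y) * indicator {0..} y \<partial>lborel)"
    using bc unfolding boundary_case_def
  proof (elim disjE conjE)
    assume gt: "gt = g_tilde_minus P" and \<beta>: "\<beta> = width_minus"
    have lev: "{x\<in>{a<..<1}. y < gt t x} = {a<..<1 - g_minus P t y}" if "0 \<le> y" for y
    proof -
      have "y < gt t x \<longleftrightarrow> x < 1 - g_minus P t y" if "x \<in> {a<..<1}" for x
        using less_gen_inverse_iff(2)[OF t, of "1 - x" y] \<open>0 \<le> y\<close> that a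
        by (auto simp: gt g_tilde_minus_def)
      then show ?thesis using g_minus_nonneg[of t y] by auto
    qed
    have "(\<integral>\<^sup>+x. ennreal (gt t x) * indicator {a<..<1} x \<partial>lborel) =
      (\<integral>\<^sup>+y. ennreal (max 0 (1 - g_minus P t y - a)) * indicator {0..} y \<partial>lborel)"
      by (rule layer_cake_interval(2)[OF nn lev])
    also have "\<dots> = (\<integral>\<^sup>+y. ennreal (\<beta> t a y) * indicator {0..} y \<partial>lborel)"
      by (simp add: \<beta> width_minus_def algebra_simps)
    finally show ?thesis using layer_cake_interval(1)[OF nn lev] by simp
  next
    assume gt: "gt = g_tilde_plus P" and \<beta>: "\<beta> = width_plus"
    have lev: "{x\<in>{a<..<1}. y < gt t x} = {max a (1 - laplace P t + g_minus P t y)<..<1}" if "0 \<le> y" for y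
    proof -
      have "y < gt t x \<longleftrightarrow> 1 - laplace P t + g_minus P t y < x" if "x \<in> {a<..<1}" for x
        using less_gen_inverse_iff(2)[OF t, of "x - (1 - laplace P t)" y] \<open>0 \<le> y\<close> that a
        by (auto simp: gt g_tilde_plus_eq[OF t])
      then show ?thesis by auto
    qed
    have "(\<integral>\<^sup>+x. ennreal (gt t x) * indicator {a<..<1} x \<partial>lborel) =
      (\<integral>\<^sup>+y. ennreal (max 0 (1 - max a (1 - laplace P t + g_minus P t y))) * indicator {0..} y \<partial>lborel)"
      by (rule layer_cake_interval(2)[OF nn lev])
    also have "\<dots> = (\<integral>\<^sup>+y. ennreal (\<beta> t a y) * indicator {0..} y \<partial>lborel)"
    proof (rule nn_integral_cong)
      fix y :: real
      show "ennreal (max 0 (1 - max a (1 - laplace P t + g_minus P t y))) * indicator {0..} y =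
        ennreal (\<beta> t a y) * indicator {0..} y"
        using g_minus_le[OF t, of y] a by (cases "0 \<le> y") (auto simp: \<beta> width_plus_def max_def min_def)
    qed
    finally show ?thesis using layer_cake_interval(1)[OF nn lev] by simp
  qed
  show "(\<lambda>x. indicator {a<..<1} x * gt t x) \<in> borel_measurable borel" using * by simp
  show "(\<integral>\<^sup>+x. ennreal (gt t x) * indicator {a<..<1} x \<partial>lborel) =
       (\<integral>\<^sup>+y. ennreal (\<beta> t a y) * indicator {0..} y \<partial>lborel)" using * by simp
qed

text \<open>Integrating \<open>exp (- z * t)\<close> over all \<open>y < z\<close> yields \<open>z * exp (- z * t)\<close>.\<close>

lemma nn_integral_tail_mass:
  assumes t: "0 \<le> t"
  shows "(\<integral>\<^sup>+y. ennreal (laplace P t - g_minus P t y) * indicator {0..} y \<partial>lborel) = ennreal (moment 1 t)"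
proof -
  have 1: "ennreal (laplace P t - g_minus P t y) * indicator {0..} y =
     (\<integral>\<^sup>+z. ennreal (exp (- z * t)) * indicator {(y, z). 0 \<le> y \<and> y < z} (y, z) \<partial>P)" for y
  proof (cases "0 \<le> y")
    case True
    have "ennreal (laplace P t - g_minus P t y) = ennreal (\<integral>z. indicator {y<..} z *\<^sub>R exp (- z * t) \<partial>P)"
      using g_plus_eq[OF t True] by (simp add: g_plus_def set_lebesgue_integral_def)
    also have "\<dots> = (\<integral>\<^sup>+z. ennreal (indicator {y<..} z *\<^sub>R exp (- z * t)) \<partial>P)"
      by (intro nn_integral_eq_integral[symmetric] integrable_exp_indicator t) auto
    also have "\<dots> = (\<integral>\<^sup>+z. ennreal (exp (- z * t)) * indicator {(y, z). 0 \<le> y \<and> y < z} (y, z) \<partial>P)"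
      using True by (intro nn_integral_cong) (auto simp: indicator_def)
    finally show ?thesis using True by simp
  qed (simp add: indicator_def)
  interpret pair_sigma_finite lborel P ..
  have "(\<integral>\<^sup>+y. ennreal (laplace P t - g_minus P t y) * indicator {0..} y \<partial>lborel) =
    (\<integral>\<^sup>+z. (\<integral>\<^sup>+y. ennreal (exp (- z * t)) * indicator {(y, z). 0 \<le> y \<and> y < z} (y, z) \<partial>lborel) \<partial>P)"
    unfolding 1
  proof (rule Fubini'[symmetric])
    show "(\<lambda>(y, z). ennreal (exp (- z * t)) * indicator {(y, z). 0 \<le> y \<and> y < z} (y, z)) \<in>
       borel_measurable (lborel \<Otimes>\<^sub>M P)"
    proof -
      have s: "sets (lborel \<Otimes>\<^sub>M P) = sets (borel \<Otimes>\<^sub>M borel)" by (intro sets_pair_measure_cong) auto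
      show ?thesis unfolding measurable_cong_sets[OF s refl] by measurable
    qed
  qed
  also have "\<dots> = (\<integral>\<^sup>+z. ennreal (z * exp (- t * z)) \<partial>P)"
  proof (rule nn_integral_cong_AE)
    show "AE z in P. (\<integral>\<^sup>+y. ennreal (exp (- z * t)) * indicator {(y, z). 0 \<le> y \<and> y < z} (y, z) \<partial>lborel) =
        ennreal (z * exp (- t * z))"
      using AE_nonneg
    proof eventually_elim
      case (elim z)
      have "(\<integral>\<^sup>+y. ennreal (exp (- z * t)) * indicator {(y, z). 0 \<le> y \<and> y < z} (y, z) \<partial>lborel) =
        (\<integral>\<^sup>+y. ennreal (exp (- z * t)) * indicator {0..<z} y \<partial>lborel)"
        by (intro nn_integral_cong) (auto simp: indicator_def)
      also have "\<dots> = ennreal (exp (- z * t)) * ennreal z"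
        using elim by (simp add: nn_integral_cmult)
      finally show ?case using elim by (simp add: mult.commute flip: ennreal_mult)
    qed
  qed
  also have "\<dots> = ennreal (moment 1 t)"
    using integrable_moment[of t 1] t AE_nonneg
    by (subst nn_integral_eq_integral) (auto simp: moment_def elim!: eventually_mono)
  finally show ?thesis .
qed

lemma boundary_width_start:
  assumes "boundary_case gt \<beta>" "0 \<le> t" "0 \<le> y"
  shows "\<beta> t (1 - laplace P t) y = laplace P t - g_minus P t y"
  using assms g_minus_le[of t y] g_minus_nonneg[of t y]
  by (auto simp: boundary_case_def width_minus_def width_plus_def)

lemma boundary_mass:
  assumes "boundary_case gt \<beta>" "0 \<le> t"
  shows "(\<integral>\<^sup>+x. ennreal (gt t x) * indicator {1 - laplace P t<..<1} x \<partial>lborel) = ennreal (moment 1 t)"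
proof -
  have "1 - laplace P t \<le> 1" using laplace_gt[OF assms(2)] measure_nonneg[of P "{0}"] by linarith
  then have "(\<integral>\<^sup>+x. ennreal (gt t x) * indicator {1 - laplace P t<..<1} x \<partial>lborel) =
      (\<integral>\<^sup>+y. ennreal (\<beta> t (1 - laplace P t) y) * indicator {0..} y \<partial>lborel)"
    by (intro boundary_layer_cake[OF assms]) auto
  also have "\<dots> = (\<integral>\<^sup>+y. ennreal (laplace P t - g_minus P t y) * indicator {0..} y \<partial>lborel)"
    using boundary_width_start[OF assms] by (intro nn_integral_cong) (auto simp: indicator_def)
  finally show ?thesis using nn_integral_tail_mass[OF assms(2)] by simp
qed

lemma dens_measurable:
  assumes bc: "boundary_case gt \<beta>" and t: "0 \<le> t"
  shows "dens P gt t \<in> borel_measurable borel"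
proof -
  let ?c = "1 - laplace P t"
  have c: "?c \<le> 1" using laplace_gt[OF t] measure_nonneg[of P "{0}"] by linarith
  note [measurable] = boundary_layer_cake(1)[OF bc t order_refl c]
  have "(\<lambda>x. indicator {0..?c} x * dens_inf P x + (1 / \<mu>) * (indicator {?c<..<1} x * gt t x)) \<in> borel_measurable borel"
    by measurable
  then show ?thesis
    by (rule measurable_discrete_difference[where X = "{?c, 1}"])
       (auto simp: dens_def mean(1)[symmetric] indicator_def)
qed

text \<open>The two indicators in the density overlap in one point only.\<close>

lemma emeasure_law:
  assumes bc: "boundary_case gt \<beta>" and t: "0 \<le> t" and A: "A \<in> sets borel"
  shows "emeasure (density lborel (\<lambda>x. ennreal (dens P gt t x))) A =
     emeasure law_inf (A \<inter> {0..1 - laplace P t}) +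
     ennreal (1 / \<mu>) * (\<integral>\<^sup>+x. ennreal (gt t x) * indicator ({1 - laplace P t<..<1} \<inter> A) x \<partial>lborel)"
proof -
  let ?c = "1 - laplace P t"
  have c: "?c \<le> 1" using laplace_gt[OF t] measure_nonneg[of P "{0}"] by linarith
  note [measurable] = dens_measurable[OF bc t] A
  have gm: "(\<lambda>x. ennreal (gt t x) * indicator ({?c<..<1} \<inter> A) x) \<in> borel_measurable borel"
  proof -
    note [measurable] = boundary_layer_cake(1)[OF bc t order_refl c]
    have "(\<lambda>x. ennreal (indicator {?c<..<1} x * gt t x) * indicator A x) \<in> borel_measurable borel" by measurable
    moreover have "(\<lambda>x. ennreal (indicator {?c<..<1} x * gt t x) * indicator A x) =
        (\<lambda>x. ennreal (gt t x) * indicator ({?c<..<1} \<inter> A) x)"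
      by (auto simp: indicator_def fun_eq_iff)
    ultimately show ?thesis by simp
  qed
  have "emeasure (density lborel (\<lambda>x. ennreal (dens P gt t x))) A =
      (\<integral>\<^sup>+x. ennreal (dens P gt t x) * indicator A x \<partial>lborel)"
    by (subst emeasure_density) auto
  also have "\<dots> = (\<integral>\<^sup>+x. ennreal (dens_inf P x) * indicator (A \<inter> {0..?c}) x +
     ennreal (1 / \<mu>) * (ennreal (gt t x) * indicator ({?c<..<1} \<inter> A) x) \<partial>lborel)"
  proof (rule nn_integral_cong_AE)
    have "AE x in lborel. x \<notin> {?c, 1}"
      by (intro AE_not_in countable_imp_null_set_lborel) auto
    then show "AE x in lborel. ennreal (dens P gt t x) * indicator A x =
       ennreal (dens_inf P x) * indicator (A \<inter> {0..?c}) x +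
       ennreal (1 / \<mu>) * (ennreal (gt t x) * indicator ({?c<..<1} \<inter> A) x)"
    proof eventually_elim
      case (elim x)
      show ?case using elim mean_pos
        by (auto simp: dens_def mean(1)[symmetric] indicator_def simp flip: ennreal_mult')
    qed
  qed
  also have "\<dots> = (\<integral>\<^sup>+x. ennreal (dens_inf P x) * indicator (A \<inter> {0..?c}) x \<partial>lborel) +
     ennreal (1 / \<mu>) * (\<integral>\<^sup>+x. ennreal (gt t x) * indicator ({?c<..<1} \<inter> A) x \<partial>lborel)"
    using gm by (subst nn_integral_add) (auto simp: nn_integral_cmult)
  finally show ?thesis using A by (simp add: emeasure_density)
qed

lemma emeasure_law_inf_atMost:
  assumes "0 \<le> s" shows "emeasure law_inf {0..1 - laplace P s} = ennreal (1 - moment 1 s / \<mu>)"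
proof (cases "s = 0")
  case True
  then show ?thesis using emeasure_law_inf_null[of "{0}"] mean_pos by (simp del: One_nat_def)
next
  case False
  have "{0..1 - laplace P s} = {0} \<union> {0<..1 - laplace P s}" using laplace_le_1[OF assms] by auto
  then have "emeasure law_inf {0..1 - laplace P s} = emeasure law_inf {0} + emeasure law_inf {0<..1 - laplace P s}"
    by (simp only:) (intro plus_emeasure[symmetric], auto)
  then show ?thesis
    using emeasure_law_inf_null[of "{0}"] emeasure_law_inf_greaterThanAtMost[of s] False assms by simp
qed

lemma emeasure_law_inf_lessThan_0: "emeasure law_inf {..<0} = 0"
proof -
  have "(\<integral>\<^sup>+x. ennreal (dens_inf P x) * indicator {..<0} x \<partial>lborel) = (\<integral>\<^sup>+x. 0 \<partial>(lborel :: real measure))"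
    by (intro nn_integral_cong) (auto simp: dens_inf_outside indicator_def)
  then show ?thesis by (simp add: emeasure_density)
qed

sublocale law_inf: prob_space law_inf
  using emeasure_law_inf_UNIV by (intro prob_spaceI) simp

lemma moment_1_le: assumes "0 \<le> s" shows "moment 1 s \<le> \<mu>"
  unfolding mean moment_def
proof (rule integral_mono_AE)
  show "AE x in P. x ^ 1 * exp (- s * x) \<le> x"
    using AE_nonneg by eventually_elim (use assms in \<open>auto intro!: mult_left_le\<close>)
qed (use integrable_moment[of s 1] assms finite_mean in auto)

lemma measure_law_inf_greaterThan:
  assumes "0 \<le> s" shows "measure law_inf {1 - laplace P s<..} = moment 1 s / \<mu>"
proof -
  have "measure law_inf {0..1 - laplace P s} = 1 - moment 1 s / \<mu>"
    using emeasure_law_inf_atMost[OF assms] moment_1_le[OF assms] mean_pos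
    by (simp add: measure_def)
  moreover have "measure law_inf ({..<0} \<union> {0..1 - laplace P s}) =
      measure law_inf {..<0} + measure law_inf {0..1 - laplace P s}"
    by (intro law_inf.finite_measure_Union) auto
  moreover have "measure law_inf {..<0} = 0" using emeasure_law_inf_lessThan_0 by (simp add: measure_def)
  moreover have "measure law_inf (space law_inf - ({..<0} \<union> {0..1 - laplace P s})) =
      1 - measure law_inf ({..<0} \<union> {0..1 - laplace P s})"
    by (intro law_inf.prob_compl) auto
  moreover have "space law_inf - ({..<0} \<union> {0..1 - laplace P s}) = {1 - laplace P s<..}"
    using laplace_le_1[OF assms] by auto
  ultimately show ?thesis by simp
qed

abbreviation "law gt t \<equiv> density lborel (\<lambda>x. ennreal (dens P gt t x))"

context
  fixes gt :: "real \<Rightarrow> real \<Rightarrow> real" and \<beta> :: "real \<Rightarrow> real \<Rightarrow> real \<Rightarrow> real" and t :: real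
  assumes bc: "boundary_case gt \<beta>" and t: "0 \<le> t"
begin

lemma emeasure_law_greaterThan:
  assumes "1 - laplace P t \<le> a" "a \<le> 1"
  shows "emeasure (law gt t) {a<..} = ennreal (1 / \<mu>) * (\<integral>\<^sup>+y. ennreal (\<beta> t a y) * indicator {0..} y \<partial>lborel)"
proof -
  have "{1 - laplace P t<..<1} \<inter> {a<..} = {a<..<1}" "{a<..} \<inter> {0..1 - laplace P t} = {}"
    using assms by auto
  then show ?thesis
    using emeasure_law[OF bc t, of "{a<..}"] boundary_layer_cake(2)[OF bc t assms] by simp
qed

lemma emeasure_law_tail: "emeasure (law gt t) {1 - laplace P t<..} = ennreal (moment 1 t / \<mu>)"
proof -
  have "{1 - laplace P t<..<1} \<inter> {1 - laplace P t<..} = {1 - laplace P t<..<1}"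
    "{1 - laplace P t<..} \<inter> {0..1 - laplace P t} = {}" by auto
  then show ?thesis
    using emeasure_law[OF bc t, of "{1 - laplace P t<..}"] boundary_mass[OF bc t] mean_pos moment_pos[of t 1] t
    by (simp add: ennreal_mult''[symmetric])
qed

lemma emeasure_law_below:
  assumes "A \<in> sets borel" "A \<subseteq> {..1 - laplace P t}"
  shows "emeasure (law gt t) A = emeasure law_inf (A \<inter> {0..1 - laplace P t})"
proof -
  have "{1 - laplace P t<..<1} \<inter> A = {}" using assms(2) by auto
  then show ?thesis using emeasure_law[OF bc t assms(1)] by simp
qed

lemma emeasure_law_UNIV: "emeasure (law gt t) UNIV = 1"
proof -
  have "emeasure (law gt t) ({..1 - laplace P t} \<union> {1 - laplace P t<..}) =
      emeasure (law gt t) {..1 - laplace P t} + emeasure (law gt t) {1 - laplace P t<..}"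
    by (intro plus_emeasure[symmetric]) auto
  moreover have "{..1 - laplace P t} \<union> {1 - laplace P t<..} = UNIV" by auto
  moreover have "{..1 - laplace P t} \<inter> {0..1 - laplace P t} = {0..1 - laplace P t}" by auto
  ultimately have "emeasure (law gt t) UNIV = ennreal (1 - moment 1 t / \<mu>) + ennreal (moment 1 t / \<mu>)"
    using emeasure_law_below[of "{..1 - laplace P t}"] emeasure_law_inf_atMost[OF t] emeasure_law_tail by simp
  also have "\<dots> = 1"
    using moment_1_le[OF t] mean_pos moment_pos[of t 1] t by (subst ennreal_plus[symmetric]) auto
  finally show ?thesis .
qed

lemma probability_density_dens: "probability_density (dens P gt t)"
  unfolding probability_density_def
proof (intro conjI)
  show "dens P gt t \<in> borel_measurable borel" by (rule dens_measurable[OF bc t])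
  have "AE x in lborel. x \<notin> {0, 1 - p0, 1 - laplace P t, 1}"
    by (intro AE_not_in countable_imp_null_set_lborel) auto
  then show "AE x in lborel. 0 \<le> dens P gt t x"
  proof eventually_elim
    case (elim x)
    then show ?case
      using dens_inf_nonneg[of x] boundary_case_nonneg[OF bc t, of x] mean_pos
      by (auto simp: dens_def mean(1)[symmetric] indicator_def)
  qed
  show "(\<integral>\<^sup>+x. ennreal (dens P gt t x) \<partial>lborel) = 1"
    using emeasure_law_UNIV dens_measurable[OF bc t] by (simp add: emeasure_density)
qed

lemma prob_space_law: "prob_space (law gt t)"
  using emeasure_law_UNIV by (intro prob_spaceI) simp

lemma measure_law_tail: "measure (law gt t) {1 - laplace P t<..} = moment 1 t / \<mu>"
  using emeasure_law_tail moment_pos[of t 1] t mean_pos by (simp add: measure_def)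

text \<open>Both laws agree below \<open>1 - laplace P t\<close>, and both give the mass \<open>moment 1 t / \<mu>\<close> to what is above.\<close>

lemma tv_law_le: "tv_norm_diff (law gt t) law_inf \<le> 2 * (moment 1 t / \<mu>)"
proof -
  interpret L: prob_space "law gt t" by (rule prob_space_law)
  let ?B = "{1 - laplace P t<..}"
  have "(SUP A\<in>sets (law gt t). \<bar>measure (law gt t) A - measure law_inf A\<bar>) \<le> moment 1 t / \<mu>"
  proof (rule cSUP_least)
    fix A assume "A \<in> sets (law gt t)"
    then have A: "A \<in> sets borel" by simp
    note split = L.measure_split[of A ?B] law_inf.measure_split[of A ?B]
    have "emeasure law_inf (A - ?B) = emeasure law_inf ((A - ?B) \<inter> {0..1 - laplace P t})"
    proof (rule emeasure_eq_AE)
      have "{..<0} \<in> null_sets law_inf" using emeasure_law_inf_lessThan_0 by (simp add: null_sets_def)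
      then have "AE x in law_inf. x \<notin> {..<0}" by (rule AE_not_in)
      then show "AE x in law_inf. x \<in> A - ?B \<longleftrightarrow> x \<in> (A - ?B) \<inter> {0..1 - laplace P t}"
        by eventually_elim auto
    qed (use A in auto)
    also have "\<dots> = emeasure (law gt t) (A - ?B)" using A by (intro emeasure_law_below[symmetric]) auto
    finally have eq: "measure law_inf (A - ?B) = measure (law gt t) (A - ?B)" by (simp add: measure_def)
    have 1: "measure (law gt t) (A \<inter> ?B) \<le> moment 1 t / \<mu>"
      unfolding measure_law_tail[symmetric] using A by (intro L.finite_measure_mono) auto
    have 2: "measure law_inf (A \<inter> ?B) \<le> moment 1 t / \<mu>"
      unfolding measure_law_inf_greaterThan[OF t, symmetric] using A by (intro law_inf.finite_measure_mono) auto
    show "\<bar>measure (law gt t) A - measure law_inf A\<bar> \<le> moment 1 t / \<mu>"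
    proof -
      have "0 \<le> measure (law gt t) (A \<inter> ?B)" "0 \<le> measure law_inf (A \<inter> ?B)" by simp_all
      moreover have "measure (law gt t) A = measure (law gt t) (A - ?B) + measure (law gt t) (A \<inter> ?B)"
        "measure law_inf A = measure law_inf (A - ?B) + measure law_inf (A \<inter> ?B)"
        using split A by simp_all
      ultimately show ?thesis using eq 1 2 by linarith
    qed
  qed auto
  then show ?thesis by (simp add: tv_norm_diff_def)
qed

lemma cdf_law_below:
  assumes "0 \<le> s" "s \<le> t" shows "cdf (law gt t) (1 - laplace P s) = 1 - moment 1 s / \<mu>"
proof -
  have le: "laplace P t \<le> laplace P s" using laplace_mono assms by simp
  have "emeasure (law gt t) {..1 - laplace P s} = emeasure law_inf ({..1 - laplace P s} \<inter> {0..1 - laplace P t})"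
    using le by (intro emeasure_law_below) auto
  also have "{..1 - laplace P s} \<inter> {0..1 - laplace P t} = {0..1 - laplace P s}" using le by auto
  also have "emeasure law_inf \<dots> = ennreal (1 - moment 1 s / \<mu>)" by (rule emeasure_law_inf_atMost[OF assms(1)])
  finally show ?thesis using moment_1_le[OF assms(1)] mean_pos by (simp add: cdf_def measure_def)
qed

lemma cdf_law_above:
  assumes "1 - laplace P t \<le> a" "a \<le> 1"
  shows "ennreal (1 - cdf (law gt t) a) = ennreal (1 / \<mu>) * (\<integral>\<^sup>+y. ennreal (\<beta> t a y) * indicator {0..} y \<partial>lborel)"
proof -
  interpret L: prob_space "law gt t" by (rule prob_space_law)
  have "measure (law gt t) (space (law gt t) - {..a}) = 1 - measure (law gt t) {..a}"
    by (intro L.prob_compl) auto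
  moreover have "space (law gt t) - {..a} = {a<..}" by auto
  ultimately have "1 - cdf (law gt t) a = measure (law gt t) {a<..}" by (simp add: cdf_def)
  then show ?thesis using emeasure_law_greaterThan[OF assms] by (simp add: L.emeasure_eq_measure)
qed

end

end

section \<open>Averages over the normalized weights\<close>

locale request_sequence = mean_law P \<mu> for P \<mu> +
  fixes M :: "nat \<Rightarrow> 'a measure" and w :: "nat \<Rightarrow> nat \<Rightarrow> 'a \<Rightarrow> real"
    and \<pi> :: "nat \<Rightarrow> nat \<Rightarrow> nat" and T :: "nat \<Rightarrow> nat \<Rightarrow> 'a \<Rightarrow> real set"
  assumes chain: "\<And>n. move_to_front_chain (M n) n (w n) (\<pi> n) (T n)"
    and LLN: "LLN P M w"
begin

sublocale c: move_to_front_chain "M n" n "w n" "\<pi> n" "T n" for n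
  by (rule chain)

text \<open>The popularities normalized to have mean \<open>\<mu>\<close>, unless all of them vanish.\<close>

definition scaled :: "nat \<Rightarrow> nat \<Rightarrow> 'a \<Rightarrow> real" where
  "scaled n i \<omega> = real n * \<mu> * c.pop n i \<omega>"

definition avg :: "nat \<Rightarrow> (real \<Rightarrow> real) \<Rightarrow> 'a \<Rightarrow> real" where
  "avg n f \<omega> = (1 / real n) * (\<Sum>i\<in>{1..n}. f (scaled n i \<omega>))"

lemma scaled_nonneg: "i \<in> {1..n} \<Longrightarrow> \<omega> \<in> space (M n) \<Longrightarrow> 0 \<le> scaled n i \<omega>"
  unfolding scaled_def using c.pop_nonneg mean_pos by (intro mult_nonneg_nonneg) auto

lemma scaled_measurable: "i \<in> {1..n} \<Longrightarrow> scaled n i \<in> borel_measurable (M n)"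
  unfolding scaled_def by (intro borel_measurable_times borel_measurable_const c.pop_measurable)

lemma avg_measurable:
  assumes "f \<in> borel_measurable borel" shows "avg n f \<in> borel_measurable (M n)"
  unfolding avg_def
  by (intro borel_measurable_times borel_measurable_const borel_measurable_sum
      measurable_compose[OF scaled_measurable assms])

lemma avg_le:
  assumes "\<And>x. 0 \<le> x \<Longrightarrow> f x \<le> K" "0 \<le> K" "\<omega> \<in> space (M n)"
  shows "avg n f \<omega> \<le> K"
proof -
  have "(\<Sum>i\<in>{1..n}. f (scaled n i \<omega>)) \<le> (\<Sum>i\<in>{1..n}. K)"
    using assms scaled_nonneg by (intro sum_mono) auto
  then show ?thesis using assms(2) by (cases "n = 0") (auto simp: avg_def field_simps)
qed

lemma avg_abs_le:
  assumes "\<And>x. 0 \<le> x \<Longrightarrow> \<bar>f x\<bar> \<le> K" "\<omega> \<in> space (M n)"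
  shows "\<bar>avg n f \<omega>\<bar> \<le> K"
proof -
  have K: "0 \<le> K" using assms(1)[of 0] by simp
  have "\<bar>avg n f \<omega>\<bar> \<le> avg n (\<lambda>x. \<bar>f x\<bar>) \<omega>"
    unfolding avg_def abs_mult by (intro mult_mono sum_abs) auto
  also have "\<dots> \<le> K" using assms K by (intro avg_le) auto
  finally show ?thesis .
qed

lemma integrable_bounded:
  fixes f :: "'a \<Rightarrow> real"
  assumes "f \<in> borel_measurable (M n)" "\<And>\<omega>. \<omega> \<in> space (M n) \<Longrightarrow> \<bar>f \<omega>\<bar> \<le> K"
  shows "integrable (M n) f"
  by (rule c.integrable_const_bound[OF AE_I2 assms(1)]) (use assms(2) in simp)

lemma continuous_map_weak_integral:
  assumes "continuous_on UNIV f" "bounded (range f)"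
  shows "continuous_map weak_topology euclideanreal (\<lambda>Q. \<integral>x. f x \<partial>Q)"
  unfolding continuous_map_def topspace_weak_topology
proof (intro conjI allI impI)
  fix U assume "openin euclideanreal (U :: real set)"
  then have "open U" by simp
  then show "openin weak_topology {Q \<in> nonneg_distributions. (\<integral>x. f x \<partial>Q) \<in> U}"
    unfolding weak_topology_def using assms by (intro topology_generated_by_Basis) blast
qed auto

text \<open>Convergence in law of the empirical means to the constant \<open>\<mu>\<close> is used only through the bounded
  continuous function \<open>\<lambda>x. min 1 \<bar>x - \<mu>\<bar>\<close>.\<close>

lemma normalization_exists:
  obtains Z where "\<And>n. Z n \<in> borel_measurable (M n)" "\<And>n \<omega>. \<omega> \<in> space (M n) \<Longrightarrow> 0 < Z n \<omega>"
    "converges_in_law_to_const weak_topology M (\<lambda>n \<omega>. empirical_measure n (\<lambda>i. Z n \<omega> * w n i \<omega>)) P"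
    "(\<lambda>n. c.expectation n (\<lambda>\<omega>. min 1 \<bar>(1 / real n) * (\<Sum>i\<in>{1..n}. Z n \<omega> * w n i \<omega>) - \<mu>\<bar>)) \<longlonglongrightarrow> 0"
proof -
  obtain Z where Z: "\<forall>n. Z n \<in> borel_measurable (M n) \<and> (\<forall>\<omega>\<in>space (M n). 0 < Z n \<omega>)"
    and emp: "converges_in_law_to_const weak_topology M
          (\<lambda>n \<omega>. empirical_measure n (\<lambda>i. Z n \<omega> * w n i \<omega>)) P"
    and conv: "weak_conv_m
          (\<lambda>n. distr (M n) borel (\<lambda>\<omega>. (1 / real n) * (\<Sum>i\<in>{1..n}. Z n \<omega> * w n i \<omega>)))
          (return borel \<mu>)"
    using LLN unfolding LLN_def mean(1)[symmetric] by blast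
  let ?m = "\<lambda>n \<omega>. (1 / real n) * (\<Sum>i\<in>{1..n}. Z n \<omega> * w n i \<omega>)"
  have m: "?m n \<in> borel_measurable (M n)" for n
    using Z by (intro borel_measurable_times borel_measurable_const borel_measurable_sum c.weights_measurable) auto
  have rd: "real_distribution (distr (M n) borel (?m n))" for n
    by (intro c.real_distribution_distr m)
  have rr: "real_distribution (return borel \<mu>)"
    by (simp add: real_distribution_def real_distribution_axioms_def prob_space_return)
  have "(\<lambda>n. integral\<^sup>L (distr (M n) borel (?m n)) (\<lambda>x. min 1 \<bar>x - \<mu>\<bar>)) \<longlonglongrightarrow>
      integral\<^sup>L (return borel \<mu>) (\<lambda>x. min 1 \<bar>x - \<mu>\<bar>)"
    by (rule weak_conv_imp_integral_bdd_continuous_conv[OF rd rr conv, where B = 1])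
       (auto intro!: continuous_intros)
  moreover have "integral\<^sup>L (distr (M n) borel (?m n)) (\<lambda>x. min 1 \<bar>x - \<mu>\<bar>) =
      c.expectation n (\<lambda>\<omega>. min 1 \<bar>?m n \<omega> - \<mu>\<bar>)" for n
    using m by (subst integral_distr) auto
  moreover have "integral\<^sup>L (return borel \<mu>) (\<lambda>x. min 1 \<bar>x - \<mu>\<bar>) = 0"
    by (subst integral_return) auto
  ultimately have "(\<lambda>n. c.expectation n (\<lambda>\<omega>. min 1 \<bar>?m n \<omega> - \<mu>\<bar>)) \<longlonglongrightarrow> 0" by simp
  then show ?thesis using that Z emp by blast
qed

text \<open>If all weights vanish, their mean is at distance \<open>\<mu>\<close> from its limit, whatever the normalization.\<close>

lemma zero_weights_vanish: "(\<lambda>n. c.prob n {\<omega>\<in>space (M n). \<not> c.positive_weight n \<omega>}) \<longlonglongrightarrow> 0"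
proof -
  obtain Z where Z: "\<And>n. Z n \<in> borel_measurable (M n)" "\<And>n \<omega>. \<omega> \<in> space (M n) \<Longrightarrow> 0 < Z n \<omega>"
    and "converges_in_law_to_const weak_topology M (\<lambda>n \<omega>. empirical_measure n (\<lambda>i. Z n \<omega> * w n i \<omega>)) P"
    and lim: "(\<lambda>n. c.expectation n (\<lambda>\<omega>. min 1 \<bar>(1 / real n) * (\<Sum>i\<in>{1..n}. Z n \<omega> * w n i \<omega>) - \<mu>\<bar>)) \<longlonglongrightarrow> 0"
    (is "(\<lambda>n. c.expectation n (?g n)) \<longlonglongrightarrow> 0")
    by (rule normalization_exists, rule that)
  have c: "0 < min 1 \<mu>" using mean_pos by simp
  have gm: "?g n \<in> borel_measurable (M n)" for n
    using Z by (intro borel_measurable_min borel_measurable_abs borel_measurable_diff borel_measurable_times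
        borel_measurable_const borel_measurable_sum c.weights_measurable) auto
  have le: "c.prob n {\<omega>\<in>space (M n). \<not> c.positive_weight n \<omega>} \<le> c.expectation n (?g n) / min 1 \<mu>" for n
  proof -
    define B where "B = {\<omega>\<in>space (M n). \<not> c.positive_weight n \<omega>}"
    have B: "B \<in> sets (M n)"
      unfolding B_def using pred_intros_logic(2)[OF c.positive_weight_measurable[of n]] unfolding pred_def .
    have "min 1 \<mu> * c.prob n B = c.expectation n (\<lambda>\<omega>. min 1 \<mu> * indicator B \<omega>)"
      using B by simp
    also have "\<dots> \<le> c.expectation n (?g n)"
    proof (rule integral_mono)
      show "integrable (M n) (?g n)" by (rule integrable_bounded[OF gm, of _ 1]) auto
      show "integrable (M n) (\<lambda>\<omega>. min 1 \<mu> * indicator B \<omega>)"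
        using B by (intro integrable_bounded[where K = 1]) (auto simp: indicator_def mean_pos less_imp_le)
      fix \<omega> assume \<omega>: "\<omega> \<in> space (M n)"
      show "min 1 \<mu> * indicator B \<omega> \<le> ?g n \<omega>"
      proof (cases "\<omega> \<in> B")
        case True
        then have "(\<Sum>i\<in>{1..n}. w n i \<omega>) = 0" by (simp add: B_def c.positive_weight_def)
        then have "(\<Sum>i\<in>{1..n}. Z n \<omega> * w n i \<omega>) = 0" by (simp only: sum_distrib_left[symmetric] mult_zero_right)
        then show ?thesis using True mean_pos by simp
      qed simp
    qed
    finally show ?thesis using c by (simp add: B_def pos_le_divide_eq mult.commute)
  qed
  show ?thesis
  proof (rule tendsto_sandwich[OF _ _ tendsto_const])
    show "(\<lambda>n. c.expectation n (?g n) / min 1 \<mu>) \<longlonglongrightarrow> 0"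
      using tendsto_divide[OF lim tendsto_const[of "min 1 \<mu>"]] c by simp
  qed (auto intro!: always_eventually le[simplified])
qed

text \<open>The normalized weights \<open>z * w n i \<omega>\<close> and \<open>scaled n i \<omega>\<close> differ by the factor \<open>\<mu> / m\<close>. Hence their mean
  distance is \<open>\<bar>m - \<mu>\<bar>\<close>, which the Lipschitz constant carries over to \<open>f\<close>; the bound \<open>2 * K\<close> serves when
  this distance is large.\<close>

lemma normalized_average_close:
  assumes \<omega>: "\<omega> \<in> space (M n)" and n: "0 < n" and z: "0 < (z :: real)"
    and bd: "\<And>x. 0 \<le> x \<Longrightarrow> \<bar>f x\<bar> \<le> K" and lip: "\<And>x y. 0 \<le> x \<Longrightarrow> 0 \<le> y \<Longrightarrow> \<bar>f x - f y\<bar> \<le> L * \<bar>x - y\<bar>"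
    and L: "0 \<le> L"
  defines "m \<equiv> (1 / real n) * (\<Sum>i\<in>{1..n}. z * w n i \<omega>)"
  shows "\<bar>avg n f \<omega> - (1 / real n) * (\<Sum>i\<in>{1..n}. f (z * w n i \<omega>))\<bar> \<le> max (2 * K) L * min 1 \<bar>m - \<mu>\<bar>"
proof -
  define S where "S = (\<Sum>i\<in>{1..n}. w n i \<omega>)"
  have w0: "0 \<le> w n i \<omega>" if "i \<in> {1..n}" for i using c.weights_nonneg[OF that \<omega>] .
  have S0: "0 \<le> S" unfolding S_def by (intro sum_nonneg w0)
  have m: "m = z * S / real n" by (simp add: m_def S_def flip: sum_distrib_left)
  have K: "0 \<le> K" using bd[of 0] by simp
  have diff: "(\<Sum>i\<in>{1..n}. \<bar>scaled n i \<omega> - z * w n i \<omega>\<bar>) \<le> real n * \<bar>m - \<mu>\<bar>"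
  proof (cases "S = 0")
    case True
    then have "w n i \<omega> = 0" if "i \<in> {1..n}" for i
      using that w0 unfolding S_def by (subst (asm) sum_nonneg_eq_0_iff) auto
    then have "(\<Sum>i\<in>{1..n}. \<bar>scaled n i \<omega> - z * w n i \<omega>\<bar>) = 0"
      by (intro sum.neutral ballI) (simp add: scaled_def c.pop_def popularity_def)
    then show ?thesis by simp
  next
    case False
    then have Sp: "0 < S" using S0 by simp
    have "scaled n i \<omega> - z * w n i \<omega> = w n i \<omega> * (real n * (\<mu> - m) / S)" for i
      using Sp n unfolding scaled_def c.pop_def popularity_def S_def[symmetric] m by (simp add: field_simps)
    then have "(\<Sum>i\<in>{1..n}. \<bar>scaled n i \<omega> - z * w n i \<omega>\<bar>) = (\<Sum>i\<in>{1..n}. w n i \<omega> * \<bar>real n * (\<mu> - m) / S\<bar>)"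
      using w0 by (intro sum.cong refl) (simp add: abs_mult)
    also have "\<dots> = S * \<bar>real n * (\<mu> - m) / S\<bar>" unfolding S_def by (rule sum_distrib_right[symmetric])
    also have "\<dots> = real n * \<bar>m - \<mu>\<bar>" using Sp by (simp add: abs_mult abs_minus_commute)
    finally show ?thesis by simp
  qed
  have "\<bar>avg n f \<omega> - (1 / real n) * (\<Sum>i\<in>{1..n}. f (z * w n i \<omega>))\<bar> =
      (1 / real n) * \<bar>\<Sum>i\<in>{1..n}. f (scaled n i \<omega>) - f (z * w n i \<omega>)\<bar>"
    by (simp add: avg_def sum_subtractf abs_mult flip: right_diff_distrib diff_divide_distrib)
  also have "\<dots> \<le> (1 / real n) * (\<Sum>i\<in>{1..n}. \<bar>f (scaled n i \<omega>) - f (z * w n i \<omega>)\<bar>)"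
    by (intro mult_left_mono sum_abs) auto
  finally have 1: "\<bar>avg n f \<omega> - (1 / real n) * (\<Sum>i\<in>{1..n}. f (z * w n i \<omega>))\<bar> \<le>
      (1 / real n) * (\<Sum>i\<in>{1..n}. \<bar>f (scaled n i \<omega>) - f (z * w n i \<omega>)\<bar>)" .
  have arg0: "0 \<le> scaled n i \<omega>" "0 \<le> z * w n i \<omega>" if "i \<in> {1..n}" for i
    using scaled_nonneg[OF that \<omega>] w0[OF that] z by auto
  have "(\<Sum>i\<in>{1..n}. \<bar>f (scaled n i \<omega>) - f (z * w n i \<omega>)\<bar>) \<le> (\<Sum>i\<in>{1..n}. 2 * K)"
  proof (rule sum_mono)
    fix i assume i: "i \<in> {1..n}"
    show "\<bar>f (scaled n i \<omega>) - f (z * w n i \<omega>)\<bar> \<le> 2 * K"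
      using bd[OF arg0(1)[OF i]] bd[OF arg0(2)[OF i]] by linarith
  qed
  then have 2: "(1 / real n) * (\<Sum>i\<in>{1..n}. \<bar>f (scaled n i \<omega>) - f (z * w n i \<omega>)\<bar>) \<le> 2 * K"
    using n by (simp add: field_simps)
  have "(\<Sum>i\<in>{1..n}. \<bar>f (scaled n i \<omega>) - f (z * w n i \<omega>)\<bar>) \<le> (\<Sum>i\<in>{1..n}. L * \<bar>scaled n i \<omega> - z * w n i \<omega>\<bar>)"
    using lip arg0 by (intro sum_mono) auto
  also have "\<dots> \<le> L * (real n * \<bar>m - \<mu>\<bar>)"
    unfolding sum_distrib_left[symmetric] by (intro mult_left_mono diff L)
  finally have 3: "(1 / real n) * (\<Sum>i\<in>{1..n}. \<bar>f (scaled n i \<omega>) - f (z * w n i \<omega>)\<bar>) \<le> L * \<bar>m - \<mu>\<bar>"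
    using n by (simp add: field_simps)
  show ?thesis
  proof (cases "\<bar>m - \<mu>\<bar> \<le> 1")
    case True
    have "L * \<bar>m - \<mu>\<bar> \<le> max (2 * K) L * \<bar>m - \<mu>\<bar>" by (intro mult_right_mono) auto
    then show ?thesis using 1 3 True by (simp add: min_def)
  next
    case False
    then show ?thesis using 1 2 by (simp add: min_def)
  qed
qed

text \<open>The map \<open>\<lambda>Q. \<bar>(\<integral>x. f x \<partial>Q) - (\<integral>x. f x \<partial>P)\<bar>\<close> is bounded and continuous for the weak topology and vanishes at \<open>P\<close>, so
  its expectation at the empirical measures tends to 0. The previous lemma exchanges the normalization.\<close>

lemma average_converges:
  assumes f: "f \<in> borel_measurable borel" and bd: "\<And>x. 0 \<le> x \<Longrightarrow> \<bar>f x\<bar> \<le> K"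
    and lip: "\<And>x y. 0 \<le> x \<Longrightarrow> 0 \<le> y \<Longrightarrow> \<bar>f x - f y\<bar> \<le> L * \<bar>x - y\<bar>" and L: "0 \<le> L"
  shows "(\<lambda>n. c.expectation n (\<lambda>\<omega>. \<bar>avg n f \<omega> - (\<integral>x. f x \<partial>P)\<bar>)) \<longlonglongrightarrow> 0"
proof -
  obtain Z where Z: "\<And>n. Z n \<in> borel_measurable (M n)" "\<And>n \<omega>. \<omega> \<in> space (M n) \<Longrightarrow> 0 < Z n \<omega>"
    and emp: "converges_in_law_to_const weak_topology M (\<lambda>n \<omega>. empirical_measure n (\<lambda>i. Z n \<omega> * w n i \<omega>)) P"
    and lim: "(\<lambda>n. c.expectation n (\<lambda>\<omega>. min 1 \<bar>(1 / real n) * (\<Sum>i\<in>{1..n}. Z n \<omega> * w n i \<omega>) - \<mu>\<bar>)) \<longlonglongrightarrow> 0"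
    (is "(\<lambda>n. c.expectation n (?g n)) \<longlonglongrightarrow> 0")
    by (rule normalization_exists, rule that)
  (* test functions of the weak topology live on the whole line *)
  define f' where "f' x = f (max 0 x)" for x
  define I where "I = (\<integral>x. f x \<partial>P)"
  have f'bd: "\<bar>f' x\<bar> \<le> K" for x using bd[of "max 0 x"] by (simp add: f'_def)
  have f'lip: "\<bar>f' x - f' y\<bar> \<le> L * \<bar>x - y\<bar>" for x y
  proof -
    have "\<bar>f' x - f' y\<bar> \<le> L * \<bar>max 0 x - max 0 y\<bar>" unfolding f'_def by (intro lip) auto
    also have "\<dots> \<le> L * \<bar>x - y\<bar>" by (intro mult_left_mono L) auto
    finally show ?thesis .
  qed
  have cont: "continuous_on UNIV f'"
  proof (rule lipschitz_on_continuous_on[of L])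
    show "L-lipschitz_on UNIV f'" using f'lip L by (intro lipschitz_onI) (auto simp: dist_real_def)
  qed
  have f'm: "f' \<in> borel_measurable borel" using cont by (rule borel_measurable_continuous_onI)
  have I': "(\<integral>x. f' x \<partial>P) = I" unfolding I_def
  proof (rule integral_cong_AE)
    show "AE x in P. f' x = f x" using AE_nonneg by eventually_elim (simp add: f'_def max_def)
  qed (use f f'm in auto)
  have K: "0 \<le> K" using bd[of 0] by simp
  define F where "F Q = \<bar>(\<integral>x. f' x \<partial>Q) - I\<bar>" for Q :: "real measure"
  have rb: "bounded (range f')" using f'bd by (intro boundedI[of _ K]) auto
  have Fc: "continuous_map weak_topology euclideanreal F"
    unfolding F_def
    by (intro continuous_map_real_abs continuous_map_diff continuous_map_weak_integral cont rb) auto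
  have Fb: "bounded (F ` topspace weak_topology)"
  proof (rule boundedI[of _ "2 * K"])
    have bdQ: "\<bar>\<integral>x. f' x \<partial>Q\<bar> \<le> K" if "Q \<in> nonneg_distributions" for Q
    proof -
      interpret Q: real_distribution Q using that by (simp add: nonneg_distributions_def)
      have "\<bar>\<integral>x. f' x \<partial>Q\<bar> \<le> (\<integral>x. \<bar>f' x\<bar> \<partial>Q)" by (rule integral_abs_bound)
      also have "\<dots> \<le> (\<integral>x. K \<partial>Q)"
        using f'm f'bd K by (intro integral_mono Q.integrable_const_bound[where B = K]) auto
      finally show ?thesis using Q.prob_space by simp
    qed
    fix r assume "r \<in> F ` topspace weak_topology"
    then obtain Q where "Q \<in> nonneg_distributions" "r = F Q" by (auto simp: topspace_weak_topology)
    then show "norm r \<le> 2 * K" using bdQ[of Q] bdQ[OF P] unfolding F_def I'[symmetric] by simp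
  qed
  let ?e = "\<lambda>n \<omega>. (1 / real n) * (\<Sum>i\<in>{1..n}. f (Z n \<omega> * w n i \<omega>))"
  have em: "?e n \<in> borel_measurable (M n)" for n
    using Z f by (intro borel_measurable_times borel_measurable_const borel_measurable_sum
       measurable_compose[OF _ f] c.weights_measurable) auto
  have Fe: "F (empirical_measure n (\<lambda>i. Z n \<omega> * w n i \<omega>)) = \<bar>?e n \<omega> - I\<bar>"
    if \<omega>: "\<omega> \<in> space (M n)" for n \<omega>
  proof -
    have "(\<lambda>i. Z n \<omega> * w n i \<omega>) \<in> measurable (uniform_count_measure {1..n}) borel"
      by (simp add: measurable_def space_uniform_count_measure sets_uniform_count_measure)
    then have "(\<integral>x. f' x \<partial>empirical_measure n (\<lambda>i. Z n \<omega> * w n i \<omega>)) =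
       (\<integral>i. f' (Z n \<omega> * w n i \<omega>) \<partial>uniform_count_measure {1..n})"
      unfolding empirical_measure_def using f'm by (intro integral_distr)
    also have "\<dots> = (\<Sum>i\<in>{1..n}. f' (Z n \<omega> * w n i \<omega>)) / real n"
      by (subst integral_uniform_count_measure) auto
    also have "(\<Sum>i\<in>{1..n}. f' (Z n \<omega> * w n i \<omega>)) = (\<Sum>i\<in>{1..n}. f (Z n \<omega> * w n i \<omega>))"
      using c.weights_nonneg \<omega> Z(2)[OF \<omega>] by (intro sum.cong refl) (simp add: f'_def)
    finally show ?thesis by (simp add: F_def)
  qed
  have "(\<lambda>n. \<integral>\<omega>. F (empirical_measure n (\<lambda>i. Z n \<omega> * w n i \<omega>)) \<partial>M n) \<longlonglongrightarrow> F P"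
    using emp Fc Fb unfolding converges_in_law_to_const_def by blast
  moreover have "(\<integral>\<omega>. F (empirical_measure n (\<lambda>i. Z n \<omega> * w n i \<omega>)) \<partial>M n) =
      c.expectation n (\<lambda>\<omega>. \<bar>?e n \<omega> - I\<bar>)" for n
    by (intro Bochner_Integration.integral_cong refl Fe)
  moreover have "F P = 0" using I' by (simp add: F_def)
  ultimately have lim1: "(\<lambda>n. c.expectation n (\<lambda>\<omega>. \<bar>?e n \<omega> - I\<bar>)) \<longlonglongrightarrow> 0" by simp
  have gm: "?g n \<in> borel_measurable (M n)" for n
    using Z by (intro borel_measurable_min borel_measurable_abs borel_measurable_diff borel_measurable_times
        borel_measurable_const borel_measurable_sum c.weights_measurable) auto
  have ebd: "\<bar>?e n \<omega>\<bar> \<le> K" if \<omega>: "\<omega> \<in> space (M n)" for n \<omega>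
  proof -
    have "\<bar>\<Sum>i\<in>{1..n}. f (Z n \<omega> * w n i \<omega>)\<bar> \<le> (\<Sum>i\<in>{1..n}. K)"
      using c.weights_nonneg \<omega> Z(2)[OF \<omega>] by (intro order_trans[OF sum_abs] sum_mono bd) (auto intro: mult_nonneg_nonneg)
    then show ?thesis using K by (cases "n = 0") (auto simp: abs_mult field_simps)
  qed
  have le: "c.expectation n (\<lambda>\<omega>. \<bar>avg n f \<omega> - I\<bar>) \<le>
     c.expectation n (\<lambda>\<omega>. \<bar>?e n \<omega> - I\<bar>) + max (2 * K) L * c.expectation n (?g n)" if n: "0 < n" for n
  proof -
    have i1: "integrable (M n) (\<lambda>\<omega>. \<bar>?e n \<omega> - I\<bar>)"
    proof (rule integrable_bounded[where K = "K + \<bar>I\<bar>"])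
      fix \<omega> assume "\<omega> \<in> space (M n)"
      then have "\<bar>?e n \<omega>\<bar> \<le> K" by (rule ebd)
      then show "\<bar>\<bar>?e n \<omega> - I\<bar>\<bar> \<le> K + \<bar>I\<bar>" by linarith
    qed (intro borel_measurable_abs borel_measurable_diff em borel_measurable_const)
    have i2: "integrable (M n) (?g n)" by (rule integrable_bounded[OF gm, of _ 1]) auto
    have i3: "integrable (M n) (\<lambda>\<omega>. \<bar>avg n f \<omega> - I\<bar>)"
    proof (rule integrable_bounded[where K = "K + \<bar>I\<bar>"])
      fix \<omega> assume "\<omega> \<in> space (M n)"
      then have "\<bar>avg n f \<omega>\<bar> \<le> K" by (intro avg_abs_le bd)
      then show "\<bar>\<bar>avg n f \<omega> - I\<bar>\<bar> \<le> K + \<bar>I\<bar>" by linarith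
    qed (intro borel_measurable_abs borel_measurable_diff avg_measurable f borel_measurable_const)
    have "c.expectation n (\<lambda>\<omega>. \<bar>avg n f \<omega> - I\<bar>) \<le>
        c.expectation n (\<lambda>\<omega>. \<bar>?e n \<omega> - I\<bar> + max (2 * K) L * ?g n \<omega>)"
    proof (rule integral_mono)
      fix \<omega> assume \<omega>: "\<omega> \<in> space (M n)"
      have "\<bar>avg n f \<omega> - ?e n \<omega>\<bar> \<le> max (2 * K) L * ?g n \<omega>"
        by (rule normalized_average_close[OF \<omega> n Z(2)[OF \<omega>] bd lip L])
      then show "\<bar>avg n f \<omega> - I\<bar> \<le> \<bar>?e n \<omega> - I\<bar> + max (2 * K) L * ?g n \<omega>" by linarith
    qed (intro i3 Bochner_Integration.integrable_add i1 integrable_mult_right i2)+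
    also have "\<dots> = c.expectation n (\<lambda>\<omega>. \<bar>?e n \<omega> - I\<bar>) + max (2 * K) L * c.expectation n (?g n)"
      using i1 i2 by simp
    finally show ?thesis .
  qed
  show ?thesis unfolding I_def[symmetric]
  proof (rule tendsto_sandwich[OF _ _ tendsto_const])
    show "(\<lambda>n. c.expectation n (\<lambda>\<omega>. \<bar>?e n \<omega> - I\<bar>) + max (2 * K) L * c.expectation n (?g n)) \<longlonglongrightarrow> 0"
      using tendsto_add[OF lim1 tendsto_mult_left[OF lim, of "max (2 * K) L"]] by simp
    show "\<forall>\<^sub>F n in sequentially. c.expectation n (\<lambda>\<omega>. \<bar>avg n f \<omega> - I\<bar>) \<le>
       c.expectation n (\<lambda>\<omega>. \<bar>?e n \<omega> - I\<bar>) + max (2 * K) L * c.expectation n (?g n)"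
      using eventually_gt_at_top[of 0] by eventually_elim (rule le)
  qed (auto intro!: always_eventually integral_nonneg_AE)
qed

lemma average_exp_converges:
  assumes "0 \<le> s"
  shows "(\<lambda>n. c.expectation n (\<lambda>\<omega>. \<bar>avg n (\<lambda>x. exp (- s * x)) \<omega> - laplace P s\<bar>)) \<longlonglongrightarrow> 0"
  unfolding laplace_def
proof (rule average_converges[where K = 1 and L = s])
  fix x y :: real assume "0 \<le> x" "0 \<le> y"
  then show "\<bar>exp (- s * x) - exp (- s * y)\<bar> \<le> s * \<bar>x - y\<bar>"
    using exp_diff_le[of 0 x y s] assms by (simp add: mult.commute)
qed (use assms in auto)

lemma average_moment_1_converges:
  assumes "0 < s"
  shows "(\<lambda>n. c.expectation n (\<lambda>\<omega>. \<bar>avg n (\<lambda>x. x * exp (- s * x)) \<omega> - moment 1 s\<bar>)) \<longlonglongrightarrow> 0"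
proof -
  have "(\<lambda>n. c.expectation n (\<lambda>\<omega>. \<bar>avg n (\<lambda>x. x * exp (- s * x)) \<omega> - (\<integral>x. x * exp (- s * x) \<partial>P)\<bar>)) \<longlonglongrightarrow> 0"
  proof (rule average_converges[where K = "1 / s" and L = 1])
    fix x :: real assume x: "0 \<le> x"
    show "\<bar>x * exp (- s * x)\<bar> \<le> 1 / s" using power_exp_le[OF x assms, of 1] x by simp
  next
    fix x y :: real assume xy: "0 \<le> x" "0 \<le> y"
    have "norm (x * exp (- s * x) - y * exp (- s * y)) \<le> 1 * norm (x - y)"
    proof (rule field_differentiable_bound[where S = "{0..}" and f' = "\<lambda>x. (1 - s * x) * exp (- s * x)"])
      fix z :: real assume z: "z \<in> {0..}"
      show "((\<lambda>x. x * exp (- s * x)) has_field_derivative (1 - s * z) * exp (- s * z)) (at z within {0..})"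
        by (auto intro!: derivative_eq_intros simp: algebra_simps)
      have "\<bar>1 - s * z\<bar> \<le> exp (s * z)" using exp_ge_add_one_self[of "s * z"] z assms
        by (auto simp: abs_if intro: order_trans[of _ "1 + s * z"])
      then have "\<bar>1 - s * z\<bar> * exp (- s * z) \<le> exp (s * z) * exp (- s * z)" by (intro mult_right_mono) auto
      then show "norm ((1 - s * z) * exp (- s * z)) \<le> 1" by (simp add: abs_mult flip: exp_add)
    qed (use xy in auto)
    then show "\<bar>x * exp (- s * x) - y * exp (- s * y)\<bar> \<le> 1 * \<bar>x - y\<bar>" by simp
  qed auto
  then show ?thesis by (simp add: moment_def)
qed

end

section \<open>Objects requested in a recent window\<close>

lemma tendsto_null_bound:
  fixes f :: "nat \<Rightarrow> real"
  assumes f: "\<And>d. 0 < d \<Longrightarrow> \<exists>g. g \<longlonglongrightarrow> 0 \<and> (\<forall>\<^sub>F n in sequentially. \<bar>f n\<bar> \<le> C * d + g n)"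
    and C: "0 \<le> C"
  shows "f \<longlonglongrightarrow> 0"
proof (rule LIMSEQ_I)
  fix r :: real assume r: "0 < r"
  define d where "d = r / (2 * (C + 1))"
  have d: "0 < d" using r C by (simp add: d_def)
  have Cd: "C * d \<le> r / 2" using r C by (simp add: d_def field_simps)
  obtain g where g: "g \<longlonglongrightarrow> 0" "\<forall>\<^sub>F n in sequentially. \<bar>f n\<bar> \<le> C * d + g n" using f[OF d] by blast
  have "\<forall>\<^sub>F n in sequentially. g n < r / 2" using g(1) r by (intro order_tendstoD(2)) auto
  with g(2) have "\<forall>\<^sub>F n in sequentially. norm (f n - 0) < r"
    by eventually_elim (use Cd in auto)
  then show "\<exists>no. \<forall>n\<ge>no. norm (f n - 0) < r" by (simp add: eventually_sequentially)
qed

locale sorted_request_sequence = request_sequence P \<mu> M w \<pi> T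
  for P \<mu> and M :: "nat \<Rightarrow> 'a measure" and w \<pi> T +
  fixes gt :: "real \<Rightarrow> real \<Rightarrow> real" and \<beta> :: "real \<Rightarrow> real \<Rightarrow> real \<Rightarrow> real" and t :: real
  assumes initial: "\<And>n i. i \<in> {1..n} \<Longrightarrow> \<pi> n i = i"
    and sorted: "gt = g_tilde_minus P \<and> \<beta> = width_minus \<and>
       (\<forall>n. AE \<omega> in M n. \<forall>i\<in>{1..n}. \<forall>j\<in>{1..n}. i \<le> j \<longrightarrow> w n j \<omega> \<le> w n i \<omega>) \<or>
       gt = g_tilde_plus P \<and> \<beta> = width_plus \<and>
       (\<forall>n. AE \<omega> in M n. \<forall>i\<in>{1..n}. \<forall>j\<in>{1..n}. i \<le> j \<longrightarrow> w n i \<omega> \<le> w n j \<omega>)"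
    and t_pos: "0 < t"
begin

lemma bc: "boundary_case gt \<beta>"
  using sorted by (auto simp: boundary_case_def)

lemma t_nonneg: "0 \<le> t" using t_pos by simp

abbreviation "time n \<equiv> real n * \<mu> * t"

lemma time_nonneg: "0 \<le> time n" using mean_pos t_pos by simp

abbreviation (input) "cfg n \<omega> \<equiv> (\<lambda>i. T n i \<omega>)"

definition hits :: "nat \<Rightarrow> real \<Rightarrow> 'a \<Rightarrow> nat set" where
  "hits n s \<omega> = requested_in n (cfg n \<omega>) (real n * \<mu> * (t - s)) (time n)"

lemma start_bounds:
  assumes "0 \<le> s" "s \<le> t"
  shows "0 \<le> real n * \<mu> * (t - s)" "real n * \<mu> * (t - s) \<le> time n"
    "time n - real n * \<mu> * (t - s) = real n * \<mu> * s"
proof -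
  show "0 \<le> real n * \<mu> * (t - s)" using assms mean_pos by simp
  show "real n * \<mu> * (t - s) \<le> time n" using assms mean_pos by (intro mult_left_mono) auto
  show "time n - real n * \<mu> * (t - s) = real n * \<mu> * s" by (simp add: algebra_simps)
qed

abbreviation "hit_pr n s \<omega> \<equiv> c.hit_prob n (real n * \<mu> * s) \<omega>"

lemma one_minus_hit_pr: "1 - hit_pr n s \<omega> i = exp (- s * scaled n i \<omega>)"
  by (simp add: c.hit_prob_def scaled_def mult_ac)

lemma hit_pr_range: "0 \<le> s \<Longrightarrow> i \<in> {1..n} \<Longrightarrow> \<omega> \<in> space (M n) \<Longrightarrow> 0 \<le> hit_pr n s \<omega> i \<and> hit_pr n s \<omega> i \<le> 1"
  using mean_pos by (intro c.hit_prob_range) auto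

abbreviation "zero_prob n \<equiv> c.prob n {\<omega>\<in>space (M n). \<not> c.positive_weight n \<omega>}"

lemma sum_exp_avg: "(\<Sum>i\<in>{1..n}. 1 - hit_pr n s \<omega> i) / real n = avg n (\<lambda>x. exp (- s * x)) \<omega>"
  by (simp add: one_minus_hit_pr avg_def)

text \<open>Chebyshev's inequality.\<close>

lemma hit_count_concentrates:
  assumes s: "0 \<le> s" "s \<le> t" and e: "0 < e"
  shows "(\<lambda>n. c.prob n {\<omega>\<in>space (M n). e \<le> \<bar>real (card (hits n s \<omega>)) / real n - (1 - laplace P s)\<bar>}) \<longlonglongrightarrow> 0"
proof (rule tendsto_sandwich[OF _ _ tendsto_const])
  let ?D = "\<lambda>n. c.expectation n (\<lambda>\<omega>. \<bar>avg n (\<lambda>x. exp (- s * x)) \<omega> - laplace P s\<bar>)"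
  have lim: "(\<lambda>n. 1 / real n + ?D n) \<longlonglongrightarrow> 0 + 0"
    by (intro tendsto_add lim_1_over_n average_exp_converges s)
  show "(\<lambda>n. (1 / real n + ?D n) / e\<^sup>2) \<longlonglongrightarrow> 0"
    using tendsto_divide[OF lim tendsto_const[of "e\<^sup>2"]] e by simp
  show "\<forall>\<^sub>F n in sequentially. c.prob n {\<omega>\<in>space (M n). e \<le> \<bar>real (card (hits n s \<omega>)) / real n - (1 - laplace P s)\<bar>} \<le>
      (1 / real n + ?D n) / e\<^sup>2"
    using eventually_gt_at_top[of 0]
  proof eventually_elim
    case (elim n)
    let ?\<Psi> = "\<lambda>C. e \<le> \<bar>real (card C) / real n - (1 - laplace P s)\<bar>"
    have L: "0 \<le> laplace P s" "laplace P s \<le> 1"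
      using laplace_gt[OF s(1)] measure_nonneg[of P "{0}"] laplace_le_1[OF s(1)] by linarith+
    have ae: "integrable (M n) (\<lambda>\<omega>. \<bar>avg n (\<lambda>x. exp (- s * x)) \<omega> - laplace P s\<bar>)"
    proof (rule integrable_bounded[where K = 2])
      fix \<omega> assume "\<omega> \<in> space (M n)"
      then have "\<bar>avg n (\<lambda>x. exp (- s * x)) \<omega>\<bar> \<le> 1" using s by (intro avg_abs_le) auto
      then show "\<bar>\<bar>avg n (\<lambda>x. exp (- s * x)) \<omega> - laplace P s\<bar>\<bar> \<le> 2" using L by linarith
    qed (intro borel_measurable_abs borel_measurable_diff avg_measurable borel_measurable_const, simp)
    have "c.prob n {\<omega>\<in>space (M n). ?\<Psi> (hits n s \<omega>)} =
       c.expectation n (\<lambda>\<omega>. subset_mean {1..n} (hit_pr n s \<omega>) (\<lambda>C. of_bool (?\<Psi> C)))"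
      unfolding hits_def by (subst c.requested_in_event_law) (use start_bounds[OF s] in auto)
    also have "\<dots> \<le> c.expectation n (\<lambda>\<omega>. (1 / real n + \<bar>avg n (\<lambda>x. exp (- s * x)) \<omega> - laplace P s\<bar>) / e\<^sup>2)"
    proof (rule integral_mono)
      have bd: "0 \<le> subset_mean {1..n} (hit_pr n s \<omega>) (\<lambda>C. of_bool (?\<Psi> C)) \<and>
          subset_mean {1..n} (hit_pr n s \<omega>) (\<lambda>C. of_bool (?\<Psi> C)) \<le> 1" if "\<omega> \<in> space (M n)" for \<omega>
        using subset_mean_mono[of "{1..n}" "hit_pr n s \<omega>" "\<lambda>C. of_bool (?\<Psi> C)" "\<lambda>_. 1"]
          hit_pr_range[OF s(1) _ that] subset_mean_nonneg[of "{1..n}" "hit_pr n s \<omega>" "\<lambda>C. of_bool (?\<Psi> C)"]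
        by (simp add: subset_mean_const)
      show "integrable (M n) (\<lambda>\<omega>. subset_mean {1..n} (hit_pr n s \<omega>) (\<lambda>C. of_bool (?\<Psi> C)))"
        by (rule integrable_bounded[where K = 1, OF c.subset_mean_measurable]) (use bd in auto)
      show "integrable (M n) (\<lambda>\<omega>. (1 / real n + \<bar>avg n (\<lambda>x. exp (- s * x)) \<omega> - laplace P s\<bar>) / e\<^sup>2)"
        using ae by auto
      fix \<omega> assume \<omega>: "\<omega> \<in> space (M n)"
      have "subset_mean {1..n} (hit_pr n s \<omega>) (\<lambda>C. of_bool (?\<Psi> C)) \<le>
         subset_mean {1..n} (hit_pr n s \<omega>) (\<lambda>C. (1 / e\<^sup>2) * (real (card ({1..n} - C)) / card {1..n} - laplace P s)\<^sup>2)"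
      proof (rule subset_mean_mono)
        fix C assume C: "C \<subseteq> {1..n}"
        have "card C \<le> n" using card_mono[OF _ C] by simp
        then have "real (card ({1..n} - C)) = real n - real (card C)"
          using C by (simp add: card_Diff_subset finite_subset of_nat_diff)
        then have eq: "\<bar>real (card C) / real n - (1 - laplace P s)\<bar> = \<bar>real (card ({1..n} - C)) / real n - laplace P s\<bar>"
          using elim by (simp add: field_simps abs_minus_commute)
        show "of_bool (?\<Psi> C) \<le> (1 / e\<^sup>2) * (real (card ({1..n} - C)) / card {1..n} - laplace P s)\<^sup>2"
        proof (cases "?\<Psi> C")
          case True
          then have "e\<^sup>2 \<le> (real (card ({1..n} - C)) / real n - laplace P s)\<^sup>2"
            unfolding eq using e by (metis abs_le_square_iff abs_of_pos)
          then show ?thesis using e True by (simp add: field_simps)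
        qed simp
      qed (use hit_pr_range[OF s(1) _ \<omega>] in auto)
      also have "\<dots> \<le> (1 / e\<^sup>2) * (1 / card {1..n} + \<bar>(\<Sum>j\<in>{1..n}. 1 - hit_pr n s \<omega> j) / card {1..n} - laplace P s\<bar>)"
        unfolding subset_mean_cmult
        by (intro mult_left_mono subset_mean_square_deviation) (use hit_pr_range[OF s(1) _ \<omega>] L elim in auto)
      also have "\<dots> = (1 / real n + \<bar>avg n (\<lambda>x. exp (- s * x)) \<omega> - laplace P s\<bar>) / e\<^sup>2"
        using sum_exp_avg[of n s \<omega>] by simp
      finally show "subset_mean {1..n} (hit_pr n s \<omega>) (\<lambda>C. of_bool (?\<Psi> C)) \<le>
        (1 / real n + \<bar>avg n (\<lambda>x. exp (- s * x)) \<omega> - laplace P s\<bar>) / e\<^sup>2" .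
    qed
    also have "\<dots> = (1 / real n + ?D n) / e\<^sup>2" using ae c.prob_space[of n] by simp
    finally show ?case .
  qed
qed simp

abbreviation "joint n s \<Phi> \<equiv> c.joint_event n (real n * \<mu> * (t - s)) (time n) \<Phi>"

lemma joint_bounds:
  assumes "0 \<le> s" "s \<le> t"
  shows "c.joint_mean n (real n * \<mu> * s) \<Phi> \<le> c.prob n (joint n s \<Phi>)"
    and "c.prob n (joint n s \<Phi>) \<le> c.joint_mean n (real n * \<mu> * s) \<Phi> + zero_prob n"
proof -
  have "c.joint_mean n (time n - real n * \<mu> * (t - s)) \<Phi> \<le> c.prob n (joint n s \<Phi>)"
    by (rule c.joint_event_ge[OF start_bounds(1,2)[OF assms]])
  then show "c.joint_mean n (real n * \<mu> * s) \<Phi> \<le> c.prob n (joint n s \<Phi>)"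
    by (simp only: start_bounds(3)[OF assms])
  have "c.prob n (joint n s \<Phi>) \<le> c.joint_mean n (time n - real n * \<mu> * (t - s)) \<Phi> + zero_prob n"
    by (rule c.joint_event_le[OF start_bounds(1,2)[OF assms]])
  then show "c.prob n (joint n s \<Phi>) \<le> c.joint_mean n (real n * \<mu> * s) \<Phi> + zero_prob n"
    by (simp only: start_bounds(3)[OF assms])
qed

lemma joint_event_tendsto:
  assumes "0 \<le> s" "s \<le> t" "(\<lambda>n. c.joint_mean n (real n * \<mu> * s) (\<Phi> n)) \<longlonglongrightarrow> L"
  shows "(\<lambda>n. c.prob n (joint n s (\<Phi> n))) \<longlonglongrightarrow> L"
proof (rule tendsto_sandwich[OF _ _ assms(3)])
  show "(\<lambda>n. c.joint_mean n (real n * \<mu> * s) (\<Phi> n) + zero_prob n) \<longlonglongrightarrow> L"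
    using tendsto_add[OF assms(3) zero_weights_vanish] by simp
qed (use joint_bounds[OF assms(1,2)] in auto)

lemma expectation_tendsto_of_L1:
  fixes f :: "nat \<Rightarrow> 'a \<Rightarrow> real"
  assumes "\<And>n. integrable (M n) (f n)" "(\<lambda>n. c.expectation n (\<lambda>\<omega>. \<bar>f n \<omega> - L\<bar>)) \<longlonglongrightarrow> 0"
  shows "(\<lambda>n. c.expectation n (f n)) \<longlonglongrightarrow> L"
proof -
  have "(\<lambda>n. c.expectation n (f n) - L) \<longlonglongrightarrow> 0"
  proof (rule Lim_null_comparison[OF _ assms(2)], intro always_eventually allI)
    fix n
    have "c.expectation n (f n) - L = c.expectation n (\<lambda>\<omega>. f n \<omega> - L)"
      using assms(1) c.prob_space[of n] by simp
    then show "norm (c.expectation n (f n) - L) \<le> c.expectation n (\<lambda>\<omega>. \<bar>f n \<omega> - L\<bar>)"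
      by (simp add: integral_abs_bound)
  qed
  then show ?thesis using Lim_null by blast
qed

text \<open>The sum of \<open>p i * exp (- s * x i)\<close> is \<open>1 / \<mu>\<close> times an average of the bounded Lipschitz function
  \<open>\<lambda>x. x * exp (- s * x)\<close>; at \<open>s = 0\<close> it would be unbounded.\<close>

lemma next_not_hit:
  assumes s: "0 < s" "s \<le> t"
  shows "(\<lambda>n. c.prob n (joint n s (\<lambda>C i. i \<notin> C))) \<longlonglongrightarrow> moment 1 s / \<mu>"
proof (rule joint_event_tendsto)
  let ?f = "\<lambda>x. x * exp (- s * x)"
  have fb: "\<bar>?f x\<bar> \<le> 1 / s" if "0 \<le> x" for x using power_exp_le[OF that s(1), of 1] that by simp
  have int: "integrable (M n) (avg n ?f)" for n
    by (rule integrable_bounded[OF avg_measurable avg_abs_le]) (use fb in auto)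
  have lim: "(\<lambda>n. c.expectation n (avg n ?f)) \<longlonglongrightarrow> moment 1 s"
    by (rule expectation_tendsto_of_L1[OF int average_moment_1_converges[OF s(1)]])
  have "\<forall>\<^sub>F n in sequentially. c.expectation n (avg n ?f) / \<mu> =
      c.joint_mean n (real n * \<mu> * s) (\<lambda>C i. i \<notin> C)"
    using eventually_gt_at_top[of 0]
  proof eventually_elim
    case (elim n)
    have "c.joint_mean n (real n * \<mu> * s) (\<lambda>C i. i \<notin> C) = c.expectation n (\<lambda>\<omega>. avg n ?f \<omega> / \<mu>)"
      unfolding c.joint_mean_def
    proof (intro Bochner_Integration.integral_cong refl)
      fix \<omega>
      have "(\<Sum>i\<in>{1..n}. c.pop n i \<omega> * subset_mean {1..n} (hit_pr n s \<omega>) (\<lambda>C. of_bool (i \<notin> C))) =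
          (\<Sum>i\<in>{1..n}. scaled n i \<omega> * exp (- s * scaled n i \<omega>) / (real n * \<mu>))"
      proof (rule sum.cong[OF refl])
        fix i assume i: "i \<in> {1..n}"
        have "subset_mean {1..n} (hit_pr n s \<omega>) (\<lambda>C. of_bool (i \<notin> C)) = exp (- s * scaled n i \<omega>)"
          using subset_mean_notin[OF finite_atLeastAtMost i] one_minus_hit_pr by simp
        then show "c.pop n i \<omega> * subset_mean {1..n} (hit_pr n s \<omega>) (\<lambda>C. of_bool (i \<notin> C)) =
            scaled n i \<omega> * exp (- s * scaled n i \<omega>) / (real n * \<mu>)"
          using elim mean_pos by (simp add: scaled_def)
      qed
      then show "(\<Sum>i\<in>{1..n}. c.pop n i \<omega> * subset_mean {1..n} (hit_pr n s \<omega>) (\<lambda>C. of_bool (i \<notin> C))) = avg n ?f \<omega> / \<mu>"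
        by (simp add: avg_def sum_divide_distrib[symmetric])
    qed
    then show ?case by simp
  qed
  moreover have "(\<lambda>n. c.expectation n (avg n ?f) / \<mu>) \<longlonglongrightarrow> moment 1 s / \<mu>"
    using mean_pos by (intro tendsto_divide lim tendsto_const) auto
  ultimately show "(\<lambda>n. c.joint_mean n (real n * \<mu> * s) (\<lambda>C i. i \<notin> C)) \<longlonglongrightarrow> moment 1 s / \<mu>"
    by (rule Lim_transform_eventually[rotated])
qed (use s in auto)

lemma next_hit:
  assumes s: "0 < s" "s \<le> t"
  shows "(\<lambda>n. c.prob n (joint n s (\<lambda>C i. i \<in> C))) \<longlonglongrightarrow> 1 - moment 1 s / \<mu>"
proof (rule joint_event_tendsto)
  have "(\<lambda>n. c.joint_mean n (real n * \<mu> * s) (\<lambda>C i. i \<notin> C)) \<longlonglongrightarrow> moment 1 s / \<mu>"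
  proof (rule tendsto_sandwich[OF _ _ _ next_not_hit[OF s]])
    have "(\<lambda>n. c.prob n (joint n s (\<lambda>C i. i \<notin> C)) - zero_prob n) \<longlonglongrightarrow> moment 1 s / \<mu> - 0"
      by (intro tendsto_diff next_not_hit s zero_weights_vanish)
    then show "(\<lambda>n. c.prob n (joint n s (\<lambda>C i. i \<notin> C)) - zero_prob n) \<longlonglongrightarrow> moment 1 s / \<mu>" by simp
    have s0: "0 \<le> s" using s by simp
    show "\<forall>\<^sub>F n in sequentially. c.prob n (joint n s (\<lambda>C i. i \<notin> C)) - zero_prob n \<le> c.joint_mean n (real n * \<mu> * s) (\<lambda>C i. i \<notin> C)"
    proof (intro always_eventually allI)
      fix n
      show "c.prob n (joint n s (\<lambda>C i. i \<notin> C)) - zero_prob n \<le> c.joint_mean n (real n * \<mu> * s) (\<lambda>C i. i \<notin> C)"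
        using joint_bounds(2)[OF s0 s(2), of n "\<lambda>C i. i \<notin> C"] by linarith
    qed
    show "\<forall>\<^sub>F n in sequentially. c.joint_mean n (real n * \<mu> * s) (\<lambda>C i. i \<notin> C) \<le> c.prob n (joint n s (\<lambda>C i. i \<notin> C))"
      by (intro always_eventually allI joint_bounds(1)[OF s0 s(2)])
  qed
  moreover have "c.joint_mean n (real n * \<mu> * s) (\<lambda>C i. i \<in> C) =
      1 - zero_prob n - c.joint_mean n (real n * \<mu> * s) (\<lambda>C i. i \<notin> C)" for n
    using c.joint_mean_compl[of "real n * \<mu> * s" n "\<lambda>C i. i \<in> C"] s mean_pos by simp
  ultimately show "(\<lambda>n. c.joint_mean n (real n * \<mu> * s) (\<lambda>C i. i \<in> C)) \<longlonglongrightarrow> 1 - moment 1 s / \<mu>"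
    using tendsto_diff[OF tendsto_diff[OF tendsto_const[of 1] zero_weights_vanish]] by fastforce
qed (use s in auto)

lemma next_None_vanishes:
  "(\<lambda>n. c.prob n {\<omega>\<in>space (M n). next_label n (cfg n \<omega>) (time n) = None}) \<longlonglongrightarrow> 0"
proof -
  have joint: "c.prob n {\<omega>\<in>space (M n). next_label n (cfg n \<omega>) (time n) = None} =
      1 - c.prob n (joint n t (\<lambda>C i. i \<in> C) \<union> joint n t (\<lambda>C i. i \<notin> C))" for n
  proof -
    have "{\<omega>\<in>space (M n). next_label n (cfg n \<omega>) (time n) = None} =
        space (M n) - (joint n t (\<lambda>C i. i \<in> C) \<union> joint n t (\<lambda>C i. i \<notin> C))"
      unfolding c.joint_event_def by (auto simp: not_None_eq)
    then show ?thesis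
      by (simp only:) (intro c.prob_compl sets.Un c.joint_event_sets)
  qed
  have U: "c.prob n (joint n t (\<lambda>C i. i \<in> C) \<union> joint n t (\<lambda>C i. i \<notin> C)) =
      c.prob n (joint n t (\<lambda>C i. i \<in> C)) + c.prob n (joint n t (\<lambda>C i. i \<notin> C))" for n
    by (intro c.finite_measure_Union c.joint_event_sets) (auto simp: c.joint_event_def)
  have "(\<lambda>n. 1 - (c.prob n (joint n t (\<lambda>C i. i \<in> C)) + c.prob n (joint n t (\<lambda>C i. i \<notin> C)))) \<longlonglongrightarrow>
      1 - ((1 - moment 1 t / \<mu>) + moment 1 t / \<mu>)"
    by (intro tendsto_diff tendsto_const tendsto_add next_hit next_not_hit t_pos order_refl)
  then show ?thesis unfolding joint U by simp
qed

definition cost :: "nat \<Rightarrow> 'a \<Rightarrow> real" where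
  "cost n \<omega> = real (search_cost n (\<pi> n) (cfg n \<omega>) (time n)) / real n"

definition cost_cdf :: "nat \<Rightarrow> real \<Rightarrow> real" where
  "cost_cdf n x = c.prob n {\<omega>\<in>space (M n). cost n \<omega> \<le> x}"

lemma cost_measurable: "cost n \<in> borel_measurable (M n)"
  unfolding cost_def by (rule measurable_compose[OF c.search_cost_measurable]) simp

lemma cost_le_sets: "{\<omega>\<in>space (M n). cost n \<omega> \<le> x} \<in> sets (M n)"
  using cost_measurable by measurable

lemma cost_cdf_mono: "x \<le> y \<Longrightarrow> cost_cdf n x \<le> cost_cdf n y"
  unfolding cost_cdf_def by (intro c.finite_measure_mono cost_le_sets) auto

lemma cost_cdf_eq: "cdf (distr (M n) borel (cost n)) x = cost_cdf n x"
proof -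
  have "measure (distr (M n) borel (cost n)) {..x} = c.prob n (cost n -` {..x} \<inter> space (M n))"
    by (intro measure_distr cost_measurable) simp
  also have "cost n -` {..x} \<inter> space (M n) = {\<omega>\<in>space (M n). cost n \<omega> \<le> x}" by auto
  finally show ?thesis by (simp add: cdf_def cost_cdf_def)
qed

lemma cost_bounds: assumes "\<omega> \<in> space (M n)" "0 < n" shows "0 \<le> cost n \<omega>" "cost n \<omega> \<le> 1"
  using request_configuration.search_cost_le[OF c.configuration[OF assms(1)] c.initial_permutation, of "time n"] assms(2)
  by (auto simp: cost_def)

definition deviant :: "nat \<Rightarrow> real \<Rightarrow> real \<Rightarrow> 'a set" where
  "deviant n s e = {\<omega>\<in>space (M n). e \<le> \<bar>real (card (hits n s \<omega>)) / real n - (1 - laplace P s)\<bar>}"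

lemma deviant_sets: "deviant n s e \<in> sets (M n)"
  unfolding deviant_def hits_def by (rule c.requested_in_event_sets)

lemma deviant_vanishes: "0 \<le> s \<Longrightarrow> s \<le> t \<Longrightarrow> 0 < e \<Longrightarrow> (\<lambda>n. c.prob n (deviant n s e)) \<longlonglongrightarrow> 0"
  unfolding deviant_def by (rule hit_count_concentrates)

lemma next_None_sets: "{\<omega>\<in>space (M n). next_label n (cfg n \<omega>) (time n) = None} \<in> sets (M n)"
proof -
  have "Measurable.pred (M n) (\<lambda>\<omega>. next_label n (cfg n \<omega>) (time n) = None)"
    by (rule measurable_compose[OF c.next_label_measurable]) simp
  then show ?thesis unfolding pred_def .
qed

lemma cost_next_bounds:
  assumes s: "0 \<le> s" "s \<le> t" and n: "0 < n"
  shows "AE \<omega> in M n. \<forall>i. next_label n (cfg n \<omega>) (time n) = Some i \<longrightarrow>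
     (i \<in> hits n s \<omega> \<longrightarrow> cost n \<omega> \<le> card (hits n s \<omega>) / real n) \<and>
     (i \<notin> hits n s \<omega> \<longrightarrow> card (hits n s \<omega>) / real n < cost n \<omega>)"
  using c.no_ties_all[OF time_nonneg, of n n] AE_space
proof eventually_elim
  case (elim \<omega>)
  then interpret request_configuration n "cfg n \<omega>" using c.configuration by blast
  have nt: "i \<in> {1..n} \<Longrightarrow> j \<in> {1..n} \<Longrightarrow> i \<noteq> j \<Longrightarrow> T n i \<omega> \<inter> T n j \<omega> \<inter> {0..<time n} = {}" for i j
    using elim(1) by blast
  show ?case
  proof (intro allI impI conjI)
    fix i assume nx: "next_label n (cfg n \<omega>) (time n) = Some i"
    have i: "i \<in> {1..n}" using nx request_label_in_range unfolding next_label_def by blast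
    note sc = search_cost_next[OF nx, of "\<pi> n"]
    show "cost n \<omega> \<le> card (hits n s \<omega>) / real n" if "i \<in> hits n s \<omega>"
      using position_at_requested[OF c.initial_permutation nt start_bounds(2)[OF s], of i] that n
      unfolding cost_def sc hits_def by (simp add: divide_right_mono)
    show "card (hits n s \<omega>) / real n < cost n \<omega>" if "i \<notin> hits n s \<omega>"
      using position_at_not_requested[OF c.initial_permutation nt start_bounds(2)[OF s], of i] that i n
      unfolding cost_def sc hits_def by (simp add: divide_strict_right_mono)
  qed
qed

text \<open>If the next object was requested in the window, it is among the first \<open>card (hits n s \<omega>)\<close> objects,
  which is a proportion of about \<open>1 - laplace P s\<close>.\<close>

lemma cost_cdf_lower:
  assumes s: "0 < s" "s \<le> t" and x: "1 - laplace P s < x" and e: "0 < e"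
  shows "\<forall>\<^sub>F n in sequentially. 1 - moment 1 s / \<mu> - e < cost_cdf n x"
proof -
  have s0: "0 \<le> s" using s by simp
  define d where "d = x - (1 - laplace P s)"
  have d: "0 < d" using x by (simp add: d_def)
  have "(\<lambda>n. c.prob n (joint n s (\<lambda>C i. i \<in> C)) - c.prob n (deviant n s d)) \<longlonglongrightarrow> (1 - moment 1 s / \<mu>) - 0"
    by (intro tendsto_diff next_hit s deviant_vanishes s0 d)
  then have "\<forall>\<^sub>F n in sequentially. 1 - moment 1 s / \<mu> - e < c.prob n (joint n s (\<lambda>C i. i \<in> C)) - c.prob n (deviant n s d)"
    using e by (intro order_tendstoD(1)) auto
  then show ?thesis using eventually_gt_at_top[of 0]
  proof eventually_elim
    case (elim n)
    have "c.prob n (joint n s (\<lambda>C i. i \<in> C)) \<le> c.prob n ({\<omega>\<in>space (M n). cost n \<omega> \<le> x} \<union> deviant n s d)"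
    proof (rule c.finite_measure_mono_AE)
      show "AE \<omega> in M n. \<omega> \<in> joint n s (\<lambda>C i. i \<in> C) \<longrightarrow> \<omega> \<in> {\<omega>\<in>space (M n). cost n \<omega> \<le> x} \<union> deviant n s d"
        using cost_next_bounds[OF s0 s(2) elim(2)]
      proof eventually_elim
        case (elim \<omega>)
        show ?case
        proof
          assume "\<omega> \<in> joint n s (\<lambda>C i. i \<in> C)"
          then have \<omega>: "\<omega> \<in> space (M n)" and le: "cost n \<omega> \<le> card (hits n s \<omega>) / real n"
            using elim unfolding c.joint_event_def hits_def by blast+
          show "\<omega> \<in> {\<omega>\<in>space (M n). cost n \<omega> \<le> x} \<union> deviant n s d"
          proof (cases "\<omega> \<in> deviant n s d")
            case False
            then have "\<bar>real (card (hits n s \<omega>)) / real n - (1 - laplace P s)\<bar> < d"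
              using \<omega> by (auto simp: deviant_def)
            then have "cost n \<omega> \<le> x" using le unfolding d_def by linarith
            then show ?thesis using \<omega> by simp
          qed simp
        qed
      qed
    qed (intro sets.Un cost_le_sets deviant_sets)
    also have "\<dots> \<le> cost_cdf n x + c.prob n (deviant n s d)"
      unfolding cost_cdf_def by (intro measure_Un_le cost_le_sets deviant_sets)
    finally show ?case using elim(1) by linarith
  qed
qed

text \<open>Conversely an object not requested in the window lies behind these objects.\<close>

lemma cost_cdf_upper:
  assumes s: "0 < s" "s \<le> t" and x: "x < 1 - laplace P s" and e: "0 < e"
  shows "\<forall>\<^sub>F n in sequentially. cost_cdf n x < 1 - moment 1 s / \<mu> + e"
proof -
  have s0: "0 \<le> s" using s by simp
  let ?N = "\<lambda>n. {\<omega>\<in>space (M n). next_label n (cfg n \<omega>) (time n) = None}"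
  define d where "d = 1 - laplace P s - x"
  have d: "0 < d" using x by (simp add: d_def)
  have "(\<lambda>n. c.prob n (joint n s (\<lambda>C i. i \<in> C)) + c.prob n (?N n) + c.prob n (deviant n s d)) \<longlonglongrightarrow> (1 - moment 1 s / \<mu>) + 0 + 0"
    by (intro tendsto_add next_hit s deviant_vanishes s0 d next_None_vanishes)
  then have "\<forall>\<^sub>F n in sequentially. c.prob n (joint n s (\<lambda>C i. i \<in> C)) + c.prob n (?N n) + c.prob n (deviant n s d) < 1 - moment 1 s / \<mu> + e"
    using e by (intro order_tendstoD(2)) auto
  then show ?thesis using eventually_gt_at_top[of 0]
  proof eventually_elim
    case (elim n)
    have "cost_cdf n x \<le> c.prob n (joint n s (\<lambda>C i. i \<in> C) \<union> ?N n \<union> deviant n s d)" unfolding cost_cdf_def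
    proof (rule c.finite_measure_mono_AE)
      show "AE \<omega> in M n. \<omega> \<in> {\<omega>\<in>space (M n). cost n \<omega> \<le> x} \<longrightarrow> \<omega> \<in> joint n s (\<lambda>C i. i \<in> C) \<union> ?N n \<union> deviant n s d"
        using cost_next_bounds[OF s0 s(2) elim(2)]
      proof eventually_elim
        case (elim \<omega>)
        show ?case
        proof
          assume "\<omega> \<in> {\<omega>\<in>space (M n). cost n \<omega> \<le> x}"
          then have \<omega>: "\<omega> \<in> space (M n)" and le: "cost n \<omega> \<le> x" by auto
          show "\<omega> \<in> joint n s (\<lambda>C i. i \<in> C) \<union> ?N n \<union> deviant n s d"
          proof (cases "next_label n (cfg n \<omega>) (time n)")
            case None
            then show ?thesis using \<omega> by simp
          next
            case (Some i)
            show ?thesis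
            proof (cases "i \<in> hits n s \<omega>")
              case True
              then have "\<omega> \<in> joint n s (\<lambda>C i. i \<in> C)" using Some \<omega> unfolding c.joint_event_def hits_def by blast
              then show ?thesis by simp
            next
              case False
              then have "card (hits n s \<omega>) / real n < cost n \<omega>" using elim Some by blast
              then have "d \<le> \<bar>real (card (hits n s \<omega>)) / real n - (1 - laplace P s)\<bar>"
                using le unfolding d_def by linarith
              then show ?thesis using \<omega> by (simp add: deviant_def)
            qed
          qed
        qed
      qed
    qed (intro sets.Un c.joint_event_sets deviant_sets next_None_sets)
    also have "\<dots> \<le> c.prob n (joint n s (\<lambda>C i. i \<in> C) \<union> ?N n) + c.prob n (deviant n s d)"
      by (intro measure_Un_le sets.Un c.joint_event_sets deviant_sets next_None_sets)
    also have "\<dots> \<le> c.prob n (joint n s (\<lambda>C i. i \<in> C)) + c.prob n (?N n) + c.prob n (deviant n s d)"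
      by (intro add_right_mono measure_Un_le c.joint_event_sets next_None_sets)
    finally show ?case using elim(1) by linarith
  qed
qed

lemma search_cost_out_tendsto:
  "(\<lambda>n. c.prob n {\<omega>\<in>space (M n). search_cost_out n (\<pi> n) (cfg n \<omega>) (time n) > 0}) \<longlonglongrightarrow> moment 1 t / \<mu>"
proof -
  have "{\<omega>\<in>space (M n). search_cost_out n (\<pi> n) (cfg n \<omega>) (time n) > 0} = joint n t (\<lambda>C i. i \<notin> C)" for n
    unfolding c.joint_event_def
    using request_configuration.search_cost_out_pos_iff[OF c.configuration c.initial_permutation]
    by (intro Collect_cong conj_cong refl) simp
  then show ?thesis using next_not_hit[OF t_pos order_refl] by simp
qed

end

section \<open>Objects left alone since the start\<close>

lemma abs_min_diff_le: "\<bar>min u v - min u' v'\<bar> \<le> \<bar>u - u'\<bar> + \<bar>v - (v' :: real)\<bar>"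
  by (auto simp: min_def)

lemma abs_max_0_diff_le: "\<bar>max 0 u - max 0 v\<bar> \<le> \<bar>u - (v :: real)\<bar>"
  by (auto simp: max_def)

lemma abs_add_diff_le: "\<bar>(u + v - z) - (u' + v' - z')\<bar> \<le> \<bar>u - u'\<bar> + \<bar>v - v'\<bar> + \<bar>z - (z' :: real)\<bar>"
  by linarith

context sorted_request_sequence begin

definition rank_above :: "nat \<Rightarrow> nat set \<Rightarrow> nat \<Rightarrow> nat" where
  "rank_above n C i = card {j\<in>{1..n} - C. i < j}"

text \<open>The object was left alone since time 0, and its position is larger than \<open>n * a\<close>.\<close>

definition unhit_above :: "real \<Rightarrow> nat \<Rightarrow> nat set \<Rightarrow> nat \<Rightarrow> bool" where
  "unhit_above a n C i \<longleftrightarrow> i \<notin> C \<and> real n * a < real n - real (rank_above n C i)"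

text \<open>The conditional probability, given the weights, of the condition on \<open>i\<close>.\<close>

definition rank_prob :: "real \<Rightarrow> nat \<Rightarrow> nat \<Rightarrow> 'a \<Rightarrow> real" where
  "rank_prob a n i \<omega> = subset_mean {1..n} (hit_pr n t \<omega>) (\<lambda>C. of_bool (unhit_above a n C i))"

text \<open>The conditional mean of the proportion of objects that satisfy the condition and have a scaled weight
  larger than \<open>y\<close>.\<close>

definition layer :: "real \<Rightarrow> nat \<Rightarrow> real \<Rightarrow> 'a \<Rightarrow> real" where
  "layer a n y \<omega> = (1 / real n) * (\<Sum>i\<in>{1..n}. if y < scaled n i \<omega> then rank_prob a n i \<omega> else 0)"

lemma rank_prob_measurable: "rank_prob a n i \<in> borel_measurable (M n)"
  unfolding rank_prob_def[abs_def] by (rule c.subset_mean_measurable)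

lemma rank_prob_bounds:
  assumes "i \<in> {1..n}" "\<omega> \<in> space (M n)"
  shows "0 \<le> rank_prob a n i \<omega>" "rank_prob a n i \<omega> \<le> exp (- t * scaled n i \<omega>)"
proof -
  note r = hit_pr_range[OF t_nonneg _ assms(2)]
  show "0 \<le> rank_prob a n i \<omega>" unfolding rank_prob_def by (rule subset_mean_nonneg) (use r in auto)
  have "rank_prob a n i \<omega> \<le> subset_mean {1..n} (hit_pr n t \<omega>) (\<lambda>C. of_bool (i \<notin> C))"
    unfolding rank_prob_def by (rule subset_mean_mono) (use r in \<open>auto simp: unhit_above_def\<close>)
  then show "rank_prob a n i \<omega> \<le> exp (- t * scaled n i \<omega>)"
    using subset_mean_notin[OF finite_atLeastAtMost assms(1)] one_minus_hit_pr by simp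
qed

lemma layer_bounds:
  assumes "\<omega> \<in> space (M n)" "0 \<le> y"
  shows "0 \<le> layer a n y \<omega>" "layer a n y \<omega> \<le> exp (- t * y)"
proof -
  show "0 \<le> layer a n y \<omega>" unfolding layer_def
    by (intro mult_nonneg_nonneg sum_nonneg) (use rank_prob_bounds(1) assms in auto)
  have "(\<Sum>i\<in>{1..n}. if y < scaled n i \<omega> then rank_prob a n i \<omega> else 0) \<le> (\<Sum>i\<in>{1..n}. exp (- t * y))"
  proof (rule sum_mono)
    fix i assume i: "i \<in> {1..n}"
    show "(if y < scaled n i \<omega> then rank_prob a n i \<omega> else 0) \<le> exp (- t * y)"
    proof (cases "y < scaled n i \<omega>")
      case True
      then have "exp (- t * scaled n i \<omega>) \<le> exp (- t * y)" using t_pos by simp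
      then show ?thesis using order_trans[OF rank_prob_bounds(2)[OF i assms(1)]] True by simp
    qed simp
  qed
  then show "layer a n y \<omega> \<le> exp (- t * y)" by (cases "n = 0") (auto simp: layer_def field_simps)
qed

lemma layer_joint_measurable: "(\<lambda>(\<omega>, y). layer a n y \<omega>) \<in> borel_measurable (M n \<Otimes>\<^sub>M lborel)"
proof -
  have "(\<lambda>p. (1 / real n) * (\<Sum>i\<in>{1..n}. if snd p < scaled n i (fst p) then rank_prob a n i (fst p) else 0)) \<in>
      borel_measurable (M n \<Otimes>\<^sub>M lborel)"
  proof (intro borel_measurable_times borel_measurable_const borel_measurable_sum)
    fix i assume i: "i \<in> {1..n}"
    note [measurable] = scaled_measurable[OF i] rank_prob_measurable[of a n i]
    show "(\<lambda>p. if snd p < scaled n i (fst p) then rank_prob a n i (fst p) else 0) \<in> borel_measurable (M n \<Otimes>\<^sub>M lborel)"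
      by measurable
  qed
  then show ?thesis by (simp add: layer_def case_prod_unfold)
qed

lemma layer_measurable: "layer a n y \<in> borel_measurable (M n)"
proof -
  have "(\<lambda>\<omega>. (\<lambda>(\<omega>, y). layer a n y \<omega>) (\<omega>, y)) \<in> borel_measurable (M n)"
    by (rule measurable_compose[OF _ layer_joint_measurable]) simp
  then show ?thesis by simp
qed

text \<open>A popularity is \<open>1 / (n * \<mu>)\<close> times the length of the interval from 0 to the scaled weight. Exchanging
  the integral over this interval with the expectation replaces weights by proportions.\<close>

lemma joint_mean_layer_cake:
  assumes n: "0 < n"
  shows "ennreal (c.joint_mean n (time n) (unhit_above a n)) =
    ennreal (1 / \<mu>) * (\<integral>\<^sup>+y. ennreal (c.expectation n (layer a n y)) * indicator {0..} y \<partial>lborel)"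
proof -
  interpret pair_sigma_finite "M n" lborel ..
  let ?s = "\<lambda>\<omega>. \<Sum>i\<in>{1..n}. c.pop n i \<omega> * rank_prob a n i \<omega>"
  have jm: "c.joint_mean n (time n) (unhit_above a n) = c.expectation n ?s"
    unfolding c.joint_mean_def rank_prob_def ..
  have int: "integrable (M n) ?s"
    unfolding rank_prob_def
    by (intro Bochner_Integration.integrable_sum c.joint_mean_integrable time_nonneg)
  have nn: "0 \<le> c.pop n i \<omega> * rank_prob a n i \<omega>" if "i \<in> {1..n}" "\<omega> \<in> space (M n)" for i \<omega>
    using that c.pop_nonneg rank_prob_bounds(1) by (intro mult_nonneg_nonneg) auto
  have "ennreal (c.joint_mean n (time n) (unhit_above a n)) = (\<integral>\<^sup>+\<omega>. ennreal (?s \<omega>) \<partial>M n)"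
    unfolding jm using nn by (intro nn_integral_eq_integral[symmetric] int AE_I2 sum_nonneg) auto
  also have "\<dots> = (\<integral>\<^sup>+\<omega>. (\<integral>\<^sup>+y. ennreal (1 / \<mu>) * (ennreal (layer a n y \<omega>) * indicator {0..} y) \<partial>lborel) \<partial>M n)"
  proof (rule nn_integral_cong)
    fix \<omega> assume \<omega>: "\<omega> \<in> space (M n)"
    have wt: "0 \<le> rank_prob a n i \<omega>" if "i \<in> {1..n}" for i using rank_prob_bounds(1)[OF that \<omega>] .
    have layers: "(\<integral>\<^sup>+y. ennreal (rank_prob a n i \<omega> / (real n * \<mu>)) * indicator {0..<scaled n i \<omega>} y \<partial>lborel) =
       ennreal (c.pop n i \<omega> * rank_prob a n i \<omega>)" if i: "i \<in> {1..n}" for i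
    proof -
      have "(\<integral>\<^sup>+y. ennreal (rank_prob a n i \<omega> / (real n * \<mu>)) * indicator {0..<scaled n i \<omega>} y \<partial>lborel) =
         ennreal (rank_prob a n i \<omega> / (real n * \<mu>)) * ennreal (scaled n i \<omega>)"
        using scaled_nonneg[OF i \<omega>] by (simp add: nn_integral_cmult)
      also have "\<dots> = ennreal (rank_prob a n i \<omega> / (real n * \<mu>) * scaled n i \<omega>)"
        by (rule ennreal_mult''[OF scaled_nonneg[OF i \<omega>], symmetric])
      also have "rank_prob a n i \<omega> / (real n * \<mu>) * scaled n i \<omega> = c.pop n i \<omega> * rank_prob a n i \<omega>"
        using n mean_pos by (simp add: scaled_def)
      finally show ?thesis .
    qed
    have "ennreal (?s \<omega>) = (\<Sum>i\<in>{1..n}. ennreal (c.pop n i \<omega> * rank_prob a n i \<omega>))"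
      using nn[OF _ \<omega>] by (intro sum_ennreal[symmetric]) auto
    also have "\<dots> = (\<Sum>i\<in>{1..n}. \<integral>\<^sup>+y. ennreal (rank_prob a n i \<omega> / (real n * \<mu>)) * indicator {0..<scaled n i \<omega>} y \<partial>lborel)"
      by (intro sum.cong refl layers[symmetric])
    also have "\<dots> = (\<integral>\<^sup>+y. (\<Sum>i\<in>{1..n}. ennreal (rank_prob a n i \<omega> / (real n * \<mu>)) * indicator {0..<scaled n i \<omega>} y) \<partial>lborel)"
      by (intro nn_integral_sum[symmetric]) simp
    also have "\<dots> = (\<integral>\<^sup>+y. ennreal (1 / \<mu>) * (ennreal (layer a n y \<omega>) * indicator {0..} y) \<partial>lborel)"
    proof (rule nn_integral_cong)
      fix y :: real
      show "(\<Sum>i\<in>{1..n}. ennreal (rank_prob a n i \<omega> / (real n * \<mu>)) * indicator {0..<scaled n i \<omega>} y) =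
         ennreal (1 / \<mu>) * (ennreal (layer a n y \<omega>) * indicator {0..} y)"
      proof (cases "0 \<le> y")
        case True
        have "(\<Sum>i\<in>{1..n}. ennreal (rank_prob a n i \<omega> / (real n * \<mu>)) * indicator {0..<scaled n i \<omega>} y) =
          (\<Sum>i\<in>{1..n}. ennreal ((if y < scaled n i \<omega> then rank_prob a n i \<omega> else 0) / (real n * \<mu>)))"
          using True by (intro sum.cong refl) (auto simp: indicator_def)
        also have "\<dots> = ennreal (\<Sum>i\<in>{1..n}. (if y < scaled n i \<omega> then rank_prob a n i \<omega> else 0) / (real n * \<mu>))"
          using wt mean_pos by (intro sum_ennreal) auto
        also have "(\<Sum>i\<in>{1..n}. (if y < scaled n i \<omega> then rank_prob a n i \<omega> else 0) / (real n * \<mu>)) = (1 / \<mu>) * layer a n y \<omega>"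
          by (simp add: layer_def sum_divide_distrib[symmetric])
        also have "ennreal ((1 / \<mu>) * layer a n y \<omega>) = ennreal (1 / \<mu>) * ennreal (layer a n y \<omega>)"
          using mean_pos by (intro ennreal_mult') simp
        finally show ?thesis using True by simp
      qed (simp add: indicator_def)
    qed
    finally show "ennreal (?s \<omega>) = (\<integral>\<^sup>+y. ennreal (1 / \<mu>) * (ennreal (layer a n y \<omega>) * indicator {0..} y) \<partial>lborel)" .
  qed
  also have "\<dots> = (\<integral>\<^sup>+y. (\<integral>\<^sup>+\<omega>. ennreal (1 / \<mu>) * (ennreal (layer a n y \<omega>) * indicator {0..} y) \<partial>M n) \<partial>lborel)"
  proof (rule Fubini'[symmetric])
    note [measurable] = layer_joint_measurable[of a n]
    have "(\<lambda>p. ennreal (1 / \<mu>) * (ennreal ((\<lambda>(\<omega>, y). layer a n y \<omega>) p) * indicator {0..} (snd p))) \<in>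
       borel_measurable (M n \<Otimes>\<^sub>M lborel)" by measurable
    then show "(\<lambda>(\<omega>, y). ennreal (1 / \<mu>) * (ennreal (layer a n y \<omega>) * indicator {0..} y)) \<in>
       borel_measurable (M n \<Otimes>\<^sub>M lborel)" by (simp add: case_prod_unfold)
  qed
  also have "\<dots> = (\<integral>\<^sup>+y. ennreal (1 / \<mu>) * (ennreal (c.expectation n (layer a n y)) * indicator {0..} y) \<partial>lborel)"
  proof (rule nn_integral_cong)
    fix y :: real
    show "(\<integral>\<^sup>+\<omega>. ennreal (1 / \<mu>) * (ennreal (layer a n y \<omega>) * indicator {0..} y) \<partial>M n) =
       ennreal (1 / \<mu>) * (ennreal (c.expectation n (layer a n y)) * indicator {0..} y)"
    proof (cases "0 \<le> y")
      case True
      have "integrable (M n) (layer a n y)"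
        using layer_bounds[OF _ True] by (intro integrable_bounded[OF layer_measurable, where K = "exp (- t * y)"]) auto
      then have "(\<integral>\<^sup>+\<omega>. ennreal (layer a n y \<omega>) \<partial>M n) = ennreal (c.expectation n (layer a n y))"
        using layer_bounds(1)[OF _ True] by (intro nn_integral_eq_integral AE_I2) auto
      then show ?thesis using True layer_measurable[of a n y] by (simp add: nn_integral_cmult)
    qed simp
  qed
  also have "\<dots> = ennreal (1 / \<mu>) * (\<integral>\<^sup>+y. ennreal (c.expectation n (layer a n y)) * indicator {0..} y \<partial>lborel)"
  proof (rule nn_integral_cmult)
    have "(\<lambda>y. c.expectation n (layer a n y)) \<in> borel_measurable lborel"
    proof -
      have "(\<lambda>(y, \<omega>). layer a n y \<omega>) \<in> borel_measurable (lborel \<Otimes>\<^sub>M M n)"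
        using measurable_compose[OF measurable_pair_swap' layer_joint_measurable[of a n]] by (simp add: case_prod_unfold)
      then show ?thesis by (rule c.borel_measurable_lebesgue_integral)
    qed
    then show "(\<lambda>y. ennreal (c.expectation n (layer a n y)) * indicator {0..} y) \<in> borel_measurable lborel" by measurable
  qed
  finally show ?thesis .
qed

text \<open>The indicator of \<open>x \<le> y\<close> lies between two Lipschitz functions whose integrals with respect to \<open>P\<close>
  are arbitrarily close, because \<open>y\<close> is not an atom.\<close>

lemma indicator_average_converges:
  assumes y: "measure P {y} = 0" "0 \<le> y"
  shows "(\<lambda>n. c.expectation n (\<lambda>\<omega>. \<bar>avg n (\<lambda>x. if x \<le> y then exp (- t * x) else 0) \<omega> - g_minus P t y\<bar>)) \<longlonglongrightarrow> 0"
    (is "(\<lambda>n. c.expectation n (\<lambda>\<omega>. \<bar>avg n ?f \<omega> - _\<bar>)) \<longlonglongrightarrow> 0")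
proof (rule tendsto_null_bound[where C = 1])
  fix d :: real assume d: "0 < d"
  (* piecewise linear cut-offs at y: lo k falls from 1 to 0 just before y, hi k just after y *)
  define lo where "lo k x = min 1 (max 0 (0 + real (Suc k) * (y - x))) * exp (- t * x)" for k x
  define hi where "hi k x = min 1 (max 0 (1 + real (Suc k) * (y - x))) * exp (- t * x)" for k x
  have clamp: "\<bar>min 1 (max 0 u) - min 1 (max 0 v)\<bar> \<le> \<bar>u - v\<bar>" for u v :: real by (auto simp: min_def max_def)
  have lip: "\<bar>min 1 (max 0 (b + real (Suc k) * (y - x))) * exp (- t * x) -
      min 1 (max 0 (b + real (Suc k) * (y - z))) * exp (- t * z)\<bar> \<le> (real (Suc k) + t) * \<bar>x - z\<bar>"
    if "0 \<le> x" "0 \<le> z" for b x z k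
  proof -
    let ?u = "min 1 (max 0 (b + real (Suc k) * (y - x)))" and ?v = "min 1 (max 0 (b + real (Suc k) * (y - z)))"
    have "?u * exp (- t * x) - ?v * exp (- t * z) = (?u - ?v) * exp (- t * x) + ?v * (exp (- t * x) - exp (- t * z))"
      by (simp add: algebra_simps)
    also have "\<bar>\<dots>\<bar> \<le> \<bar>?u - ?v\<bar> * exp (- t * x) + ?v * \<bar>exp (- t * x) - exp (- t * z)\<bar>"
      by (intro order_trans[OF abs_triangle_ineq]) (simp add: abs_mult)
    also have "\<dots> \<le> (real (Suc k) * \<bar>x - z\<bar>) * 1 + 1 * (t * \<bar>x - z\<bar>)"
    proof (intro add_mono mult_mono)
      have "\<bar>?u - ?v\<bar> \<le> \<bar>(b + real (Suc k) * (y - x)) - (b + real (Suc k) * (y - z))\<bar>" by (rule clamp)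
      also have "\<dots> = \<bar>real (Suc k) * (z - x)\<bar>" by (simp add: algebra_simps)
      also have "\<dots> = real (Suc k) * \<bar>x - z\<bar>" by (simp only: abs_mult abs_minus_commute abs_of_nat)
      finally show "\<bar>?u - ?v\<bar> \<le> real (Suc k) * \<bar>x - z\<bar>" .
      show "\<bar>exp (- t * x) - exp (- t * z)\<bar> \<le> t * \<bar>x - z\<bar>"
        using exp_diff_le[of 0 x z t] that t_pos by (simp add: mult.commute)
    qed (use that t_pos in auto)
    finally show ?thesis by (simp add: algebra_simps)
  qed
  have bd: "0 \<le> lo k x \<and> lo k x \<le> 1 \<and> 0 \<le> hi k x \<and> hi k x \<le> 1" if "0 \<le> x" for k x
    using that t_pos unfolding lo_def hi_def by (auto intro!: mult_le_one mult_nonneg_nonneg)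
  have meas [measurable]: "lo k \<in> borel_measurable borel" "hi k \<in> borel_measurable borel" for k
    unfolding lo_def hi_def by measurable
  have sand: "lo k x \<le> ?f x \<and> ?f x \<le> hi k x" for k x
  proof (cases "x \<le> y")
    case True
    then show ?thesis by (auto simp: lo_def hi_def max_def min_def)
  next
    case False
    then have "real (Suc k) * (y - x) \<le> 0" by (intro mult_nonneg_nonpos) auto
    then show ?thesis using False by (auto simp: lo_def hi_def)
  qed
  have "(\<lambda>k. \<integral>x. hi k x - lo k x \<partial>P) \<longlonglongrightarrow> (\<integral>x. 0 \<partial>P)"
  proof (rule integral_dominated_convergence[where w = "\<lambda>_. 1"])
    have ny: "AE x in P. x \<noteq> y"
      using y(1) by (intro AE_I[where N = "{y}"]) (auto simp: emeasure_eq_measure)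
    show "AE x in P. (\<lambda>k. hi k x - lo k x) \<longlonglongrightarrow> 0"
      using ny
    proof eventually_elim
      case (elim x)
      have "\<forall>\<^sub>F k in sequentially. 1 < real k * \<bar>y - x\<bar>"
      proof -
        have "\<forall>\<^sub>F k in sequentially. 1 / \<bar>y - x\<bar> < real k"
          using filterlim_real_sequentially by (simp only: filterlim_at_top_dense)
        then show ?thesis by eventually_elim (use elim in \<open>simp add: pos_divide_less_eq\<close>)
      qed
      then have "\<forall>\<^sub>F k in sequentially. hi k x - lo k x = 0"
      proof eventually_elim
        case (elim k)
        then have k: "1 < real (Suc k) * \<bar>y - x\<bar>"
          by (rule less_le_trans) (intro mult_right_mono, auto)
        show ?case
        proof (cases "x < y")
          case True
          then have "1 < real (Suc k) * (y - x)" using k by simp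
          then show ?thesis by (simp add: hi_def lo_def)
        next
          case False
          then have "real (Suc k) * (y - x) < - 1" using k by (simp add: abs_if algebra_simps split: if_splits)
          then show ?thesis by (simp add: hi_def lo_def)
        qed
      qed
      then show ?case by (rule tendsto_eventually)
    qed
    show "AE x in P. norm (hi k x - lo k x) \<le> 1" for k
      using AE_nonneg
    proof eventually_elim
      case (elim x)
      show ?case using bd[OF elim, of k] by (auto simp: abs_le_iff)
    qed
  qed auto
  then have "\<forall>\<^sub>F k in sequentially. (\<integral>x. hi k x - lo k x \<partial>P) < d" using d by (intro order_tendstoD(2)) auto
  then obtain k where k: "(\<integral>x. hi k x - lo k x \<partial>P) < d" by (auto simp: eventually_sequentially)
  have intP: "integrable P (lo k)" "integrable P (hi k)" "integrable P ?f"
  proof -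
    have b1: "AE x in P. norm (lo k x) \<le> 1" and b2: "AE x in P. norm (hi k x) \<le> 1"
      and b3: "AE x in P. norm (?f x) \<le> 1"
      using AE_nonneg by (eventually_elim, use bd t_pos in simp)+
    show "integrable P (lo k)" by (rule integrable_const_bound[OF b1]) simp
    show "integrable P (hi k)" by (rule integrable_const_bound[OF b2]) simp
    show "integrable P ?f" by (rule integrable_const_bound[OF b3]) simp
  qed
  have G: "g_minus P t y = (\<integral>x. ?f x \<partial>P)"
    unfolding g_minus_def set_lebesgue_integral_def
  proof (rule integral_cong_AE)
    show "AE x in P. indicator {0..y} x *\<^sub>R exp (- x * t) = ?f x"
      using AE_nonneg by eventually_elim (auto simp: indicator_def mult.commute)
  qed auto
  let ?I = "\<lambda>h. \<integral>x. h x \<partial>P"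
  have Gs: "?I (lo k) \<le> g_minus P t y" "g_minus P t y \<le> ?I (hi k)" "?I (hi k) - ?I (lo k) < d"
    unfolding G using intP sand k by (auto intro!: integral_mono)
  have lo_lip: "\<bar>lo k x - lo k z\<bar> \<le> (real (Suc k) + t) * \<bar>x - z\<bar>" if "0 \<le> x" "0 \<le> z" for x z
    unfolding lo_def by (rule lip[OF that])
  have hi_lip: "\<bar>hi k x - hi k z\<bar> \<le> (real (Suc k) + t) * \<bar>x - z\<bar>" if "0 \<le> x" "0 \<le> z" for x z
    unfolding hi_def by (rule lip[OF that])
  let ?l = "\<lambda>n. c.expectation n (\<lambda>\<omega>. \<bar>avg n (lo k) \<omega> - ?I (lo k)\<bar>)"
  let ?h = "\<lambda>n. c.expectation n (\<lambda>\<omega>. \<bar>avg n (hi k) \<omega> - ?I (hi k)\<bar>)"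
  have L: "?l \<longlonglongrightarrow> 0"
    by (rule average_converges[where K = 1 and L = "real (Suc k) + t"])
       (use bd t_pos lo_lip in auto)
  have H: "?h \<longlonglongrightarrow> 0"
    by (rule average_converges[where K = 1 and L = "real (Suc k) + t"])
       (use bd t_pos hi_lip in auto)
  have fm: "?f \<in> borel_measurable borel" by measurable
  have int_dev: "integrable (M n) (\<lambda>\<omega>. \<bar>avg n h \<omega> - r\<bar>)"
    if "h \<in> borel_measurable borel" "\<And>x. 0 \<le> x \<Longrightarrow> \<bar>h x\<bar> \<le> 1" for n h r
  proof (rule integrable_bounded[where K = "1 + \<bar>r\<bar>"])
    fix \<omega> assume "\<omega> \<in> space (M n)"
    then have "\<bar>avg n h \<omega>\<bar> \<le> 1" using that(2) by (intro avg_abs_le)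
    then show "\<bar>\<bar>avg n h \<omega> - r\<bar>\<bar> \<le> 1 + \<bar>r\<bar>" by linarith
  qed (intro borel_measurable_abs borel_measurable_diff avg_measurable borel_measurable_const that)
  have fb: "\<bar>?f x\<bar> \<le> 1" if "0 \<le> x" for x using that t_pos by (cases "x \<le> y") simp_all
  have "\<bar>c.expectation n (\<lambda>\<omega>. \<bar>avg n ?f \<omega> - g_minus P t y\<bar>)\<bar> \<le> 1 * d + (?l n + ?h n)" for n
  proof -
    have il: "integrable (M n) (\<lambda>\<omega>. \<bar>avg n (lo k) \<omega> - ?I (lo k)\<bar>)"
      by (rule int_dev) (use bd in auto)
    have ih: "integrable (M n) (\<lambda>\<omega>. \<bar>avg n (hi k) \<omega> - ?I (hi k)\<bar>)"
      by (rule int_dev) (use bd in auto)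
    have "c.expectation n (\<lambda>\<omega>. \<bar>avg n ?f \<omega> - g_minus P t y\<bar>) \<le>
        c.expectation n (\<lambda>\<omega>. d + (\<bar>avg n (lo k) \<omega> - ?I (lo k)\<bar> + \<bar>avg n (hi k) \<omega> - ?I (hi k)\<bar>))"
    proof (rule integral_mono)
      show "integrable (M n) (\<lambda>\<omega>. \<bar>avg n ?f \<omega> - g_minus P t y\<bar>)" by (rule int_dev[OF fm fb])
      show "integrable (M n) (\<lambda>\<omega>. d + (\<bar>avg n (lo k) \<omega> - ?I (lo k)\<bar> + \<bar>avg n (hi k) \<omega> - ?I (hi k)\<bar>))"
        using il ih by auto
      fix \<omega> assume "\<omega> \<in> space (M n)"
      have "avg n (lo k) \<omega> \<le> avg n ?f \<omega>" "avg n ?f \<omega> \<le> avg n (hi k) \<omega>"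
        unfolding avg_def using sand by (auto intro!: mult_left_mono sum_mono divide_right_mono)
      then show "\<bar>avg n ?f \<omega> - g_minus P t y\<bar> \<le> d + (\<bar>avg n (lo k) \<omega> - ?I (lo k)\<bar> + \<bar>avg n (hi k) \<omega> - ?I (hi k)\<bar>)"
        using Gs by linarith
    qed
    also have "\<dots> = d + (?l n + ?h n)" using il ih c.prob_space[of n] by simp
    finally show ?thesis by (simp add: abs_of_nonneg integral_nonneg_AE)
  qed
  moreover have "(\<lambda>n. ?l n + ?h n) \<longlonglongrightarrow> 0" using tendsto_add[OF L H] by simp
  ultimately show "\<exists>g. g \<longlonglongrightarrow> 0 \<and> (\<forall>\<^sub>F n in sequentially.
      \<bar>c.expectation n (\<lambda>\<omega>. \<bar>avg n ?f \<omega> - g_minus P t y\<bar>)\<bar> \<le> 1 * d + g n)"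
    by (intro exI[of _ "\<lambda>n. ?l n + ?h n"] conjI always_eventually allI)
qed simp

section \<open>Convergence of the search cost\<close>

definition heavy :: "nat \<Rightarrow> real \<Rightarrow> 'a \<Rightarrow> nat set" where
  "heavy n y \<omega> = {i\<in>{1..n}. y < scaled n i \<omega>}"

lemma layer_eq_subset_mean:
  "layer a n y \<omega> = subset_mean {1..n} (hit_pr n t \<omega>)
     (\<lambda>C. real (card {i\<in>{1..n}. y < scaled n i \<omega> \<and> unhit_above a n C i}) / real n)"
proof -
  have "(if y < scaled n i \<omega> then rank_prob a n i \<omega> else 0) =
      subset_mean {1..n} (hit_pr n t \<omega>) (\<lambda>C. of_bool (y < scaled n i \<omega> \<and> unhit_above a n C i))" for i
    by (simp add: rank_prob_def subset_mean_def)
  then have "layer a n y \<omega> = (1 / real n) * subset_mean {1..n} (hit_pr n t \<omega>)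
      (\<lambda>C. \<Sum>i\<in>{1..n}. of_bool (y < scaled n i \<omega> \<and> unhit_above a n C i))"
    by (simp only: layer_def subset_mean_sum)
  also have "\<dots> = subset_mean {1..n} (hit_pr n t \<omega>)
      (\<lambda>C. (1 / real n) * (\<Sum>i\<in>{1..n}. of_bool (y < scaled n i \<omega> \<and> unhit_above a n C i)))"
    by (simp only: subset_mean_cmult)
  finally show ?thesis by (simp only: sum_of_bool_card[OF finite_atLeastAtMost] times_divide_eq_left mult_1_left)
qed

lemma scaled_mono:
  assumes "\<omega> \<in> space (M n)" "w n i \<omega> \<le> w n j \<omega>" shows "scaled n i \<omega> \<le> scaled n j \<omega>"
proof -
  have "0 \<le> (\<Sum>j\<in>{1..n}. w n j \<omega>)" by (intro sum_nonneg c.weights_nonneg assms(1))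
  then show ?thesis unfolding scaled_def c.pop_def popularity_def
    using assms(2) mean_pos by (intro mult_left_mono divide_right_mono) auto
qed

text \<open>Among the objects left alone, those beyond position \<open>n * a\<close> form an upper set for the order of the
  labels, and those with weight above \<open>y\<close> form an upper or a lower set according to the order of the
  weights. The size of the intersection is therefore a function of three sizes, and the limit
  \<open>\<beta> t a y\<close> is the same function of their limits. The summand \<open>1 / n\<close> is due to rounding.\<close>

lemma count_close:
  assumes \<omega>: "\<omega> \<in> space (M n)" and n: "0 < n" and C: "C \<subseteq> {1..n}"
    and ord: "\<beta> = width_minus \<and> (\<forall>i\<in>{1..n}. \<forall>j\<in>{1..n}. i \<le> j \<longrightarrow> w n j \<omega> \<le> w n i \<omega>) \<or>
      \<beta> = width_plus \<and> (\<forall>i\<in>{1..n}. \<forall>j\<in>{1..n}. i \<le> j \<longrightarrow> w n i \<omega> \<le> w n j \<omega>)"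
    and a: "1 - laplace P t \<le> a" "a \<le> 1"
  shows "\<bar>real (card {i\<in>{1..n}. y < scaled n i \<omega> \<and> unhit_above a n C i}) / real n - \<beta> t a y\<bar> \<le>
     \<bar>real (card (heavy n y \<omega> - C)) / real n - (laplace P t - g_minus P t y)\<bar> +
     2 * \<bar>real (card ({1..n} - C)) / real n - laplace P t\<bar> + 1 / real n"
proof -
  define D where "D = {1..n} - C"
  (* an object left alone lies beyond n a exactly if fewer than k such objects are behind it *)
  define k where "k = nat \<lceil>real n * (1 - a)\<rceil>"
  define U where "U = {i\<in>D. card {j\<in>D. i < j} < k}"
  define V where "V = heavy n y \<omega> - C"
  have fin: "finite D" by (simp add: D_def)
  have UD: "U \<subseteq> D" by (auto simp: U_def)
  have VD: "V \<subseteq> D" by (auto simp: V_def D_def heavy_def)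
  have set: "{i\<in>{1..n}. y < scaled n i \<omega> \<and> unhit_above a n C i} = U \<inter> V"
  proof -
    have "real n * a < real n - real r \<longleftrightarrow> r < k" for r
    proof -
      have "r < k \<longleftrightarrow> int r < \<lceil>real n * (1 - a)\<rceil>" unfolding k_def by linarith
      also have "\<dots> \<longleftrightarrow> real r < real n * (1 - a)" by (simp add: less_ceiling_iff)
      finally show ?thesis by (auto simp: algebra_simps)
    qed
    then show ?thesis
      by (auto simp: unhit_above_def rank_above_def U_def V_def D_def heavy_def)
  qed
  have cU: "card U = min (card D) k" unfolding U_def by (rule card_rank_less[OF fin])
  have Uup: "j \<in> U" if "i \<in> U" "j \<in> D" "i < j" for i j
  proof -
    have "card {l\<in>D. j < l} \<le> card {l\<in>D. i < l}" using that fin by (intro card_mono) auto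
    then show ?thesis using that by (auto simp: U_def)
  qed
  define \<delta> where "\<delta> = real (card D) / real n"
  define \<kappa> where "\<kappa> = real k / real n"
  define \<alpha> where "\<alpha> = real (card V) / real n"
  have \<kappa>: "\<bar>\<kappa> - (1 - a)\<bar> \<le> 1 / real n"
  proof -
    have "0 \<le> real n * (1 - a)" using a by simp
    then have "\<bar>real k - real n * (1 - a)\<bar> \<le> 1" unfolding k_def by linarith
    then have "\<bar>real k - real n * (1 - a)\<bar> / real n \<le> 1 / real n" by (intro divide_right_mono) auto
    moreover have "\<bar>real k - real n * (1 - a)\<bar> / real n = \<bar>\<kappa> - (1 - a)\<bar>"
    proof -
      have "(real k - real n * (1 - a)) / real n = \<kappa> - (1 - a)" using n by (simp add: \<kappa>_def diff_divide_distrib)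
      then show ?thesis by (metis abs_divide abs_of_nat)
    qed
    ultimately show ?thesis by simp
  qed
  have c: "real (card U) / real n = min \<delta> \<kappa>"
    unfolding cU \<delta>_def \<kappa>_def using n by (auto simp: min_def divide_right_mono divide_le_cancel)
  have min1: "\<bar>min \<delta> \<kappa> - (1 - a)\<bar> \<le> \<bar>\<delta> - laplace P t\<bar> + 1 / real n"
    using abs_min_diff_le[of \<delta> \<kappa> "laplace P t" "1 - a"] \<kappa> a by simp
  have main: "\<bar>real (card (U \<inter> V)) / real n - \<beta> t a y\<bar> \<le>
      \<bar>\<alpha> - (laplace P t - g_minus P t y)\<bar> + 2 * \<bar>\<delta> - laplace P t\<bar> + 1 / real n"
    using ord
  proof (elim disjE conjE)
    assume \<beta>: "\<beta> = width_minus" and dec: "\<forall>i\<in>{1..n}. \<forall>j\<in>{1..n}. i \<le> j \<longrightarrow> w n j \<omega> \<le> w n i \<omega>"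
    have Vdown: "j \<in> V" if "i \<in> V" "j \<in> D" "j < i" for i j
    proof -
      have "scaled n i \<omega> \<le> scaled n j \<omega>"
        using that dec VD by (intro scaled_mono[OF \<omega>]) (auto simp: D_def subset_iff)
      then show ?thesis using that by (auto simp: V_def D_def heavy_def)
    qed
    have "card (U \<inter> V) = card U + card V - card D"
      by (rule card_upper_lower[OF fin UD VD Uup Vdown])
    then have "real (card (U \<inter> V)) = max 0 (real (card U) + real (card V) - real (card D))"
      by (simp add: max_def of_nat_diff)
    then have "real (card (U \<inter> V)) / real n = max 0 (min \<delta> \<kappa> + \<alpha> - \<delta>)"
    proof -
      assume e: "real (card (U \<inter> V)) = max 0 (real (card U) + real (card V) - real (card D))"
      have "max 0 z / real n = max 0 (z / real n)" for z
        using n by (simp add: max_def zero_le_divide_iff)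
      then show ?thesis
        unfolding e \<alpha>_def by (simp only: add_divide_distrib diff_divide_distrib c \<delta>_def[symmetric])
    qed
    moreover have "\<beta> t a y = max 0 ((1 - a) + (laplace P t - g_minus P t y) - laplace P t)"
      by (simp add: \<beta> width_minus_def)
    ultimately have "\<bar>real (card (U \<inter> V)) / real n - \<beta> t a y\<bar> \<le>
        \<bar>(min \<delta> \<kappa> + \<alpha> - \<delta>) - ((1 - a) + (laplace P t - g_minus P t y) - laplace P t)\<bar>"
      using abs_max_0_diff_le by simp
    also have "\<dots> \<le> \<bar>min \<delta> \<kappa> - (1 - a)\<bar> + \<bar>\<alpha> - (laplace P t - g_minus P t y)\<bar> + \<bar>\<delta> - laplace P t\<bar>"
      by (rule abs_add_diff_le)
    finally show ?thesis using min1 by simp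
  next
    assume \<beta>: "\<beta> = width_plus" and inc: "\<forall>i\<in>{1..n}. \<forall>j\<in>{1..n}. i \<le> j \<longrightarrow> w n i \<omega> \<le> w n j \<omega>"
    have Vup: "j \<in> V" if "i \<in> V" "j \<in> D" "i < j" for i j
    proof -
      have "scaled n i \<omega> \<le> scaled n j \<omega>"
        using that inc VD by (intro scaled_mono[OF \<omega>]) (auto simp: D_def subset_iff)
      then show ?thesis using that by (auto simp: V_def D_def heavy_def)
    qed
    have "card (U \<inter> V) = min (card U) (card V)"
      by (rule card_upper_upper[OF fin UD VD Uup Vup])
    then have "real (card (U \<inter> V)) / real n = min (min \<delta> \<kappa>) \<alpha>"
      unfolding c[symmetric] \<alpha>_def using n by (auto simp: min_def divide_le_cancel)
    then have "\<bar>real (card (U \<inter> V)) / real n - \<beta> t a y\<bar> \<le>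
        \<bar>min \<delta> \<kappa> - (1 - a)\<bar> + \<bar>\<alpha> - (laplace P t - g_minus P t y)\<bar>"
      unfolding \<beta> width_plus_def using abs_min_diff_le by simp
    moreover have "A \<le> x + 2 * e + q" if "A \<le> m + x" "m \<le> e + q" "0 \<le> e" for A m x e q :: real
      using that by linarith
    ultimately show ?thesis using min1 by (metis abs_ge_zero)
  qed
  show ?thesis using main unfolding set \<alpha>_def \<delta>_def V_def D_def .
qed

text \<open>The counts in the previous lemma have conditional means that are averages over the scaled weights; the
  parameter \<open>d\<close> in the bound of the absolute deviation is arbitrary.\<close>

lemma layer_expectation_converges:
  assumes a: "1 - laplace P t \<le> a" "a \<le> 1" and y: "0 \<le> y" "measure P {y} = 0"
  shows "(\<lambda>n. c.expectation n (layer a n y)) \<longlonglongrightarrow> \<beta> t a y"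
proof -
  let ?G = "\<lambda>n \<omega>. \<bar>avg n (\<lambda>x. if x \<le> y then exp (- t * x) else 0) \<omega> - g_minus P t y\<bar>"
  let ?D = "\<lambda>n \<omega>. \<bar>avg n (\<lambda>x. exp (- t * x)) \<omega> - laplace P t\<bar>"
  have L: "0 \<le> laplace P t" "laplace P t \<le> 1"
    using laplace_gt[OF t_nonneg] measure_nonneg[of P "{0}"] laplace_le_1[OF t_nonneg] by linarith+
  have g: "0 \<le> laplace P t - g_minus P t y" "laplace P t - g_minus P t y \<le> 1"
    using g_minus_le[OF t_nonneg y(1)] g_minus_nonneg[of t y] L by linarith+
  have iG: "integrable (M n) (?G n)" and iD: "integrable (M n) (?D n)" for n
  proof -
    show "integrable (M n) (?G n)"
    proof (rule integrable_bounded[where K = 2])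
      fix \<omega> assume \<omega>: "\<omega> \<in> space (M n)"
      have "\<bar>avg n (\<lambda>x. if x \<le> y then exp (- t * x) else 0) \<omega>\<bar> \<le> 1"
      proof (rule avg_abs_le[OF _ \<omega>])
        fix x :: real assume "0 \<le> x"
        then show "\<bar>if x \<le> y then exp (- t * x) else 0\<bar> \<le> 1" using t_pos by (cases "x \<le> y") simp_all
      qed
      then show "\<bar>?G n \<omega>\<bar> \<le> 2" using g g_minus_nonneg[of t y] L by linarith
    qed (intro borel_measurable_abs borel_measurable_diff avg_measurable borel_measurable_const, measurable)
    show "integrable (M n) (?D n)"
    proof (rule integrable_bounded[where K = 2])
      fix \<omega> assume \<omega>: "\<omega> \<in> space (M n)"
      have "\<bar>avg n (\<lambda>x. exp (- t * x)) \<omega>\<bar> \<le> 1" using t_pos by (intro avg_abs_le[OF _ \<omega>]) simp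
      then show "\<bar>?D n \<omega>\<bar> \<le> 2" using L by linarith
    qed (intro borel_measurable_abs borel_measurable_diff avg_measurable borel_measurable_const, measurable)
  qed
  have iB: "integrable (M n) (layer a n y)" for n
    using layer_bounds[OF _ y(1)] by (intro integrable_bounded[OF layer_measurable, where K = "exp (- t * y)"]) auto
  have "(\<lambda>n. c.expectation n (layer a n y) - \<beta> t a y) \<longlonglongrightarrow> 0"
  proof (rule tendsto_null_bound[where C = 3])
    fix d :: real assume d: "0 < d"
    (* the deviation of the number of objects left alone enters count_close twice; once more it bounds
       the deviation of the heavy ones, whose mean number is the total minus that of the light ones *)
    let ?g = "\<lambda>n. (3 / real n + 3 * c.expectation n (?D n) + c.expectation n (?G n)) / d + 1 / real n"
    have "?g \<longlonglongrightarrow> (3 * 0 + 3 * 0 + 0) / d + 0"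
    proof (intro tendsto_add tendsto_divide tendsto_const lim_1_over_n tendsto_mult_left)
      show "(\<lambda>n. 3 / real n) \<longlonglongrightarrow> 3 * 0" using lim_const_over_n[of 3] by simp
      show "(\<lambda>n. c.expectation n (?D n)) \<longlonglongrightarrow> 0" by (rule average_exp_converges[OF t_nonneg])
      show "(\<lambda>n. c.expectation n (?G n)) \<longlonglongrightarrow> 0" by (rule indicator_average_converges[OF y(2,1)])
    qed (use d in simp)
    then have glim: "?g \<longlonglongrightarrow> 0" by simp
    have bound: "\<bar>c.expectation n (layer a n y) - \<beta> t a y\<bar> \<le> 3 * d + ?g n" if n: "0 < n" for n
    proof -
      let ?bound = "\<lambda>\<omega>. 3 * d + (3 / real n + 3 * ?D n \<omega> + ?G n \<omega>) / d + 1 / real n"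
      have pointwise: "AE \<omega> in M n. \<bar>layer a n y \<omega> - \<beta> t a y\<bar> \<le> ?bound \<omega>"
      proof -
        have "AE \<omega> in M n. \<beta> = width_minus \<and> (\<forall>i\<in>{1..n}. \<forall>j\<in>{1..n}. i \<le> j \<longrightarrow> w n j \<omega> \<le> w n i \<omega>) \<or>
          \<beta> = width_plus \<and> (\<forall>i\<in>{1..n}. \<forall>j\<in>{1..n}. i \<le> j \<longrightarrow> w n i \<omega> \<le> w n j \<omega>)"
          using sorted
        proof (elim disjE conjE)
          assume "\<beta> = width_minus" "\<forall>n. AE \<omega> in M n. \<forall>i\<in>{1..n}. \<forall>j\<in>{1..n}. i \<le> j \<longrightarrow> w n j \<omega> \<le> w n i \<omega>"
          then show ?thesis by (auto elim!: allE[of _ n] elim: eventually_mono)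
        next
          assume "\<beta> = width_plus" "\<forall>n. AE \<omega> in M n. \<forall>i\<in>{1..n}. \<forall>j\<in>{1..n}. i \<le> j \<longrightarrow> w n i \<omega> \<le> w n j \<omega>"
          then show ?thesis by (auto elim!: allE[of _ n] elim: eventually_mono)
        qed
        then show ?thesis using AE_space
        proof eventually_elim
          case (elim \<omega>)
          note r = hit_pr_range[OF t_nonneg _ elim(2)]
          let ?sm = "subset_mean {1..n} (hit_pr n t \<omega>)"
          have joint: "heavy n y \<omega> \<subseteq> {1..n}" by (auto simp: heavy_def)
          have ne: "{1..n} \<noteq> {}" using n by auto
          have "\<bar>layer a n y \<omega> - \<beta> t a y\<bar> \<le>
            ?sm (\<lambda>C. \<bar>real (card {i\<in>{1..n}. y < scaled n i \<omega> \<and> unhit_above a n C i}) / real n - \<beta> t a y\<bar>)"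
            unfolding layer_eq_subset_mean by (rule subset_mean_abs_diff_le) (use r in auto)
          also have "\<dots> \<le> ?sm (\<lambda>C. \<bar>real (card (heavy n y \<omega> - C)) / card {1..n} - (laplace P t - g_minus P t y)\<bar> +
             2 * \<bar>real (card ({1..n} - C)) / card {1..n} - laplace P t\<bar> + 1 / real n)"
          proof (rule subset_mean_mono)
            fix C assume C: "C \<subseteq> {1..n}"
            show "\<bar>real (card {i\<in>{1..n}. y < scaled n i \<omega> \<and> unhit_above a n C i}) / real n - \<beta> t a y\<bar> \<le>
              \<bar>real (card (heavy n y \<omega> - C)) / card {1..n} - (laplace P t - g_minus P t y)\<bar> +
              2 * \<bar>real (card ({1..n} - C)) / card {1..n} - laplace P t\<bar> + 1 / real n"
              using count_close[OF elim(2) n C elim(1) a, of y] by simp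
          qed (use r in auto)
          also have "\<dots> = ?sm (\<lambda>C. \<bar>real (card (heavy n y \<omega> - C)) / card {1..n} - (laplace P t - g_minus P t y)\<bar>) +
             2 * ?sm (\<lambda>C. \<bar>real (card ({1..n} - C)) / card {1..n} - laplace P t\<bar>) + 1 / real n"
            unfolding subset_mean_add subset_mean_cmult by (simp add: subset_mean_const)
          finally have 1: "\<bar>layer a n y \<omega> - \<beta> t a y\<bar> \<le>
             ?sm (\<lambda>C. \<bar>real (card (heavy n y \<omega> - C)) / card {1..n} - (laplace P t - g_minus P t y)\<bar>) +
             2 * ?sm (\<lambda>C. \<bar>real (card ({1..n} - C)) / card {1..n} - laplace P t\<bar>) + 1 / real n" .
          have hv: "(\<Sum>j\<in>heavy n y \<omega>. 1 - hit_pr n t \<omega> j) / card {1..n} =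
              avg n (\<lambda>x. exp (- t * x)) \<omega> - avg n (\<lambda>x. if x \<le> y then exp (- t * x) else 0) \<omega>"
          proof -
            have "(\<Sum>j\<in>heavy n y \<omega>. exp (- t * scaled n j \<omega>)) = (\<Sum>j\<in>{1..n}. if y < scaled n j \<omega> then exp (- t * scaled n j \<omega>) else 0)"
              unfolding heavy_def by (rule sum.inter_filter) simp
            also have "\<dots> = (\<Sum>j\<in>{1..n}. exp (- t * scaled n j \<omega>) - (if scaled n j \<omega> \<le> y then exp (- t * scaled n j \<omega>) else 0))"
              by (intro sum.cong) auto
            finally show ?thesis unfolding one_minus_hit_pr avg_def by (simp add: sum_subtractf diff_divide_distrib)
          qed
          have 2: "?sm (\<lambda>C. \<bar>real (card (heavy n y \<omega> - C)) / card {1..n} - (laplace P t - g_minus P t y)\<bar>) \<le>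
             d + (1 / real n + (?D n \<omega> + ?G n \<omega>)) / d"
          proof -
            have "?sm (\<lambda>C. \<bar>real (card (heavy n y \<omega> - C)) / card {1..n} - (laplace P t - g_minus P t y)\<bar>) \<le>
              d + (1 / card {1..n} + \<bar>(\<Sum>j\<in>heavy n y \<omega>. 1 - hit_pr n t \<omega> j) / card {1..n} - (laplace P t - g_minus P t y)\<bar>) / d"
              by (rule subset_mean_abs_deviation[OF finite_atLeastAtMost ne joint _ g d]) (use r in auto)
            also have "\<dots> \<le> d + (1 / real n + (?D n \<omega> + ?G n \<omega>)) / d"
              unfolding hv using d by (intro add_left_mono divide_right_mono) auto
            finally show ?thesis .
          qed
          have 3: "?sm (\<lambda>C. \<bar>real (card ({1..n} - C)) / card {1..n} - laplace P t\<bar>) \<le> d + (1 / real n + ?D n \<omega>) / d"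
          proof -
            have "?sm (\<lambda>C. \<bar>real (card ({1..n} - C)) / card {1..n} - laplace P t\<bar>) \<le>
              d + (1 / card {1..n} + \<bar>(\<Sum>j\<in>{1..n}. 1 - hit_pr n t \<omega> j) / card {1..n} - laplace P t\<bar>) / d"
              by (rule subset_mean_abs_deviation[OF finite_atLeastAtMost ne order_refl _ L d]) (use r in auto)
            then show ?thesis using sum_exp_avg[of n t \<omega>] by simp
          qed
          have eq: "?bound \<omega> = (d + (1 / real n + (?D n \<omega> + ?G n \<omega>)) / d) + 2 * (d + (1 / real n + ?D n \<omega>) / d) + 1 / real n"
            using d by (simp add: add_divide_distrib)
          show ?case unfolding eq
            by (rule order_trans[OF 1]) (intro add_mono mult_left_mono 2 3 order_refl, simp)
        qed
      qed
      have "c.expectation n (layer a n y) - \<beta> t a y = c.expectation n (\<lambda>\<omega>. layer a n y \<omega> - \<beta> t a y)"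
        using iB c.prob_space[of n] by simp
      then have "\<bar>c.expectation n (layer a n y) - \<beta> t a y\<bar> \<le> c.expectation n (\<lambda>\<omega>. \<bar>layer a n y \<omega> - \<beta> t a y\<bar>)"
        using integral_abs_bound by simp
      also have "\<dots> \<le> c.expectation n ?bound"
        using iB iG iD by (intro integral_mono_AE pointwise) auto
      also have "\<dots> = 3 * d + ?g n"
        using iG iD c.prob_space[of n] by simp
      finally show ?thesis .
    qed
    have "\<forall>\<^sub>F n in sequentially. \<bar>c.expectation n (layer a n y) - \<beta> t a y\<bar> \<le> 3 * d + ?g n"
      by (rule eventually_mono[OF eventually_gt_at_top[of 0]]) (rule bound)
    then show "\<exists>g. g \<longlonglongrightarrow> 0 \<and> (\<forall>\<^sub>F n in sequentially. \<bar>c.expectation n (layer a n y) - \<beta> t a y\<bar> \<le> 3 * d + g n)"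
      using glim by (intro exI[of _ ?g] conjI)
  qed simp
  then show ?thesis by (rule Lim_null[THEN iffD2])
qed

lemma nn_integral_exp_tail: "(\<integral>\<^sup>+y. ennreal (exp (- t * y)) * indicator {0..} y \<partial>lborel) < \<infinity>"
proof -
  have "(\<integral>\<^sup>+y. ennreal (exp (- t * y)) * indicator {0..} y \<partial>lborel) = ennreal (0 - (- exp (- t * 0) / t))"
  proof (rule nn_integral_FTC_atLeast)
    show "((\<lambda>y. - exp (- t * y) / t) \<longlongrightarrow> 0) at_top" using t_pos by real_asymp
    fix y :: real
    show "((\<lambda>y. - exp (- t * y) / t) has_real_derivative exp (- t * y)) (at y)"
      using t_pos by (auto intro!: derivative_eq_intros)
  qed auto
  then show ?thesis by simp
qed

text \<open>Dominated convergence with respect to \<open>y\<close>, outside of the countably many atoms of \<open>P\<close>.\<close>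

lemma joint_mean_above_tendsto:
  assumes a: "1 - laplace P t \<le> a" "a \<le> 1"
  shows "(\<lambda>n. c.joint_mean n (time n) (unhit_above a n)) \<longlonglongrightarrow> 1 - cdf (law gt t) a"
proof -
  let ?u = "\<lambda>n y. ennreal (c.expectation n (layer a n y)) * indicator {0..} y"
  have um: "?u n \<in> borel_measurable lborel" for n
  proof -
    have "(\<lambda>(y, \<omega>). layer a n y \<omega>) \<in> borel_measurable (lborel \<Otimes>\<^sub>M M n)"
      using measurable_compose[OF measurable_pair_swap' layer_joint_measurable[of a n]] by (simp add: case_prod_unfold)
    then have "(\<lambda>y. c.expectation n (layer a n y)) \<in> borel_measurable lborel" by (rule c.borel_measurable_lebesgue_integral)
    then show ?thesis by measurable
  qed
  have gm: "g_minus P t \<in> borel_measurable borel"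
    by (rule borel_measurable_mono) (auto intro!: monoI g_minus_mono t_nonneg)
  have "\<beta> t a \<in> borel_measurable borel"
    using bc gm unfolding boundary_case_def width_minus_def[abs_def] width_plus_def[abs_def] by auto
  then have \<beta>m: "(\<lambda>y. ennreal (\<beta> t a y) * indicator {0..} y) \<in> borel_measurable lborel" by measurable
  have "(\<lambda>n. \<integral>\<^sup>+y. ?u n y \<partial>lborel) \<longlonglongrightarrow> (\<integral>\<^sup>+y. ennreal (\<beta> t a y) * indicator {0..} y \<partial>lborel)"
  proof (rule nn_integral_dominated_convergence[OF um \<beta>m])
    show "(\<lambda>y. ennreal (exp (- t * y)) * indicator {0..} y) \<in> borel_measurable lborel" by measurable
    show "(\<integral>\<^sup>+y. ennreal (exp (- t * y)) * indicator {0..} y \<partial>lborel) < \<infinity>" by (rule nn_integral_exp_tail)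
    show "AE y in lborel. ?u n y \<le> ennreal (exp (- t * y)) * indicator {0..} y" for n
    proof (rule AE_I2)
      fix y :: real
      show "?u n y \<le> ennreal (exp (- t * y)) * indicator {0..} y"
      proof (cases "0 \<le> y")
        case True
        have "c.expectation n (layer a n y) \<le> c.expectation n (\<lambda>_. exp (- t * y))"
          using layer_bounds[OF _ True]
          by (intro integral_mono integrable_bounded[OF layer_measurable, where K = "exp (- t * y)"]) auto
        then show ?thesis using True c.prob_space[of n] by (simp add: ennreal_leI)
      qed simp
    qed
    have "AE y in lborel. y \<notin> {y. measure P {y} \<noteq> 0}"
      by (intro AE_not_in countable_imp_null_set_lborel countable_support)
    then show "AE y in lborel. (\<lambda>n. ?u n y) \<longlonglongrightarrow> ennreal (\<beta> t a y) * indicator {0..} y"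
    proof eventually_elim
      case (elim y)
      show ?case
      proof (cases "0 \<le> y")
        case True
        then have "(\<lambda>n. ennreal (c.expectation n (layer a n y))) \<longlonglongrightarrow> ennreal (\<beta> t a y)"
          using elim by (intro tendsto_ennrealI layer_expectation_converges a) auto
        then show ?thesis using True by simp
      qed simp
    qed
  qed
  then have "(\<lambda>n. ennreal (1 / \<mu>) * (\<integral>\<^sup>+y. ?u n y \<partial>lborel)) \<longlonglongrightarrow> ennreal (1 - cdf (law gt t) a)"
    unfolding cdf_law_above[OF bc t_nonneg a] by (intro ennreal_tendsto_cmult) auto
  moreover have "\<forall>\<^sub>F n in sequentially. ennreal (1 / \<mu>) * (\<integral>\<^sup>+y. ?u n y \<partial>lborel) = ennreal (c.joint_mean n (time n) (unhit_above a n))"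
    using eventually_gt_at_top[of 0] by eventually_elim (rule joint_mean_layer_cake[symmetric])
  ultimately have lim: "(\<lambda>n. ennreal (c.joint_mean n (time n) (unhit_above a n))) \<longlonglongrightarrow> ennreal (1 - cdf (law gt t) a)"
    by (rule Lim_transform_eventually)
  have nn: "0 \<le> c.joint_mean n (time n) (unhit_above a n)" for n
  proof -
    have "0 \<le> c.expectation n (\<lambda>\<omega>. \<Sum>i\<in>{1..n}. c.pop n i \<omega> * rank_prob a n i \<omega>)"
      by (intro integral_nonneg_AE AE_I2 sum_nonneg mult_nonneg_nonneg c.pop_nonneg rank_prob_bounds(1))
    then show ?thesis unfolding c.joint_mean_def rank_prob_def .
  qed
  interpret L: prob_space "law gt t" by (rule prob_space_law[OF bc t_nonneg])
  have "0 \<le> 1 - cdf (law gt t) a" by (simp add: cdf_def)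
  with lim show ?thesis using nn by (subst (asm) tendsto_ennreal_iff) auto
qed

text \<open>Beyond the proportion \<open>a > 1 - laplace P t\<close> there are, up to a small probability, only objects that
  were left alone since time 0.\<close>

lemma cost_cdf_above:
  assumes a: "1 - laplace P t < a" "a \<le> 1"
  shows "(\<lambda>n. cost_cdf n a) \<longlonglongrightarrow> cdf (law gt t) a"
proof -
  define d where "d = a - (1 - laplace P t)"
  have d: "0 < d" using a by (simp add: d_def)
  have a0: "0 < a" using a laplace_le_1[OF t_nonneg] by linarith
  have joint: "(\<lambda>n. c.prob n (joint n t (unhit_above a n))) \<longlonglongrightarrow> 1 - cdf (law gt t) a"
    by (rule joint_event_tendsto) (use t_pos a joint_mean_above_tendsto[of a] in auto)
  have cost_cdf: "cost_cdf n a = 1 - c.prob n {\<omega>\<in>space (M n). a < cost n \<omega>}" for n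
  proof -
    have "{\<omega>\<in>space (M n). cost n \<omega> \<le> a} = space (M n) - {\<omega>\<in>space (M n). a < cost n \<omega>}" by auto
    moreover have "{\<omega>\<in>space (M n). a < cost n \<omega>} \<in> sets (M n)" using cost_measurable by measurable
    ultimately show ?thesis unfolding cost_cdf_def by (simp only: c.prob_compl)
  qed
  have ae: "AE \<omega> in M n. (\<omega> \<in> joint n t (unhit_above a n) \<longrightarrow> a < cost n \<omega>) \<and>
      (\<omega> \<in> space (M n) \<and> a < cost n \<omega> \<longrightarrow> \<omega> \<in> joint n t (unhit_above a n) \<union> deviant n t d)" if n: "0 < n" for n
    using c.no_ties_all[OF time_nonneg, of n n] cost_next_bounds[OF t_nonneg order_refl n] AE_space
  proof eventually_elim
    case (elim \<omega>)
    interpret request_configuration n "cfg n \<omega>" using elim(3) c.configuration by blast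
    have hits: "hits n t \<omega> = requested_in n (cfg n \<omega>) 0 (time n)" by (simp add: hits_def)
    have pos: "a < cost n \<omega> \<longleftrightarrow> unhit_above a n (hits n t \<omega>) i"
      if nx: "next_label n (cfg n \<omega>) (time n) = Some i" and nh: "i \<notin> hits n t \<omega>" for i
    proof -
      have i: "i \<in> {1..n}" using nx request_label_in_range unfolding next_label_def by blast
      have "real (position_at n (\<pi> n) (cfg n \<omega>) (time n) i) = real n - real (rank_above n (hits n t \<omega>) i)"
        unfolding rank_above_def hits
        by (rule c.never_requested_position[OF initial elim(3) time_nonneg elim(1)]) (use i nh hits in auto)
      then have "cost n \<omega> = (real n - real (rank_above n (hits n t \<omega>) i)) / real n"
        unfolding cost_def search_cost_next[OF nx] by simp
      then show ?thesis using n nh by (simp add: unhit_above_def pos_less_divide_eq mult.commute)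
    qed
    show ?case
    proof (intro conjI impI)
      assume "\<omega> \<in> joint n t (unhit_above a n)"
      then obtain i where i: "next_label n (cfg n \<omega>) (time n) = Some i" "unhit_above a n (hits n t \<omega>) i"
        unfolding c.joint_event_def hits_def by blast
      then have "i \<notin> hits n t \<omega>" by (simp add: unhit_above_def)
      then show "a < cost n \<omega>" using pos[OF i(1)] i(2) by blast
    next
      assume asm: "\<omega> \<in> space (M n) \<and> a < cost n \<omega>"
      show "\<omega> \<in> joint n t (unhit_above a n) \<union> deviant n t d"
      proof (cases "next_label n (cfg n \<omega>) (time n)")
        case None
        then have "cost n \<omega> = 0" unfolding cost_def by (simp add: search_cost_None)
        then show ?thesis using asm a0 by simp
      next
        case (Some i)
        show ?thesis
        proof (cases "i \<in> hits n t \<omega>")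
          case True
          then have "cost n \<omega> \<le> card (hits n t \<omega>) / real n" using elim(2) Some by blast
          then have "d \<le> \<bar>real (card (hits n t \<omega>)) / real n - (1 - laplace P t)\<bar>"
            using asm unfolding d_def by linarith
          then show ?thesis using asm by (simp add: deviant_def)
        next
          case False
          then have "unhit_above a n (hits n t \<omega>) i" using pos[OF Some] asm by blast
          then have "\<omega> \<in> joint n t (unhit_above a n)" using Some asm unfolding c.joint_event_def hits_def by blast
          then show ?thesis by simp
        qed
      qed
    qed
  qed
  have gts: "{\<omega>\<in>space (M n). a < cost n \<omega>} \<in> sets (M n)" for n using cost_measurable by measurable
  have "(\<lambda>n. c.prob n {\<omega>\<in>space (M n). a < cost n \<omega>}) \<longlonglongrightarrow> 1 - cdf (law gt t) a"
  proof (rule tendsto_sandwich[OF _ _ joint])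
    show "\<forall>\<^sub>F n in sequentially. c.prob n (joint n t (unhit_above a n)) \<le> c.prob n {\<omega>\<in>space (M n). a < cost n \<omega>}"
      using eventually_gt_at_top[of 0]
    proof eventually_elim
      case (elim n)
      show ?case
      proof (rule c.finite_measure_mono_AE[OF _ gts])
        show "AE \<omega> in M n. \<omega> \<in> joint n t (unhit_above a n) \<longrightarrow> \<omega> \<in> {\<omega>\<in>space (M n). a < cost n \<omega>}"
          using ae[OF elim] AE_space by eventually_elim blast
      qed
    qed
    show "\<forall>\<^sub>F n in sequentially. c.prob n {\<omega>\<in>space (M n). a < cost n \<omega>} \<le> c.prob n (joint n t (unhit_above a n)) + c.prob n (deviant n t d)"
      using eventually_gt_at_top[of 0]
    proof eventually_elim
      case (elim n)
      have "c.prob n {\<omega>\<in>space (M n). a < cost n \<omega>} \<le> c.prob n (joint n t (unhit_above a n) \<union> deviant n t d)"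
      proof (rule c.finite_measure_mono_AE)
        show "AE \<omega> in M n. \<omega> \<in> {\<omega>\<in>space (M n). a < cost n \<omega>} \<longrightarrow> \<omega> \<in> joint n t (unhit_above a n) \<union> deviant n t d"
          using ae[OF elim] by eventually_elim blast
      qed (intro sets.Un c.joint_event_sets deviant_sets)
      also have "\<dots> \<le> c.prob n (joint n t (unhit_above a n)) + c.prob n (deviant n t d)"
        by (intro measure_Un_le c.joint_event_sets deviant_sets)
      finally show ?case .
    qed
    show "(\<lambda>n. c.prob n (joint n t (unhit_above a n)) + c.prob n (deviant n t d)) \<longlonglongrightarrow> 1 - cdf (law gt t) a"
      using tendsto_add[OF joint deviant_vanishes[OF t_nonneg order_refl d]] by simp
  qed
  then have "(\<lambda>n. 1 - c.prob n {\<omega>\<in>space (M n). a < cost n \<omega>}) \<longlonglongrightarrow> 1 - (1 - cdf (law gt t) a)"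
    by (intro tendsto_diff tendsto_const)
  then show ?thesis unfolding cost_cdf by simp
qed

lemma cdf_law_nonpos: "x \<le> 0 \<Longrightarrow> cdf (law gt t) x = 0"
proof -
  assume x: "x \<le> 0"
  interpret L: prob_space "law gt t" by (rule prob_space_law[OF bc t_nonneg])
  have "cdf (law gt t) x \<le> cdf (law gt t) 0"
    unfolding cdf_def using x by (intro L.finite_measure_mono) auto
  also have "cdf (law gt t) 0 = 0"
    using cdf_law_below[OF bc t_nonneg order_refl t_nonneg] mean_pos by (simp del: One_nat_def)
  finally show ?thesis using measure_nonneg[of "law gt t" "{..x}"] by (simp add: cdf_def)
qed

lemma cdf_law_ge_1: "1 \<le> x \<Longrightarrow> cdf (law gt t) x = 1"
proof -
  assume x: "1 \<le> x"
  interpret L: prob_space "law gt t" by (rule prob_space_law[OF bc t_nonneg])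
  have a: "1 - laplace P t \<le> 1" using laplace_gt[OF t_nonneg] measure_nonneg[of P "{0}"] by linarith
  have "\<beta> t 1 y \<le> 0" if "0 \<le> y" for y
    using bc g_minus_nonneg[of t y] g_minus_le[OF t_nonneg that]
    by (auto simp: boundary_case_def width_minus_def width_plus_def)
  then have "(\<integral>\<^sup>+y. ennreal (\<beta> t 1 y) * indicator {0..} y \<partial>lborel) = (\<integral>\<^sup>+y. 0 \<partial>(lborel :: real measure))"
    by (intro nn_integral_cong) (auto simp: indicator_def ennreal_neg)
  then have "ennreal (1 - cdf (law gt t) 1) = 0" using cdf_law_above[OF bc t_nonneg a order_refl] by simp
  then have "1 \<le> cdf (law gt t) 1" by (simp add: ennreal_eq_0_iff)
  also have "\<dots> \<le> cdf (law gt t) x" unfolding cdf_def using x by (intro L.finite_measure_mono) auto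
  finally show ?thesis using L.prob_le_1[of "{..x}"] by (simp add: cdf_def)
qed

lemma below_cases:
  assumes "0 < x" "x \<le> 1 - laplace P t" obtains s where "0 < s" "s \<le> t" "x = 1 - laplace P s"
proof -
  have "x < 1 - p0" using assms laplace_gt[OF t_nonneg] by linarith
  then obtain s where s: "0 < s" "x = 1 - laplace P s" using rank_time_cases[OF assms(1)] by metis
  have "s \<le> t" using laplace_strict[OF t_nonneg, of s] s assms by (cases "s \<le> t") auto
  then show ?thesis using that s by blast
qed

text \<open>Comparing different points \<open>y < x\<close> suffices for convergence at the continuity points of the limit, and
  it spares a separate treatment of the point \<open>1 - laplace P t\<close>.\<close>

lemma cost_cdf_eventually_ge:
  assumes "y < x" "0 < e" shows "\<forall>\<^sub>F n in sequentially. cdf (law gt t) y - e < cost_cdf n x"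
proof -
  consider "y \<le> 0" | "0 < y" "y \<le> 1 - laplace P t" | "1 - laplace P t < y" "y \<le> 1" | "1 < y" by linarith
  then show ?thesis
  proof cases
    case 1
    then have "cdf (law gt t) y - e < cost_cdf n x" for n
      using cdf_law_nonpos[OF 1] assms(2) measure_nonneg[of "M n" "{\<omega>\<in>space (M n). cost n \<omega> \<le> x}"]
      unfolding cost_cdf_def by linarith
    then show ?thesis by simp
  next
    case 2
    then obtain s where s: "0 < s" "s \<le> t" "y = 1 - laplace P s" by (rule below_cases)
    have "cdf (law gt t) y = 1 - moment 1 s / \<mu>"
      unfolding s(3) by (rule cdf_law_below[OF bc t_nonneg]) (use s in auto)
    then show ?thesis using cost_cdf_lower[OF s(1,2) _ assms(2), of x] assms(1) s(3) by simp
  next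
    case 3
    have "\<forall>\<^sub>F n in sequentially. cdf (law gt t) y - e < cost_cdf n y"
      using cost_cdf_above[OF 3] assms(2) by (intro order_tendstoD(1)) auto
    then show ?thesis by eventually_elim (use cost_cdf_mono[of y x] assms(1) in \<open>auto intro: less_le_trans\<close>)
  next
    case 4
    show ?thesis using eventually_gt_at_top[of 0]
    proof eventually_elim
      case (elim n)
      have "{\<omega>\<in>space (M n). cost n \<omega> \<le> x} = space (M n)" using cost_bounds(2)[OF _ elim] 4 assms(1) by force
      then have "cost_cdf n x = 1" unfolding cost_cdf_def by (simp add: c.prob_space)
      then show ?case using cdf_law_ge_1[of y] 4 assms(2) by simp
    qed
  qed
qed

lemma cost_cdf_eventually_le:
  assumes "x < y" "0 < e" shows "\<forall>\<^sub>F n in sequentially. cost_cdf n x < cdf (law gt t) y + e"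
proof -
  consider "y \<le> 0" | "0 < y" "y \<le> 1 - laplace P t" | "1 - laplace P t < y" "y \<le> 1" | "1 < y" by linarith
  then show ?thesis
  proof cases
    case 1
    show ?thesis using eventually_gt_at_top[of 0]
    proof eventually_elim
      case (elim n)
      have "{\<omega>\<in>space (M n). cost n \<omega> \<le> x} = {}" using cost_bounds(1)[OF _ elim] 1 assms(1) by force
      then have "cost_cdf n x = 0" unfolding cost_cdf_def by (simp only: measure_empty)
      then show ?case using cdf_law_nonpos[OF 1] assms(2) by simp
    qed
  next
    case 2
    then obtain s where s: "0 < s" "s \<le> t" "y = 1 - laplace P s" by (rule below_cases)
    have "cdf (law gt t) y = 1 - moment 1 s / \<mu>"
      unfolding s(3) by (rule cdf_law_below[OF bc t_nonneg]) (use s in auto)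
    then show ?thesis using cost_cdf_upper[OF s(1,2) _ assms(2), of x] assms(1) s(3) by simp
  next
    case 3
    have "\<forall>\<^sub>F n in sequentially. cost_cdf n y < cdf (law gt t) y + e"
      using cost_cdf_above[OF 3] assms(2) by (intro order_tendstoD(2)) auto
    then show ?thesis by eventually_elim (use cost_cdf_mono[of x y] assms(1) in \<open>auto intro: le_less_trans\<close>)
  next
    case 4
    have "cost_cdf n x < cdf (law gt t) y + e" for n
      using cdf_law_ge_1[of y] 4 assms(2) c.prob_le_1[of n "{\<omega>\<in>space (M n). cost n \<omega> \<le> x}"]
      unfolding cost_cdf_def by linarith
    then show ?thesis by simp
  qed
qed

lemma search_cost_weak_conv: "weak_conv_m (\<lambda>n. distr (M n) borel (cost n)) (law gt t)"
  unfolding weak_conv_m_def weak_conv_def cost_cdf_eq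
proof (intro allI impI)
  fix x assume cont: "isCont (cdf (law gt t)) x"
  show "(\<lambda>n. cost_cdf n x) \<longlonglongrightarrow> cdf (law gt t) x"
  proof (rule LIMSEQ_I)
    fix r :: real assume r: "0 < r"
    obtain h where h: "0 < h" "\<And>z. \<bar>z - x\<bar> < h \<Longrightarrow> \<bar>cdf (law gt t) z - cdf (law gt t) x\<bar> < r / 2"
      using cont r unfolding continuous_at_real_range by (metis half_gt_zero real_norm_def)
    have 1: "\<forall>\<^sub>F n in sequentially. cdf (law gt t) (x - h / 2) - r / 2 < cost_cdf n x"
      by (rule cost_cdf_eventually_ge) (use h(1) r in auto)
    have 2: "\<forall>\<^sub>F n in sequentially. cost_cdf n x < cdf (law gt t) (x + h / 2) + r / 2"
      by (rule cost_cdf_eventually_le) (use h(1) r in auto)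
    have 3: "\<bar>cdf (law gt t) (x - h / 2) - cdf (law gt t) x\<bar> < r / 2"
      "\<bar>cdf (law gt t) (x + h / 2) - cdf (law gt t) x\<bar> < r / 2"
      using h(2)[of "x - h / 2"] h(2)[of "x + h / 2"] h(1) by simp_all
    from 1 2 have "\<forall>\<^sub>F n in sequentially. norm (cost_cdf n x - cdf (law gt t) x) < r"
    proof eventually_elim
      case (elim n)
      then show ?case unfolding real_norm_def using 3 by linarith
    qed
    then show "\<exists>no. \<forall>n\<ge>no. norm (cost_cdf n x - cdf (law gt t) x) < r" by (simp add: eventually_sequentially)
  qed
qed

end

theorem corollary3p2:
  fixes P :: "real measure" and \<mu> :: real
    and M :: "nat \<Rightarrow> 'a measure"
    and w :: "nat \<Rightarrow> nat \<Rightarrow> 'a \<Rightarrow> real"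
    and \<pi> :: "nat \<Rightarrow> nat \<Rightarrow> nat"
    and T :: "nat \<Rightarrow> nat \<Rightarrow> 'a \<Rightarrow> real set"
    and gt :: "real \<Rightarrow> real \<Rightarrow> real"
    and law_S :: "real \<Rightarrow> real measure" and law_Sinf :: "real measure"
  assumes P: "P \<in> nonneg_distributions"
    and finite_mean: "integrable P (\<lambda>x. x)"
    and mean: "\<mu> = (\<integral>x. x \<partial>P)" "\<mu> \<noteq> 0"
    and chain: "\<And>n. move_to_front_chain (M n) n (w n) (\<pi> n) (T n)"
    and LLN: "LLN_minus P M w \<pi> \<and> gt = g_tilde_minus P \<or>
              LLN_plus P M w \<pi> \<and> gt = g_tilde_plus P"
    and law_S: "\<And>t. law_S t = density lborel (\<lambda>x. ennreal (dens P gt t x))"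
    and law_Sinf: "law_Sinf = density lborel (\<lambda>x. ennreal (dens_inf P x))"
  shows "(probability_density (dens_inf P)) \<and>
    (\<forall>t\<ge>0. probability_density (dens P gt t)) \<and>
    (\<forall>t>0. weak_conv_m
           (\<lambda>n. distr (M n) borel
              (\<lambda>\<omega>. real (search_cost n (\<pi> n) (\<lambda>i. T n i \<omega>) (real n * \<mu> * t)) / real n))
           (law_S t)) \<and>
    (\<forall>t>0. (\<lambda>n. measure (M n)
              {\<omega> \<in> space (M n). search_cost_out n (\<pi> n) (\<lambda>i. T n i \<omega>) (real n * \<mu> * t) > 0})
           \<longlonglongrightarrow> measure (law_S t) {1 - laplace P t<..}) \<and>
    (\<forall>t>0. measure (law_S t) {1 - laplace P t<..} = measure law_Sinf {1 - laplace P t<..}) \<and>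
    (\<forall>t>0. measure law_Sinf {1 - laplace P t<..} = \<bar>laplace' P t\<bar> / \<mu>) \<and>
    (\<forall>t\<ge>0. tv_norm_diff (law_S t) law_Sinf \<le> 2 * (\<bar>laplace' P t\<bar> / \<mu>))"
proof -
  interpret mean_law P \<mu> by (rule mean_law.intro) fact+
  define \<beta> where "\<beta> = (if LLN_minus P M w \<pi> \<and> gt = g_tilde_minus P then width_minus else width_plus)"
  have LLN': "LLN P M w" and initial: "i \<in> {1..n} \<Longrightarrow> \<pi> n i = i" for i n
    using LLN unfolding LLN_minus_def LLN_plus_def by blast+
  have sorted: "gt = g_tilde_minus P \<and> \<beta> = width_minus \<and>
       (\<forall>n. AE \<omega> in M n. \<forall>i\<in>{1..n}. \<forall>j\<in>{1..n}. i \<le> j \<longrightarrow> w n j \<omega> \<le> w n i \<omega>) \<or>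
       gt = g_tilde_plus P \<and> \<beta> = width_plus \<and>
       (\<forall>n. AE \<omega> in M n. \<forall>i\<in>{1..n}. \<forall>j\<in>{1..n}. i \<le> j \<longrightarrow> w n i \<omega> \<le> w n j \<omega>)"
    using LLN unfolding \<beta>_def by (auto simp only: LLN_minus_def LLN_plus_def if_True if_False simp_thms split: if_split)
  then have bc: "boundary_case gt \<beta>" by (auto simp: boundary_case_def)
  have abs': "\<bar>laplace' P t\<bar> = moment 1 t" if "0 \<le> t" for t
    using laplace'_eq[OF that] moment_pos[of t 1] that by (simp del: One_nat_def)
  have dens: "probability_density (dens P gt t)" if "0 \<le> t" for t
    by (rule probability_density_dens[OF bc that])
  have limits: "weak_conv_m
           (\<lambda>n. distr (M n) borel
              (\<lambda>\<omega>. real (search_cost n (\<pi> n) (\<lambda>i. T n i \<omega>) (real n * \<mu> * t)) / real n))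
           (law_S t) \<and>
         (\<lambda>n. measure (M n)
              {\<omega> \<in> space (M n). search_cost_out n (\<pi> n) (\<lambda>i. T n i \<omega>) (real n * \<mu> * t) > 0})
           \<longlonglongrightarrow> moment 1 t / \<mu>" if t: "0 < t" for t
  proof -
    interpret sorted_request_sequence P \<mu> M w \<pi> T gt \<beta> t
    proof (intro sorted_request_sequence.intro request_sequence.intro request_sequence_axioms.intro
          sorted_request_sequence_axioms.intro mean_law_axioms)
    qed (fact chain LLN' initial sorted t)+
    show ?thesis
      using search_cost_weak_conv search_cost_out_tendsto unfolding law_S cost_def[abs_def] by blast
  qed
  have tail: "measure (law_S t) {1 - laplace P t<..} = moment 1 t / \<mu>"
    "measure law_Sinf {1 - laplace P t<..} = moment 1 t / \<mu>" if "0 \<le> t" for t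
    using measure_law_tail[OF bc that] measure_law_inf_greaterThan[OF that] by (simp_all only: law_S law_Sinf)
  have tv: "tv_norm_diff (law_S t) law_Sinf \<le> 2 * (moment 1 t / \<mu>)" if "0 \<le> t" for t
    using tv_law_le[OF bc that] by (simp only: law_S law_Sinf)
  show ?thesis
    using probability_density_dens_inf dens limits tail tv abs' by (simp add: less_imp_le del: One_nat_def)
qed

end
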